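(* Assume the setting described in the context. For any $\alpha,\beta\in\mathbb{N}\cup\{0\}$, any $h,k\ge1$ and any indices $i_1,\dots,i_h,j_1,\dots,j_k\in\{1,\dots,m\}$, the following hold for $(t,x)\neq(s,y)$ in $\mathbb{R}^{1+n}$, where $\tau$ denotes the time variable of functions on $\mathbb{R}^{1+N}=\mathbb{R}_\tau\times\mathbb{R}^N$ and the $Z_i$ act on the $\mathbb{R}^N$ variables: $$\partial_s^\alpha\partial_t^\beta X^y_{i_1}\cdots X^y_{i_h}\Gamma(t,x;s,y)=(-1)^\beta\int_{\mathbb{R}^p}\big(\partial_\tau^{\alpha+\beta}Z_{i_1}\cdots Z_{i_h}\gamma_{\mathbb{G}}\big)\big(s-t,(x,0)^{-1}\star(y,\eta)\big)\,d\eta;$$ $$\partial_s^\alpha\partial_t^\beta X^x_{j_1}\cdots X^x_{j_k}\Gamma(t,x;s,y)=(-1)^\beta\int_{\mathbb{R}^p}\big(\partial_\tau^{\alpha+\beta}Z_{j_1}\cdots Z_{j_k}\gamma_{\mathbb{G}}\big)\big(s-t,(y,0)^{-1}\star(x,\eta)\big)\,d\eta;$$ $$\partial_s^\alpha\partial_t^\beta X^x_{j_1}\cdots X^x_{j_k}X^y_{i_1}\cdots X^y_{i_h}\Gamma(t,x;s,y)=(-1)^\beta\int_{\mathbb{R}^p}\Big(\partial_\tau^{\alpha+\beta}Z_{j_1}\cdots Z_{j_k}\big((Z_{i_1}\cdots Z_{i_h}\gamma_{\mathbb{G}})\circ\tilde\iota\big)\Big)\big(s-t,(y,0)^{-1}\star(x,\eta)\big)\,d\eta,$$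 where $\tilde\iota:\mathbb{R}^{1+N}\to\mathbb{R}^{1+N}$, $\tilde\iota(\tau,(x,\xi))=(\tau,(x,\xi)^{-1})$, with $(x,\xi)^{-1}$ the inverse in $\mathbb{G}$. Here $X^x_j$, $X^y_j$ denote $X_j$ acting in the $x$, resp. $y$, variable.
   Context: Let $X_1,\dots,X_m$ be smooth vector fields on $\mathbb{R}^n$, linearly independent in the vector space of smooth vector fields on $\mathbb{R}^n$, satisfying: (H.1) there are reals $1=\sigma_1\le\dots\le\sigma_n$ such that, with $\delta_\lambda(x)=(\lambda^{\sigma_1}x_1,\dots,\lambda^{\sigma_n}x_n)$, every $X_j$ is $\delta_\lambda$-homogeneous of degree 1, i.e. $X_j(f\circ\delta_\lambda)=\lambda(X_jf)\circ\delta_\lambda$ for all $\lambda>0$, $f\in C^\infty(\mathbb{R}^n)$; (H.2) $\dim\{Y(0):Y\in\mathrm{Lie}\{X_1,\dots,X_m\}\}=n$, where $\mathrm{Lie}\{\cdot\}$ is the smallest Lie subalgebra of smooth vector fields containing the $X_j$. Let $N=\dim\mathrm{Lie}\{X_1,\dots,X_m\}$, assume $N>n$, set $p=N-n$. Fix a homogeneous Carnot group $\mathbb{G}=(\mathbb{R}^N,\star)$ on $\mathbb{R}^N=\mathbb{R}^n_x\times\mathbb{R}^p_\xi$ with dilations $D_\lambda(x,\xi)=(\delta_\lambda(x),\delta^*_\lambda(\xi))$, $\delta^*_\lambda(\xi)=(\lambda^{\sigma^*_1}\xi_1,\dots,\lambda^{\sigma^*_p}\xi_p)$, and left-invariant,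 $D_\lambda$-homogeneous of degree 1 vector fields $Z_1,\dots,Z_m$ Lie-generating the Lie algebra of $\mathbb{G}$ such that each $Z_i$ lifts $X_i$: $Z_i(f\circ\pi)(x,\xi)=(X_if)(x)$ for all $f\in C^\infty(\mathbb{R}^n)$, $\pi(x,\xi)=x$ (such objects exist). Let $\mathcal{H}_{\mathbb{G}}=\sum_{j=1}^mZ_j^2-\partial_\tau$ on $\mathbb{R}^{1+N}$ and let $\gamma_{\mathbb{G}}$ be the unique fundamental solution of $\mathcal{H}_{\mathbb{G}}$ with pole at the origin vanishing at infinity (smooth away from the origin, and $\gamma_{\mathbb{G}}(s-t,(x,\xi)^{-1}\star(y,\eta))$ is a global fundamental solution of $\mathcal{H}_{\mathbb{G}}$). Define $\Gamma(t,x;s,y)=\int_{\mathbb{R}^p}\gamma_{\mathbb{G}}(s-t,(x,0)^{-1}\star(y,\eta))\,d\eta$; it is the global fundamental solution of $\mathcal{H}=\sum_jX_j^2-\partial_t$ on $\mathbb{R}^{1+n}$. *)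

theory Defs
  imports "HOL-Analysis.Analysis"
begin

text \<open>C-infinity on a set S (used with S open): differentiable at every point of S,
  and every directional derivative is again C-infinity on S.\<close>
coinductive Cinf_on :: "'a::euclidean_space set \<Rightarrow> ('a \<Rightarrow> 'b::euclidean_space) \<Rightarrow> bool"
  for S where
  "(\<forall>x\<in>S. f differentiable (at x)) \<Longrightarrow>
   (\<forall>v. Cinf_on S (\<lambda>x. frechet_derivative f (at x) v)) \<Longrightarrow> Cinf_on S f"

text \<open>A vector field is given by its coefficient function V; it acts on f by
  (V f)(x) = Df(x)(V(x)) = sum_k V_k(x) d_k f(x).\<close>
definition vf_app :: "('a::euclidean_space \<Rightarrow> 'a) \<Rightarrow> ('a \<Rightarrow> real) \<Rightarrow> 'a \<Rightarrow> real" where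
  "vf_app V f x = frechet_derivative f (at x) (V x)"

definition lie_br :: "('a::euclidean_space \<Rightarrow> 'a) \<Rightarrow> ('a \<Rightarrow> 'a) \<Rightarrow> 'a \<Rightarrow> 'a" where
  "lie_br V W = (\<lambda>x. frechet_derivative W (at x) (V x) - frechet_derivative V (at x) (W x))"

inductive_set lie_gen :: "('a::euclidean_space \<Rightarrow> 'a) set \<Rightarrow> ('a \<Rightarrow> 'a) set" for A where
  gen: "V \<in> A \<Longrightarrow> V \<in> lie_gen A"
| zero: "(\<lambda>x. 0) \<in> lie_gen A"
| add: "V \<in> lie_gen A \<Longrightarrow> W \<in> lie_gen A \<Longrightarrow> (\<lambda>x. V x + W x) \<in> lie_gen A"
| scale: "V \<in> lie_gen A \<Longrightarrow> (\<lambda>x. c *\<^sub>R V x) \<in> lie_gen A"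
| br: "V \<in> lie_gen A \<Longrightarrow> W \<in> lie_gen A \<Longrightarrow> lie_br V W \<in> lie_gen A"

definition fun_lin_indep :: "('a \<Rightarrow> 'b::real_vector) list \<Rightarrow> bool" where
  "fun_lin_indep vs \<longleftrightarrow>
     (\<forall>c. (\<forall>x. (\<Sum>i<length vs. c i *\<^sub>R (vs ! i) x) = 0) \<longrightarrow> (\<forall>i<length vs. c i = 0))"

definition fun_span :: "('a \<Rightarrow> 'b::real_vector) list \<Rightarrow> ('a \<Rightarrow> 'b) set" where
  "fun_span vs = {(\<lambda>x. \<Sum>i<length vs. c i *\<^sub>R (vs ! i) x) | c. True}"

definition has_fun_dim :: "('a \<Rightarrow> 'b::real_vector) set \<Rightarrow> nat \<Rightarrow> bool" where
  "has_fun_dim L d \<longleftrightarrow>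
     (\<exists>vs. length vs = d \<and> set vs \<subseteq> L \<and> fun_lin_indep vs \<and> L \<subseteq> fun_span vs)"

definition dil :: "('i::finite \<Rightarrow> real) \<Rightarrow> real \<Rightarrow> real^'i \<Rightarrow> real^'i" where
  "dil sg lam x = (\<chi> i. lam powr sg i * x $ i)"

definition left_inv :: "('g::euclidean_space \<Rightarrow> 'g \<Rightarrow> 'g) \<Rightarrow> ('g \<Rightarrow> 'g) \<Rightarrow> bool" where
  "left_inv star V \<longleftrightarrow>
     (\<forall>f g z. Cinf_on UNIV f \<longrightarrow> vf_app V (\<lambda>w. f (star g w)) z = vf_app V f (star g z))"

definition homog1 :: "(real \<Rightarrow> 'a::euclidean_space \<Rightarrow> 'a) \<Rightarrow> ('a \<Rightarrow> 'a) \<Rightarrow> bool" where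
  "homog1 D V \<longleftrightarrow>
     (\<forall>lam f z. lam > 0 \<longrightarrow> Cinf_on UNIV f \<longrightarrow>
        vf_app V (\<lambda>w. f (D lam w)) z = lam * vf_app V f (D lam z))"

definition dtau :: "(real \<times> 'g::euclidean_space \<Rightarrow> real) \<Rightarrow> real \<times> 'g \<Rightarrow> real" where
  "dtau g = (\<lambda>(\<tau>, z). deriv (\<lambda>\<tau>'. g (\<tau>', z)) \<tau>)"

definition zop :: "('g::euclidean_space \<Rightarrow> 'g) \<Rightarrow> (real \<times> 'g \<Rightarrow> real) \<Rightarrow> real \<times> 'g \<Rightarrow> real" where
  "zop V g = (\<lambda>(\<tau>, z). frechet_derivative (\<lambda>z'. g (\<tau>, z')) (at z) (V z))"

definition vf_div :: "('g::euclidean_space \<Rightarrow> 'g) \<Rightarrow> 'g \<Rightarrow> real" where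
  "vf_div V z = (\<Sum>e\<in>Basis. frechet_derivative V (at z) e \<bullet> e)"

text \<open>Formal (Lebesgue) transpose of the vector field V: V^T phi = - div(phi V).\<close>
definition ztrans :: "('g::euclidean_space \<Rightarrow> 'g) \<Rightarrow> (real \<times> 'g \<Rightarrow> real) \<Rightarrow> real \<times> 'g \<Rightarrow> real" where
  "ztrans V phi = (\<lambda>\<zeta>. - (zop V phi \<zeta> + vf_div V (snd \<zeta>) * phi \<zeta>))"

text \<open>Transpose of H_G = sum_j Z_j^2 - d_tau.\<close>
definition heat_transpose ::
  "nat \<Rightarrow> (nat \<Rightarrow> 'g::euclidean_space \<Rightarrow> 'g) \<Rightarrow> (real \<times> 'g \<Rightarrow> real) \<Rightarrow> real \<times> 'g \<Rightarrow> real" where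
  "heat_transpose m Z phi = (\<lambda>\<zeta>. (\<Sum>j=1..m. ztrans (Z j) (ztrans (Z j) phi) \<zeta>) + dtau phi \<zeta>)"

text \<open>gam is a fundamental solution of H_G with pole at the origin:
  locally integrable and H_G gam = - Dirac_0 in the sense of distributions.\<close>
definition fund_sol_origin ::
  "nat \<Rightarrow> (nat \<Rightarrow> 'g::euclidean_space \<Rightarrow> 'g) \<Rightarrow> (real \<times> 'g \<Rightarrow> real) \<Rightarrow> bool" where
  "fund_sol_origin m Z gam \<longleftrightarrow>
     (\<forall>K. compact K \<longrightarrow> set_integrable lborel K gam) \<and>
     (\<forall>phi. Cinf_on UNIV phi \<and> compact (closure {\<zeta>. phi \<zeta> \<noteq> 0}) \<longrightarrow>
        (\<integral>\<zeta>. gam \<zeta> * heat_transpose m Z phi \<zeta> \<partial>lborel) = - phi 0)"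

datatype 'v dop = DT | DS | DX 'v | DY 'v

type_synonym 'n F4 = "real \<times> (real^'n) \<times> real \<times> (real^'n) \<Rightarrow> real"

fun apply_dop :: "(real^'n \<Rightarrow> (real^'n)) dop \<Rightarrow> 'n::finite F4 \<Rightarrow> 'n F4" where
  "apply_dop DT F = (\<lambda>(t, x, s, y). deriv (\<lambda>t'. F (t', x, s, y)) t)"
| "apply_dop DS F = (\<lambda>(t, x, s, y). deriv (\<lambda>s'. F (t, x, s', y)) s)"
| "apply_dop (DX V) F = (\<lambda>(t, x, s, y). frechet_derivative (\<lambda>x'. F (t, x', s, y)) (at x) (V x))"
| "apply_dop (DY V) F = (\<lambda>(t, x, s, y). frechet_derivative (\<lambda>y'. F (t, x, s, y')) (at y) (V y))"

fun dop_exists :: "(real^'n \<Rightarrow> (real^'n)) dop \<Rightarrow> 'n::finite F4 \<Rightarrow> real \<times> (real^'n) \<times> real \<times> (real^'n) \<Rightarrow> bool" where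
  "dop_exists DT F (t, x, s, y) = ((\<lambda>t'. F (t', x, s, y)) differentiable (at t))"
| "dop_exists DS F (t, x, s, y) = ((\<lambda>s'. F (t, x, s', y)) differentiable (at s))"
| "dop_exists (DX V) F (t, x, s, y) = ((\<lambda>x'. F (t, x', s, y)) differentiable (at x))"
| "dop_exists (DY V) F (t, x, s, y) = ((\<lambda>y'. F (t, x, s, y')) differentiable (at y))"

fun apply_ops :: "(real^'n \<Rightarrow> (real^'n)) dop list \<Rightarrow> 'n::finite F4 \<Rightarrow> 'n F4" where
  "apply_ops [] F = F"
| "apply_ops (d # ds) F = apply_dop d (apply_ops ds F)"

fun ops_exist :: "(real \<times> (real^'n) \<times> real \<times> (real^'n) \<Rightarrow> bool) \<Rightarrow> (real^'n \<Rightarrow> (real^'n)) dop list \<Rightarrow> 'n::finite F4 \<Rightarrow> bool" where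
  "ops_exist W [] F = True"
| "ops_exist W (d # ds) F = (ops_exist W ds F \<and> (\<forall>p. W p \<longrightarrow> dop_exists d (apply_ops ds F) p))"

end

theory Submission
  imports Defs
begin

text \<open>A fundamental solution of the heat operator vanishing at infinity is unique: the difference of the
  potentials of two of them solves the homogeneous equation, and a perturbation by \<open>arctan \<tau>\<close> gives a maximum
  principle for it. Uniqueness forces \<open>gam\<close> to be homogeneous of degree \<open>-Q\<close> under the dilations and invariant
  under \<open>z \<mapsto> z\<^sup>-\<^sup>1\<close>. Homogeneity alone then controls all fibre integrals: dyadic rescaling bounds every
  derivative of the kernel by an integrable function of \<open>\<eta>\<close>, so one may differentiate under the integral sign.
  Right translations preserve the fibres of \<open>\<pi>\<close> and their Lebesgue measure, which turns \<open>X\<^sub>j\<close> acting on the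
  fibre integral into \<open>Z\<^sub>j\<close> acting on the kernel; inversion exchanges the roles of \<open>x\<close> and \<open>y\<close>.\<close>

section \<open>Smooth functions\<close>

text \<open>Nothing quantitative is assumed about \<open>gam\<close>: it is locally integrable,
  smooth off the origin and tends to 0 at infinity. The decay needed for integrals over R^p has to
  be extracted from uniqueness. Homogeneity of degree -Q, with Q the sum of all space weights,
  suffices: on a fibre the volume of dyadic boxes grows with the sum of the fibre weights alone,
  which is smaller than Q by the sum of the \<open>\<sigma>\<close>, and every differentiation
  lowers the degree further. That right translations respect the fibres rests on Lie generation. The
  generators \<open>Z j\<close> project to R^n, projectable fields are closed under brackets, and so
  every left-invariant field projects. \<open>X j\<close> in the variable y becomes
  \<open>Z j\<close> directly. For the variable x the fibre is reparametrised so that x takes the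
  place of y, and this composes the kernel with inversion in G. For \<open>gam\<close> itself the
  inversion is absorbed by symmetry; once derivatives in y have been taken it stays, and this is the
  origin of \<open>(\<tau>, z) \<mapsto> (\<tau>, ginv z)\<close> in the mixed formula.\<close>

fun Ck_on :: "nat \<Rightarrow> 'a::euclidean_space set \<Rightarrow> ('a \<Rightarrow> 'b::euclidean_space) \<Rightarrow> bool" where
  "Ck_on 0 S f = continuous_on S f"
| "Ck_on (Suc n) S f = ((\<forall>x\<in>S. f differentiable (at x)) \<and>
     (\<forall>v. Ck_on n S (\<lambda>x. frechet_derivative f (at x) v)))"

lemma Ck_on_Suc_imp: "Ck_on (Suc n) S f \<Longrightarrow> Ck_on n S f"
proof (induction n arbitrary: f)
  case 0
  then show ?case
    by (auto intro!: continuous_at_imp_continuous_on differentiable_imp_continuous_within)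
next
  case (Suc n)
  then show ?case by (metis Ck_on.simps(2))
qed

lemma Cinf_on_imp_Ck_on: "Cinf_on S f \<Longrightarrow> Ck_on n S f"
proof (induction n arbitrary: f)
  case 0
  then have "\<forall>x\<in>S. f differentiable (at x)" by (auto elim: Cinf_on.cases)
  then show ?case
    by (auto intro!: continuous_at_imp_continuous_on differentiable_imp_continuous_within)
next
  case (Suc n)
  then show ?case by (auto elim: Cinf_on.cases)
qed

text \<open>The derivative of a product or of a composite is a sum of such expressions, so a direct
  coinduction on \<open>Cinf_on\<close> would have to close up under sums as well. Closure
  properties are instead proved for \<open>Ck_on\<close> by induction on the order and transferred
  by this equivalence.\<close>

lemma Cinf_on_iff_Ck_on: "Cinf_on S f \<longleftrightarrow> (\<forall>n. Ck_on n S f)"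
proof
  assume "\<forall>n. Ck_on n S f"
  then show "Cinf_on S f"
  proof (coinduction arbitrary: f)
    case Cinf_on
    then have "Ck_on (Suc n) S f" for n by blast
    then show ?case by auto
  qed
qed (blast intro: Cinf_on_imp_Ck_on)

lemma Cinf_on_differentiable: "Cinf_on S f \<Longrightarrow> x \<in> S \<Longrightarrow> f differentiable (at x)"
  by (auto elim: Cinf_on.cases)

lemma Cinf_on_has_derivative:
  "Cinf_on S f \<Longrightarrow> x \<in> S \<Longrightarrow> (f has_derivative frechet_derivative f (at x)) (at x)"
  using Cinf_on_differentiable frechet_derivative_works by blast

lemma Cinf_on_frechet: "Cinf_on S f \<Longrightarrow> Cinf_on S (\<lambda>x. frechet_derivative f (at x) v)"
  by (auto elim: Cinf_on.cases)

lemma Cinf_on_continuous: "Cinf_on S f \<Longrightarrow> continuous_on S f"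
  using Cinf_on_imp_Ck_on[of S f 0] by simp

lemma frechet_derivative_cong_open:
  assumes "open S" "x \<in> S" "\<And>y. y \<in> S \<Longrightarrow> f y = g y"
  shows "frechet_derivative f (at x) = frechet_derivative g (at x)"
proof -
  have "(f has_derivative D) (at x) \<longleftrightarrow> (g has_derivative D) (at x)" for D
    using assms by (metis has_derivative_transform_within_open)
  then show ?thesis unfolding frechet_derivative_def by simp
qed

lemma differentiable_cong_open:
  assumes "open S" "x \<in> S" "\<And>y. y \<in> S \<Longrightarrow> f y = g y"
  shows "f differentiable (at x) \<longleftrightarrow> g differentiable (at x)"
  using assms unfolding differentiable_def by (metis has_derivative_transform_within_open)

lemma Ck_on_cong:
  assumes "open S" "\<And>y. y \<in> S \<Longrightarrow> f y = g y"
  shows "Ck_on n S f \<longleftrightarrow> Ck_on n S g"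
  using assms(2)
proof (induction n arbitrary: f g)
  case 0 then show ?case by (simp cong: continuous_on_cong)
next
  case (Suc n)
  have "Ck_on n S (\<lambda>x. frechet_derivative f (at x) v) = Ck_on n S (\<lambda>x. frechet_derivative g (at x) v)" for v
    by (rule Suc.IH) (metis Suc.prems assms(1) frechet_derivative_cong_open)
  moreover have "(\<forall>x\<in>S. f differentiable (at x)) = (\<forall>x\<in>S. g differentiable (at x))"
    using Suc.prems assms(1) differentiable_cong_open by metis
  ultimately show ?case by simp
qed

lemma Cinf_on_cong:
  assumes "open S" "\<And>y. y \<in> S \<Longrightarrow> f y = g y"
  shows "Cinf_on S f \<longleftrightarrow> Cinf_on S g"
  using Ck_on_cong[OF assms] by (simp add: Cinf_on_iff_Ck_on)

lemma Ck_on_subset: "Ck_on n S f \<Longrightarrow> T \<subseteq> S \<Longrightarrow> Ck_on n T f"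
  by (induction n arbitrary: f) (auto intro: continuous_on_subset)

lemma Cinf_on_subset: "Cinf_on S f \<Longrightarrow> T \<subseteq> S \<Longrightarrow> Cinf_on T f"
  by (meson Ck_on_subset Cinf_on_iff_Ck_on)

lemma frechet_derivative_eqI: "(f has_derivative f') (at x) \<Longrightarrow> frechet_derivative f (at x) v = f' v"
  using frechet_derivative_at by metis

lemma Ck_on_const: "Ck_on n S (\<lambda>x. c)"
  by (induction n arbitrary: c) auto

lemma Ck_on_bounded_linear:
  assumes "bounded_linear f" shows "Ck_on n S f"
proof (cases n)
  case 0 then show ?thesis by (simp add: assms linear_continuous_on)
next
  case (Suc k)
  have "(f has_derivative f) (at x)" for x by (simp add: assms bounded_linear_imp_has_derivative)
  then have "frechet_derivative f (at x) v = f v" for x v by (rule frechet_derivative_eqI)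
  then show ?thesis using Suc Ck_on_const
    by (auto intro: bounded_linear_imp_differentiable[OF assms])
qed

lemma Ck_on_add:
  assumes S: "open S" and "Ck_on n S f" "Ck_on n S g" shows "Ck_on n S (\<lambda>x. f x + g x)"
  using assms(2,3)
proof (induction n arbitrary: f g)
  case 0 then show ?case by (simp add: continuous_on_add)
next
  case (Suc n)
  have "frechet_derivative (\<lambda>x. f x + g x) (at x) v = frechet_derivative f (at x) v + frechet_derivative g (at x) v"
    if "x \<in> S" for x v
    using Suc.prems that by (auto intro!: frechet_derivative_eqI has_derivative_add simp: frechet_derivative_works)
  then have "Ck_on n S (\<lambda>x. frechet_derivative (\<lambda>x. f x + g x) (at x) v)" for v
    by (subst Ck_on_cong[OF S]) (use Suc in auto)
  then show ?case using Suc.prems by auto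
qed

lemma Ck_on_sum:
  assumes S: "open S" and "\<And>i. i \<in> I \<Longrightarrow> Ck_on n S (f i)" shows "Ck_on n S (\<lambda>x. \<Sum>i\<in>I. f i x)"
  using assms(2) by (induction I rule: infinite_finite_induct) (auto intro: Ck_on_const Ck_on_add[OF S])

lemma Ck_on_bilinear:
  assumes B: "bounded_bilinear B" and S: "open S"
    and "Ck_on n S f" "Ck_on n S g" shows "Ck_on n S (\<lambda>x. B (f x) (g x))"
  using assms(3,4)
proof (induction n arbitrary: f g)
  case 0 then show ?case using bounded_bilinear.continuous_on[OF B] by simp
next
  case (Suc n)
  have hd: "((\<lambda>x. B (f x) (g x)) has_derivative
     (\<lambda>v. B (f x) (frechet_derivative g (at x) v) + B (frechet_derivative f (at x) v) (g x))) (at x)"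
    if "x \<in> S" for x
    using Suc.prems that by (auto intro!: bounded_bilinear.FDERIV[OF B] simp: frechet_derivative_works)
  have "Ck_on n S (\<lambda>x. frechet_derivative (\<lambda>x. B (f x) (g x)) (at x) v)" for v
  proof (subst Ck_on_cong[OF S])
    show "Ck_on n S (\<lambda>x. B (f x) (frechet_derivative g (at x) v) + B (frechet_derivative f (at x) v) (g x))"
      using Suc.prems by (intro Ck_on_add[OF S] Suc.IH) (auto intro: Ck_on_Suc_imp)
  qed (use hd in \<open>auto intro!: frechet_derivative_eqI\<close>)
  then show ?case using hd by (auto intro: differentiableI)
qed

lemma linear_eq_sum_Basis:
  fixes D :: "'a::euclidean_space \<Rightarrow> 'b::real_vector"
  assumes "linear D" shows "D v = (\<Sum>b\<in>Basis. (v \<bullet> b) *\<^sub>R D b)"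
proof -
  have "D v = D (\<Sum>b\<in>Basis. (v \<bullet> b) *\<^sub>R b)" by (simp add: euclidean_representation)
  also have "\<dots> = (\<Sum>b\<in>Basis. (v \<bullet> b) *\<^sub>R D b)"
    using assms by (simp add: linear_sum linear_scale)
  finally show ?thesis .
qed

lemma Ck_on_compose:
  assumes S: "open S" and "Ck_on n T f" "Ck_on n S g" "\<And>x. x \<in> S \<Longrightarrow> g x \<in> T"
  shows "Ck_on n S (\<lambda>x. f (g x))"
  using assms(2-4)
proof (induction n arbitrary: f g)
  case 0 then show ?case
    using continuous_on_compose2[of T f S g] by auto
next
  case (Suc n)
  \<comment> \<open>The chain rule applies the derivative of \<open>f\<close> in a direction that
    moves with \<open>x\<close>, whereas \<open>Ck_on\<close> speaks of fixed directions. Expanding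
    the direction in the basis gives a sum of products whose factors are covered by the assumptions
    and the induction hypothesis.\<close>
  define F where "F v x = (\<Sum>b\<in>Basis. (frechet_derivative g (at x) v \<bullet> b) *\<^sub>R frechet_derivative f (at (g x)) b)" for v x
  have hd: "((\<lambda>x. f (g x)) has_derivative (\<lambda>v. F v x)) (at x)" if "x \<in> S" for x
  proof -
    have g: "(g has_derivative frechet_derivative g (at x)) (at x)"
      using Suc.prems(2) that frechet_derivative_works by (metis Ck_on.simps(2))
    have f: "(f has_derivative frechet_derivative f (at (g x))) (at (g x))"
      using Suc.prems(1,3) that frechet_derivative_works by (metis Ck_on.simps(2))
    have "frechet_derivative f (at (g x)) (frechet_derivative g (at x) v) = F v x" for v
      unfolding F_def by (rule linear_eq_sum_Basis) (use f has_derivative_linear in auto)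
    then show ?thesis using has_derivative_compose[OF g f] by simp
  qed
  have "Ck_on n S (\<lambda>x. frechet_derivative (\<lambda>x. f (g x)) (at x) v)" for v
  proof (subst Ck_on_cong[OF S])
    show "Ck_on n S (F v)" unfolding F_def
    proof (intro Ck_on_sum[OF S] Ck_on_bilinear[OF bounded_bilinear_scaleR S] Suc.IH
        Ck_on_bilinear[OF bounded_bilinear_inner S] Ck_on_const)
      show "Ck_on n S g" using Suc.prems Ck_on_Suc_imp by blast
    qed (use Suc.prems in auto)
  qed (use hd in \<open>auto intro!: frechet_derivative_eqI\<close>)
  then show ?case using hd by (auto intro: differentiableI)
qed

named_theorems Cinf_intros

lemma Cinf_on_const [Cinf_intros]: "Cinf_on S (\<lambda>x. c)"
  by (simp add: Cinf_on_iff_Ck_on Ck_on_const)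

lemma Cinf_on_bounded_linear: "bounded_linear f \<Longrightarrow> Cinf_on S f"
  by (simp add: Cinf_on_iff_Ck_on Ck_on_bounded_linear)

lemma Cinf_on_ident [Cinf_intros]: "Cinf_on S (\<lambda>x. x)"
  by (intro Cinf_on_bounded_linear bounded_linear_ident)

lemma Cinf_on_compose:
  "open S \<Longrightarrow> Cinf_on T f \<Longrightarrow> Cinf_on S g \<Longrightarrow> (\<And>x. x \<in> S \<Longrightarrow> g x \<in> T) \<Longrightarrow> Cinf_on S (\<lambda>x. f (g x))"
  by (simp add: Cinf_on_iff_Ck_on) (blast intro: Ck_on_compose)

lemma Cinf_on_compose_UNIV:
  "open S \<Longrightarrow> Cinf_on UNIV f \<Longrightarrow> Cinf_on S g \<Longrightarrow> Cinf_on S (\<lambda>x. f (g x))"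
  by (rule Cinf_on_compose) auto

lemma Cinf_on_linear_compose:
  "bounded_linear f \<Longrightarrow> open S \<Longrightarrow> Cinf_on S g \<Longrightarrow> Cinf_on S (\<lambda>x. f (g x))"
  by (rule Cinf_on_compose_UNIV) (auto intro: Cinf_on_bounded_linear)

lemma Cinf_on_add [Cinf_intros]:
  "open S \<Longrightarrow> Cinf_on S f \<Longrightarrow> Cinf_on S g \<Longrightarrow> Cinf_on S (\<lambda>x. f x + g x)"
  by (simp add: Cinf_on_iff_Ck_on Ck_on_add)

lemma Cinf_on_sum [Cinf_intros]:
  "open S \<Longrightarrow> (\<And>i. i \<in> I \<Longrightarrow> Cinf_on S (f i)) \<Longrightarrow> Cinf_on S (\<lambda>x. \<Sum>i\<in>I. f i x)"
  by (simp add: Cinf_on_iff_Ck_on Ck_on_sum)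

lemma Cinf_on_scaleR [Cinf_intros]:
  "open S \<Longrightarrow> Cinf_on S f \<Longrightarrow> Cinf_on S g \<Longrightarrow> Cinf_on S (\<lambda>x. f x *\<^sub>R g x)"
  by (simp add: Cinf_on_iff_Ck_on Ck_on_bilinear[OF bounded_bilinear_scaleR])

lemma Cinf_on_mult [Cinf_intros]:
  fixes f g :: "'a::euclidean_space \<Rightarrow> real"
  shows "open S \<Longrightarrow> Cinf_on S f \<Longrightarrow> Cinf_on S g \<Longrightarrow> Cinf_on S (\<lambda>x. f x * g x)"
  using Cinf_on_scaleR[of S f g] by simp

lemma Cinf_on_inner [Cinf_intros]:
  "open S \<Longrightarrow> Cinf_on S f \<Longrightarrow> Cinf_on S g \<Longrightarrow> Cinf_on S (\<lambda>x. f x \<bullet> g x)"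
  by (simp add: Cinf_on_iff_Ck_on Ck_on_bilinear[OF bounded_bilinear_inner])

lemma Cinf_on_minus [Cinf_intros]: "open S \<Longrightarrow> Cinf_on S f \<Longrightarrow> Cinf_on S (\<lambda>x. - f x)"
  by (rule Cinf_on_linear_compose[OF bounded_linear_minus[OF bounded_linear_ident]])

lemma Cinf_on_diff [Cinf_intros]:
  "open S \<Longrightarrow> Cinf_on S f \<Longrightarrow> Cinf_on S g \<Longrightarrow> Cinf_on S (\<lambda>x. f x - g x)"
  using Cinf_on_add[of S f "\<lambda>x. - g x"] Cinf_on_minus[of S g] by simp

lemma Cinf_on_fst [Cinf_intros]: "open S \<Longrightarrow> Cinf_on S f \<Longrightarrow> Cinf_on S (\<lambda>x. fst (f x))"
  by (rule Cinf_on_linear_compose[OF bounded_linear_fst])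

lemma Cinf_on_snd [Cinf_intros]: "open S \<Longrightarrow> Cinf_on S f \<Longrightarrow> Cinf_on S (\<lambda>x. snd (f x))"
  by (rule Cinf_on_linear_compose[OF bounded_linear_snd])

lemma Cinf_on_Pair [Cinf_intros]:
  assumes "open S" "Cinf_on S f" "Cinf_on S g" shows "Cinf_on S (\<lambda>x. (f x, g x))"
proof -
  have "Cinf_on S (\<lambda>x. (f x, 0) + (0, g x))"
    by (intro Cinf_on_add assms Cinf_on_linear_compose[where g=f] Cinf_on_linear_compose[where g=g]
        bounded_linear_Pair bounded_linear_ident bounded_linear_zero)
  then show ?thesis by simp
qed

text \<open>This makes \<open>Cinf_on\<close> usable for vector fields, whose direction varies with
  the point; the basis expansion reduces them to fixed directions.\<close>

lemma Cinf_on_frechet_app [Cinf_intros]: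
  assumes S: "open S" and T: "open T" and f: "Cinf_on T f" and g: "Cinf_on S g" and V: "Cinf_on S V"
    and "\<And>x. x \<in> S \<Longrightarrow> g x \<in> T"
  shows "Cinf_on S (\<lambda>x. frechet_derivative f (at (g x)) (V x))"
proof (subst Cinf_on_cong[OF S])
  show "frechet_derivative f (at (g y)) (V y) = (\<Sum>b\<in>Basis. (V y \<bullet> b) *\<^sub>R frechet_derivative f (at (g y)) b)"
    if "y \<in> S" for y
    by (rule linear_eq_sum_Basis) (metis Cinf_on_has_derivative assms(6) f has_derivative_linear that)
  show "Cinf_on S (\<lambda>y. \<Sum>b\<in>Basis. (V y \<bullet> b) *\<^sub>R frechet_derivative f (at (g y)) b)"
    by (intro Cinf_intros S V Cinf_on_compose[OF S _ g, of T] Cinf_on_frechet f assms(6))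
qed

lemma has_derivative_slice_snd:
  assumes "(f has_derivative f') (at (a, b))"
  shows "((\<lambda>y. f (a, y)) has_derivative (\<lambda>v. f' (0, v))) (at b)"
  by (rule has_derivative_compose[of "\<lambda>y. (a, y)" "\<lambda>v. (0, v)" _ _ f f'])
    (auto intro!: derivative_eq_intros assms)

lemma has_derivative_slice_fst:
  assumes "(f has_derivative f') (at (a, b))"
  shows "((\<lambda>x. f (x, b)) has_derivative (\<lambda>v. f' (v, 0))) (at a)"
  by (rule has_derivative_compose[of "\<lambda>x. (x, b)" "\<lambda>v. (v, 0)" _ _ f f'])
    (auto intro!: derivative_eq_intros assms)

lemma linear_frechet_derivative: "f differentiable (at x) \<Longrightarrow> linear (frechet_derivative f (at x))"
  using frechet_derivative_works has_derivative_linear by blast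

section \<open>Weighted dilations\<close>

text \<open>Stated over the \<open>Basis\<close> of an arbitrary Euclidean space, so that one notion
  covers the base, the fibre, the group, time, and the products of these that serve as parameter
  spaces.\<close>

definition wdil :: "('a::euclidean_space \<Rightarrow> real) \<Rightarrow> real \<Rightarrow> 'a \<Rightarrow> 'a" where
  "wdil w l z = (\<Sum>e\<in>Basis. (l powr w e * (z \<bullet> e)) *\<^sub>R e)"

definition pos_wt :: "('a::euclidean_space \<Rightarrow> real) \<Rightarrow> bool" where
  "pos_wt w \<longleftrightarrow> (\<forall>e\<in>Basis. w e > 0)"

lemma wdil_inner [simp]: "e \<in> Basis \<Longrightarrow> wdil w l z \<bullet> e = l powr w e * (z \<bullet> e)"
  by (simp add: wdil_def)

lemma wdil_Basis: "e \<in> Basis \<Longrightarrow> wdil w l e = l powr w e *\<^sub>R e"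
  by (rule euclidean_eqI) (auto simp: inner_Basis)

lemma linear_wdil: "linear (wdil w l)"
  by (rule linearI; rule euclidean_eqI) (auto simp: inner_add_left algebra_simps)

lemma bounded_linear_wdil: "bounded_linear (wdil w l)"
  by (simp add: linear_conv_bounded_linear[symmetric] linear_wdil)

lemma wdil_0 [simp]: "wdil w l 0 = 0"
  using linear_0[OF linear_wdil] .

lemma wdil_wdil: "l > 0 \<Longrightarrow> l' > 0 \<Longrightarrow> wdil w l (wdil w l' z) = wdil w (l * l') z"
  by (rule euclidean_eqI) (auto simp: powr_mult)

lemma wdil_1 [simp]: "wdil w 1 z = z"
  by (rule euclidean_eqI) auto

lemma wdil_inverse: "l > 0 \<Longrightarrow> wdil w l (wdil w (1/l) z) = z" "l > 0 \<Longrightarrow> wdil w (1/l) (wdil w l z) = z"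
  by (auto simp: wdil_wdil)

lemma wdil_eq_0_iff [simp]: "l > 0 \<Longrightarrow> wdil w l z = 0 \<longleftrightarrow> z = 0"
  by (metis wdil_inverse(2) wdil_0)

lemma wdil_Pair:
  "wdil w l (x, y) = (wdil (\<lambda>e. w (e, 0)) l x, wdil (\<lambda>e. w (0, e)) l y)"
  by (rule euclidean_eqI) (auto simp: Basis_prod_def)

lemma pos_wt_Pair: "pos_wt w \<longleftrightarrow> pos_wt (\<lambda>e. w (e, 0)) \<and> pos_wt (\<lambda>e. w (0, e))"
  by (auto simp: pos_wt_def Basis_prod_def)

lemma norm_wdil_le: "norm (wdil w l z) \<le> (\<Sum>e\<in>Basis. l powr w e) * norm z"
proof -
  have "norm (wdil w l z) \<le> (\<Sum>e\<in>Basis. norm ((l powr w e * (z \<bullet> e)) *\<^sub>R e :: 'a))"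
    unfolding wdil_def by (rule norm_sum)
  also have "\<dots> \<le> (\<Sum>e\<in>Basis. l powr w e * norm z)"
    by (rule sum_mono) (auto simp: abs_mult intro!: mult_left_mono Basis_le_norm)
  finally show ?thesis by (simp add: sum_distrib_right)
qed

lemma power_powr_swap: "x \<ge> 0 \<Longrightarrow> (x ^ k) powr a = (x powr a) ^ k" for x a :: real
  by (induction k) (simp_all add: powr_mult)

lemma sum_half_powr_tendsto_0:
  assumes "pos_wt w"
  shows "(\<lambda>k. \<Sum>e\<in>Basis. ((1/2)^k) powr w (e::'a::euclidean_space)) \<longlonglongrightarrow> 0"
proof (rule tendsto_null_sum)
  fix e :: 'a assume "e \<in> Basis"
  then have "w e > 0" using assms by (auto simp: pos_wt_def)
  then have "(1/2::real) powr w e < 1" using powr_less_mono2[of "w e" "1/2" 1] by simp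
  then show "(\<lambda>k. ((1/2)^k) powr w e) \<longlonglongrightarrow> 0"
    by (subst power_powr_swap) (auto intro: LIMSEQ_power_zero)
qed

lemma wdil_half_tendsto_0:
  assumes "pos_wt w" shows "(\<lambda>k. wdil w ((1/2)^k) z) \<longlonglongrightarrow> 0"
proof (rule Lim_null_comparison)
  show "\<forall>\<^sub>F k in sequentially. norm (wdil w ((1/2)^k) z) \<le> (\<Sum>e\<in>Basis. ((1/2)^k) powr w e) * norm z"
    by (intro always_eventually allI norm_wdil_le)
  show "(\<lambda>k. (\<Sum>e\<in>Basis. ((1/2)^k) powr w e) * norm z) \<longlonglongrightarrow> 0"
    by (intro tendsto_mult_left_zero sum_half_powr_tendsto_0 assms)
qed

text \<open>The dilations by \<open>(1/2)^k\<close> carry every point to the origin, and the value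
  does not change on the way.\<close>

lemma dilation_invariant_const:
  fixes f :: "'a::euclidean_space \<Rightarrow> 'b::t2_space"
  assumes w: "pos_wt w" and c: "isCont f 0" and inv: "\<And>l z. l > 0 \<Longrightarrow> f (wdil w l z) = f z"
  shows "f z = f 0"
proof -
  have "(\<lambda>k. f (wdil w ((1/2)^k) z)) \<longlonglongrightarrow> f 0"
    using isCont_tendsto_compose[OF c wdil_half_tendsto_0[OF w]] .
  then show ?thesis by (simp add: inv LIMSEQ_const_iff)
qed

text \<open>Along the same sequence the factor \<open>(1/2)^k\<close> tends to 0 while the values of
  \<open>f\<close> tend to \<open>f 0\<close>, so the constant \<open>f z\<close> is 0.\<close>

lemma dilation_degree_neg1_zero:
  fixes f :: "'a::euclidean_space \<Rightarrow> real"
  assumes w: "pos_wt w" and c: "isCont f 0" and hom: "\<And>l z. l > 0 \<Longrightarrow> l * f (wdil w l z) = f z"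
  shows "f z = 0"
proof -
  have "(\<lambda>k. (1/2)^k * f (wdil w ((1/2)^k) z)) \<longlonglongrightarrow> 0 * f 0"
    by (intro tendsto_mult LIMSEQ_power_zero isCont_tendsto_compose[OF c wdil_half_tendsto_0[OF w]]) auto
  then show ?thesis by (simp add: hom LIMSEQ_const_iff)
qed

section \<open>Diffeomorphisms preserving Lebesgue measure\<close>

text \<open>The change of variables theorem of the library is available for \<open>real^'n\<close> with \<open>'n\<close> a
  well-ordered finite type only; this type makes it applicable to any Euclidean space.\<close>

typedef (overloaded) 'a bidx = "{..<DIM('a::euclidean_space)}"
  by (rule exI[of _ 0]) simp

instance bidx :: (euclidean_space) finite
proof
  have "(UNIV :: 'a bidx set) = Abs_bidx ` {..<DIM('a)}"
    by (metis type_definition.Abs_image type_definition_bidx)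
  then show "finite (UNIV :: 'a bidx set)" by (metis finite_imageI finite_lessThan)
qed

instantiation bidx :: (euclidean_space) wellorder
begin
definition less_eq_bidx :: "'a bidx \<Rightarrow> 'a bidx \<Rightarrow> bool" where
  "less_eq_bidx i j \<longleftrightarrow> Rep_bidx i \<le> Rep_bidx j"
definition less_bidx :: "'a bidx \<Rightarrow> 'a bidx \<Rightarrow> bool" where
  "less_bidx i j \<longleftrightarrow> Rep_bidx i < Rep_bidx j"
instance
proof
  fix P :: "'a bidx \<Rightarrow> bool" and a :: "'a bidx"
  assume *: "\<And>x. (\<And>y. y < x \<Longrightarrow> P y) \<Longrightarrow> P x"
  show "P a" by (induction a rule: measure_induct_rule[of Rep_bidx]) (use * less_bidx_def in blast)
qed (auto simp: less_eq_bidx_def less_bidx_def Rep_bidx_inject)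
end

lemma card_bidx: "CARD('a::euclidean_space bidx) = DIM('a)"
  using type_definition.card[OF type_definition_bidx] by simp

definition bidx_vec :: "'a::euclidean_space bidx \<Rightarrow> 'a" where
  "bidx_vec = (SOME e. bij_betw e UNIV Basis)"

lemma bij_bidx_vec: "bij_betw (bidx_vec :: 'a bidx \<Rightarrow> 'a::euclidean_space) UNIV Basis"
proof -
  have "\<exists>e :: 'a bidx \<Rightarrow> 'a. bij_betw e UNIV Basis"
    by (rule finite_same_card_bij) (auto simp: card_bidx)
  then show ?thesis unfolding bidx_vec_def by (rule someI_ex)
qed

lemma bidx_vec_Basis [simp]: "bidx_vec i \<in> Basis"
  using bij_bidx_vec by (auto simp: bij_betw_def)

definition of_bvec :: "real ^ 'a bidx \<Rightarrow> 'a::euclidean_space" where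
  "of_bvec v = (\<Sum>i\<in>UNIV. v $ i *\<^sub>R bidx_vec i)"

definition to_bvec :: "'a::euclidean_space \<Rightarrow> real ^ 'a bidx" where
  "to_bvec x = (\<chi> i. x \<bullet> bidx_vec i)"

lemma bidx_vec_inner: "bidx_vec i \<bullet> bidx_vec j = (if i = j then 1 else 0)"
  using bij_bidx_vec by (auto simp: inner_Basis bij_betw_def inj_on_def)

lemma of_bvec_inner: "of_bvec v \<bullet> bidx_vec i = v $ i"
  by (simp add: of_bvec_def inner_sum_left bidx_vec_inner if_distrib cong: if_cong)

lemma to_of_bvec [simp]: "to_bvec (of_bvec v) = v"
  by (simp add: to_bvec_def of_bvec_inner)

lemma of_to_bvec [simp]: "of_bvec (to_bvec x) = x"
proof (rule euclidean_eqI)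
  fix b :: 'a assume "b \<in> Basis"
  then obtain i where "b = bidx_vec i" using bij_bidx_vec by (auto simp: bij_betw_def)
  then show "of_bvec (to_bvec x) \<bullet> b = x \<bullet> b" by (simp add: of_bvec_inner) (simp add: to_bvec_def)
qed

lemma linear_to_bvec: "linear to_bvec"
  by (rule linearI) (auto simp: to_bvec_def vec_eq_iff inner_add_left)

lemma linear_of_bvec: "linear of_bvec"
  by (rule linearI) (auto simp: of_bvec_def scaleR_add_left sum.distrib scaleR_sum_right)

lemma borel_measurable_bvec [measurable]: "to_bvec \<in> borel_measurable borel" "of_bvec \<in> borel_measurable borel"
  by (auto intro!: borel_measurable_continuous_onI linear_continuous_on
      simp: linear_conv_bounded_linear[symmetric] linear_to_bvec linear_of_bvec)

lemma distr_of_bvec: "distr lborel borel of_bvec = (lborel :: 'a::euclidean_space measure)"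
proof (rule lborel_eqI[symmetric])
  fix l u :: 'a assume le: "\<And>b. b \<in> Basis \<Longrightarrow> l \<bullet> b \<le> u \<bullet> b"
  have eq: "of_bvec -` box l u = box (to_bvec l) (to_bvec u)"
  proof -
    have "(\<forall>b\<in>Basis. l \<bullet> b < x \<bullet> b \<and> x \<bullet> b < u \<bullet> b) \<longleftrightarrow>
       (\<forall>i. l \<bullet> bidx_vec i < x \<bullet> bidx_vec i \<and> x \<bullet> bidx_vec i < u \<bullet> bidx_vec i)" for x
      using bij_bidx_vec[where 'a='a] unfolding bij_betw_def by (metis UNIV_I imageE bidx_vec_Basis)
    then show ?thesis by (auto simp: mem_box_cart mem_box of_bvec_inner) (auto simp: to_bvec_def)
  qed
  have "emeasure (distr lborel borel of_bvec) (box l u) = emeasure lborel (box (to_bvec l) (to_bvec u))"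
    by (subst emeasure_distr) (auto simp: eq)
  also have "\<dots> = (\<Prod>b\<in>Basis. (to_bvec u - to_bvec l) \<bullet> b)"
    by (rule emeasure_lborel_box) (auto simp: to_bvec_def Basis_vec_def inner_axis le)
  also have "(\<Prod>b\<in>Basis. (to_bvec u - to_bvec l) \<bullet> b) = (\<Prod>i\<in>UNIV. (u - l) \<bullet> bidx_vec i)"
  proof -
    have inj: "inj (\<lambda>i::'a bidx. axis i (1::real))" by (auto simp: inj_on_def axis_eq_axis)
    have B: "(Basis :: (real^'a bidx) set) = range (\<lambda>i. axis i 1)" by (auto simp: Basis_vec_def)
    show ?thesis unfolding B
      by (subst prod.reindex[OF inj]) (auto simp: to_bvec_def inner_axis inner_diff_left)
  qed
  also have "\<dots> = (\<Prod>b\<in>Basis. (u - l) \<bullet> b)"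
    using bij_bidx_vec by (rule prod.reindex_bij_betw)
  finally show "emeasure (distr lborel borel of_bvec) (box l u) = (\<Prod>b\<in>Basis. (u - l) \<bullet> b)" .
qed simp

lemma distr_to_bvec: "distr lborel borel (to_bvec :: 'a::euclidean_space \<Rightarrow> _) = lborel"
proof -
  have "distr (lborel::'a measure) borel to_bvec = distr (distr lborel borel of_bvec) borel (to_bvec :: 'a \<Rightarrow> _)"
    by (simp add: distr_of_bvec)
  also have "\<dots> = distr lborel borel (\<lambda>v. v)" by (subst distr_distr) (auto simp: o_def)
  finally show ?thesis by (simp add: distr_id2)
qed

text \<open>The claim is made for the inverse \<open>\<theta>\<close> because the preimage of a box
  under \<open>\<theta>\<close> is its image under \<open>\<psi>\<close>, and the change of
  variables formula computes measures of images.\<close>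

lemma distr_lborel_diffeo_vec:
  fixes \<psi> \<theta> :: "real^'n::{finite,wellorder} \<Rightarrow> real^'n::_"
  assumes der: "\<And>x. (\<psi> has_derivative \<psi>' x) (at x)" and det: "\<And>x. \<bar>det (matrix (\<psi>' x))\<bar> = 1"
    and inv: "\<And>x. \<theta> (\<psi> x) = x" "\<And>x. \<psi> (\<theta> x) = x" and meas [measurable]: "\<theta> \<in> borel_measurable borel"
  shows "distr lborel borel \<theta> = lborel"
proof (rule lborel_eqI[symmetric])
  fix l u :: "real^'n::_" assume le: "\<And>b. b \<in> Basis \<Longrightarrow> l \<bullet> b \<le> u \<bullet> b"
  have eq: "\<theta> -` box l u = \<psi> ` box l u" using inv by (auto simp: image_iff) metis
  have borel: "\<psi> ` box l u \<in> sets borel"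
    unfolding eq[symmetric] using measurable_sets[OF meas, of "box l u"] by simp
  have d: "(\<psi> has_derivative \<psi>' x) (at x within S)" for x S using der has_derivative_at_withinI by blast
  have inj: "inj_on \<psi> (box l u)" using inv by (metis inj_onI)
  have int: "(\<lambda>x. \<bar>det (matrix (\<psi>' x))\<bar>) integrable_on box l u"
    unfolding det using lmeasurable_box[of l u] lmeasurable_iff_integrable_on by auto
  have lm: "\<psi> ` box l u \<in> lmeasurable"
    using measurable_differentiable_image_eq[OF _ d inj] int by simp
  have "measure lebesgue (\<psi> ` box l u) = integral (box l u) (\<lambda>x. 1)"
    using measure_differentiable_image_eq[OF _ d inj int] by (simp add: det)
  also have "\<dots> = measure lebesgue (box l u)"
    using lmeasure_integral[OF lmeasurable_box, of l u] by simp
  finally have m: "measure lebesgue (\<psi> ` box l u) = measure lebesgue (box l u)" .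
  have "emeasure (distr lborel borel \<theta>) (box l u) = emeasure lborel (\<psi> ` box l u)"
    by (subst emeasure_distr) (auto simp: eq)
  also have "\<dots> = emeasure lebesgue (\<psi> ` box l u)" using borel by simp
  also have "\<dots> = measure lebesgue (\<psi> ` box l u)" using lm by (intro emeasure_eq_measure2) auto
  also have "\<dots> = emeasure lebesgue (box l u)" unfolding m
    by (intro emeasure_eq_measure2[symmetric]) auto
  also have "\<dots> = (\<Prod>b\<in>Basis. (u - l) \<bullet> b)" using le by (simp add: emeasure_lborel_box)
  finally show "emeasure (distr lborel borel \<theta>) (box l u) = (\<Prod>b\<in>Basis. (u - l) \<bullet> b)" .
qed simp

definition absdet :: "('a::euclidean_space \<Rightarrow> 'a) \<Rightarrow> real" where
  "absdet L = \<bar>det (matrix (to_bvec \<circ> L \<circ> of_bvec))\<bar>"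

lemma absdet_id: "absdet (\<lambda>x. x) = 1"
proof -
  have "to_bvec \<circ> (\<lambda>x::'a. x) \<circ> of_bvec = (\<lambda>x. x)" by auto
  then show ?thesis by (simp add: absdet_def matrix_id_mat_1[unfolded id_def] del: o_apply)
qed

lemma absdet_comp:
  assumes "linear L" "linear M" shows "absdet (\<lambda>x. L (M x)) = absdet L * absdet M"
proof -
  have lin: "linear (to_bvec \<circ> L \<circ> of_bvec)" if "linear L" for L :: "'a \<Rightarrow> 'a"
    using that by (intro linear_compose linear_to_bvec linear_of_bvec)
  have "to_bvec \<circ> (\<lambda>x. L (M x)) \<circ> of_bvec = (to_bvec \<circ> L \<circ> of_bvec) \<circ> (to_bvec \<circ> M \<circ> of_bvec)" by auto
  then show ?thesis unfolding absdet_def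
    by (simp add: matrix_compose lin assms det_mul abs_mult del: o_apply)
qed

lemma isCont_absdet:
  assumes "\<And>e. isCont (\<lambda>x. L x e) a" shows "isCont (\<lambda>x. absdet (L x)) a"
  unfolding absdet_def det_def matrix_def to_bvec_def
  by (auto intro!: continuous_intros assms)

lemma distr_lborel_diffeo:
  fixes \<psi> \<theta> :: "'a::euclidean_space \<Rightarrow> 'a"
  assumes der: "\<And>x. (\<psi> has_derivative \<psi>' x) (at x)" and det: "\<And>x. absdet (\<psi>' x) = 1"
    and inv: "\<And>x. \<theta> (\<psi> x) = x" "\<And>x. \<psi> (\<theta> x) = x" and meas [measurable]: "\<theta> \<in> borel_measurable borel"
  shows "distr lborel borel \<psi> = lborel"
proof -
  let ?p = "to_bvec \<circ> \<psi> \<circ> of_bvec" and ?t = "to_bvec \<circ> \<theta> \<circ> of_bvec"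
  have [measurable]: "\<psi> \<in> borel_measurable borel"
    by (intro borel_measurable_continuous_onI continuous_at_imp_continuous_on ballI)
      (use der has_derivative_continuous in blast)
  have v: "distr lborel borel ?t = lborel"
  proof (rule distr_lborel_diffeo_vec[where \<psi>="?p" and \<psi>'="\<lambda>x. to_bvec \<circ> \<psi>' (of_bvec x) \<circ> of_bvec"])
    fix x :: "real^'a bidx"
    show "(?p has_derivative to_bvec \<circ> \<psi>' (of_bvec x) \<circ> of_bvec) (at x)"
      by (intro diff_chain_at linear_imp_has_derivative linear_of_bvec linear_to_bvec)
        (use der in \<open>auto simp: linear_imp_has_derivative linear_to_bvec\<close>)
    show "\<bar>det (matrix (to_bvec \<circ> \<psi>' (of_bvec x) \<circ> of_bvec))\<bar> = 1"
      using det[of "of_bvec x"] by (simp add: absdet_def)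
  qed (auto simp: inv)
  have "distr lborel borel \<theta> = distr (distr (distr lborel borel to_bvec) borel ?t) borel of_bvec"
    by (subst distr_distr, simp, simp)+ (simp add: o_def)
  also have "\<dots> = lborel" by (simp add: distr_to_bvec v distr_of_bvec)
  finally have th: "distr lborel borel \<theta> = lborel" .
  \<comment> \<open>Lebesgue measure being invariant under the inverse, it can be pushed forward by
    \<open>\<theta>\<close> and then by \<open>\<psi>\<close>; the composite is the
    identity.\<close>
  have "distr lborel borel \<psi> = distr (distr lborel borel \<theta>) borel \<psi>" by (simp add: th)
  also have "\<dots> = distr lborel borel (\<lambda>x. x)" by (subst distr_distr) (auto simp: o_def inv)
  finally show ?thesis by (simp add: distr_id2)
qed

text \<open>The Jacobian determinant of a dilation-equivariant family is dilation-invariant, hence equal to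
  its value at the origin.\<close>

theorem distr_lborel_equivariant:
  fixes \<phi> :: "'q::euclidean_space \<Rightarrow> 'a::euclidean_space \<Rightarrow> 'a"
  assumes smooth: "Cinf_on UNIV (\<lambda>(q, z). \<phi> q z)" and wv: "pos_wt w" "pos_wt v"
    and eqv: "\<And>l q z. l > 0 \<Longrightarrow> \<phi> (wdil v l q) (wdil w l z) = wdil w l (\<phi> q z)"
    and inv: "\<And>q z. \<theta> q (\<phi> q z) = z" "\<And>q z. \<phi> q (\<theta> q z) = z"
    and meas: "\<theta> q \<in> borel_measurable borel"
    and at0: "((\<phi> 0) has_derivative A) (at 0)" "\<And>x. A (A x) = x"
  shows "distr lborel borel (\<phi> q) = lborel"
proof -
  define F where "F = frechet_derivative (\<lambda>(q, z). \<phi> q z)"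
  define \<phi>' where "\<phi>' = (\<lambda>q z e. F (at (q, z)) (0, e))"
  have F: "((\<lambda>(q, z). \<phi> q z) has_derivative F (at (q, z))) (at (q, z))" for q z
    unfolding F_def by (rule Cinf_on_has_derivative[OF smooth]) simp
  have der: "(\<phi> q has_derivative \<phi>' q z) (at z)" for q z
    using has_derivative_slice_snd[OF F] by (simp add: \<phi>'_def)
  have lin: "linear (\<phi>' q z)" for q z using der has_derivative_linear by blast
  define J where "J = (\<lambda>p. absdet (\<phi>' (fst p) (snd p)))"
  have nz: "absdet (wdil w l) \<noteq> 0" if "l > 0" for l
    using absdet_comp[OF linear_wdil linear_wdil, of w l w "1/l"] that by (auto simp: wdil_inverse absdet_id)
  have conj: "\<phi>' (wdil v l q) (wdil w l z) (wdil w l e) = wdil w l (\<phi>' q z e)" if "l > 0" for l q z e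
  proof -
    have wd: "(wdil w l has_derivative wdil w l) (at x)" for x :: 'a
      by (simp add: linear_imp_has_derivative linear_wdil)
    have 1: "((\<lambda>z. \<phi> (wdil v l q) (wdil w l z)) has_derivative (\<lambda>e. \<phi>' (wdil v l q) (wdil w l z) (wdil w l e))) (at z)"
      by (rule has_derivative_compose[OF wd der])
    have 2: "((\<lambda>z. wdil w l (\<phi> q z)) has_derivative (\<lambda>e. wdil w l (\<phi>' q z e))) (at z)"
      by (rule has_derivative_compose[OF der wd])
    from 1 have "((\<lambda>z. wdil w l (\<phi> q z)) has_derivative (\<lambda>e. \<phi>' (wdil v l q) (wdil w l z) (wdil w l e))) (at z)"
      by (simp only: eqv[OF that])
    from has_derivative_unique[OF this 2] show ?thesis by (rule fun_cong)
  qed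
  \<comment> \<open>Equivariance conjugates the derivative by the dilation, and the determinant of
    the dilation cancels. The parameter \<open>q\<close> is dilated too because a single translation
    does not commute with dilations, whereas the family of all translations is equivariant.\<close>
  have "J (wdil v l q, wdil w l z) = J (q, z)" if "l > 0" for l q z
  proof -
    have "absdet (\<phi>' (wdil v l q) (wdil w l z)) * absdet (wdil w l) = absdet (wdil w l) * absdet (\<phi>' q z)"
      using absdet_comp[OF lin linear_wdil, of "wdil v l q" "wdil w l z" w l]
        absdet_comp[OF linear_wdil lin, of w l q z] by (auto simp: conj[OF that])
    then show ?thesis using nz[OF that] by (simp add: J_def)
  qed
  moreover have "isCont J (0, 0)" unfolding J_def \<phi>'_def F_def
  proof (intro isCont_absdet)
    fix e
    have "Cinf_on UNIV (\<lambda>x. frechet_derivative (\<lambda>(q, z). \<phi> q z) (at x) (0, e))"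
      by (rule Cinf_on_frechet[OF smooth])
    then show "isCont (\<lambda>x. frechet_derivative (\<lambda>(q, z). \<phi> q z) (at (fst x, snd x)) (0, e)) (0, 0)"
      using Cinf_on_continuous continuous_on_eq_continuous_at[OF open_UNIV] by fastforce
  qed
  moreover define u where "u = (\<lambda>(e::'q \<times> 'a). if snd e = 0 then v (fst e) else w (snd e))"
  have wu: "wdil u l (q, z) = (wdil v l q, wdil w l z)" for l q z
    unfolding wdil_Pair u_def by (auto simp: wdil_def nonzero_Basis intro!: sum.cong)
  have "pos_wt u" using wv unfolding pos_wt_Pair[of u] by (auto simp: u_def pos_wt_def)
  ultimately have "J p = J 0" for p
    by (intro dilation_invariant_const[of u J p]) (auto simp: wu zero_prod_def)
  then have J: "J p = J (0, 0)" for p by (simp add: zero_prod_def)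
  have J1: "J (0, 0) = 1"
  proof -
    have "\<phi>' 0 0 = A" using der at0(1) has_derivative_unique by blast
    \<comment> \<open>Requiring an involution covers all the uses: the identity for translations and
      changes of sign for inversions.\<close>
    moreover have "absdet A * absdet A = 1"
      using absdet_comp[of A A] at0 has_derivative_linear[OF at0(1)] by (simp add: absdet_id)
    moreover have "absdet A \<ge> 0" by (simp add: absdet_def)
    ultimately show ?thesis
      by (simp add: J_def square_eq_1_iff)
  qed
  have "absdet (\<phi>' q z) = 1" for q z using J[of "(q, z)"] J1 by (simp add: J_def)
  then show ?thesis
    using distr_lborel_diffeo[of "\<phi> q" "\<phi>' q" "\<theta> q"] der inv meas by blast
qed

section \<open>Mixed derivatives, bump functions and parameter integrals\<close>

text \<open>The mean value theorem is applied twice, along \<open>u\<close> and then along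
  \<open>v\<close>. The left side is symmetric in \<open>u\<close> and \<open>v\<close>, although
  the right side differentiates in a definite order.\<close>

lemma second_difference_eq:
  fixes f :: "'a::euclidean_space \<Rightarrow> real"
  assumes f: "Cinf_on UNIV f" and h: "h > 0"
  obtains s t where "0 < s" "s < h" "0 < t" "t < h"
    "f (x + h *\<^sub>R u + h *\<^sub>R v) - f (x + h *\<^sub>R u) - f (x + h *\<^sub>R v) + f x
      = h * (h * frechet_derivative (\<lambda>y. frechet_derivative f (at y) u) (at (x + s *\<^sub>R u + t *\<^sub>R v)) v)"
proof -
  define Du where "Du = (\<lambda>y. frechet_derivative f (at y) u)"
  have Du: "Cinf_on UNIV Du" unfolding Du_def by (rule Cinf_on_frechet[OF f])
  have line: "((\<lambda>s. g (c + s *\<^sub>R d)) has_real_derivative frechet_derivative g (at (c + s *\<^sub>R d)) d) (at s)"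
    if "Cinf_on UNIV g" for g :: "'a \<Rightarrow> real" and c d s
  proof -
    have 1: "(g has_derivative frechet_derivative g (at (c + s *\<^sub>R d))) (at (c + s *\<^sub>R d))"
      by (rule Cinf_on_has_derivative[OF that]) simp
    have 2: "((\<lambda>s. c + s *\<^sub>R d) has_derivative (\<lambda>r. r *\<^sub>R d)) (at s)"
      by (auto intro!: derivative_eq_intros)
    have "((\<lambda>s. g (c + s *\<^sub>R d)) has_derivative (\<lambda>r. frechet_derivative g (at (c + s *\<^sub>R d)) (r *\<^sub>R d))) (at s)"
      by (rule has_derivative_compose[OF 2 1])
    moreover have "frechet_derivative g (at (c + s *\<^sub>R d)) (r *\<^sub>R d) = frechet_derivative g (at (c + s *\<^sub>R d)) d * r" for r
      using linear_scale[OF has_derivative_linear[OF 1]] by simp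
    ultimately show ?thesis by (simp add: has_field_derivative_def)
  qed
  define p where "p = (\<lambda>s. f ((x + h *\<^sub>R v) + s *\<^sub>R u) - f (x + s *\<^sub>R u))"
  have "DERIV p s :> Du ((x + h *\<^sub>R v) + s *\<^sub>R u) - Du (x + s *\<^sub>R u)" for s
    unfolding p_def Du_def by (intro DERIV_diff line f)
  from MVT2[OF h, of p, OF this]
  obtain s where s: "0 < s" "s < h" "p h - p 0 = h * (Du ((x + h *\<^sub>R v) + s *\<^sub>R u) - Du (x + s *\<^sub>R u))"
    by auto
  define q where "q = (\<lambda>t. Du ((x + s *\<^sub>R u) + t *\<^sub>R v))"
  have "DERIV q t :> frechet_derivative Du (at (x + s *\<^sub>R u + t *\<^sub>R v)) v" for t
    unfolding q_def by (intro line Du)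
  from MVT2[OF h, of q, OF this]
  obtain t where t: "0 < t" "t < h" "q h - q 0 = h * frechet_derivative Du (at (x + s *\<^sub>R u + t *\<^sub>R v)) v"
    by auto
  have "p h - p 0 = h * (q h - q 0)" using s(3) by (simp add: q_def algebra_simps)
  then have "p h - p 0 = h * (h * frechet_derivative Du (at (x + s *\<^sub>R u + t *\<^sub>R v)) v)"
    using t(3) by simp
  moreover have "p h - p 0 = f (x + h *\<^sub>R u + h *\<^sub>R v) - f (x + h *\<^sub>R u) - f (x + h *\<^sub>R v) + f x"
    by (simp add: p_def algebra_simps)
  ultimately show ?thesis using that s t unfolding Du_def by metis
qed

lemma frechet_derivative_commute:
  fixes f :: "'a::euclidean_space \<Rightarrow> real"
  assumes f: "Cinf_on UNIV f"
  shows "frechet_derivative (\<lambda>y. frechet_derivative f (at y) u) (at x) v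
       = frechet_derivative (\<lambda>y. frechet_derivative f (at y) v) (at x) u"
proof -
  define G where "G = (\<lambda>u v y. frechet_derivative (\<lambda>y. frechet_derivative f (at y) u) (at y) v)"
  have cont: "isCont (G u v) x" for u v
    using Cinf_on_continuous[OF Cinf_on_frechet[OF Cinf_on_frechet[OF f]]]
    unfolding G_def by (simp add: continuous_on_eq_continuous_at)
  define h where "h = (\<lambda>k::nat. inverse (real (Suc k)))"
  have h: "h k > 0" for k by (simp add: h_def)
  have h0: "h \<longlonglongrightarrow> 0" unfolding h_def by (rule LIMSEQ_inverse_real_of_nat)
  define \<Delta> where "\<Delta> = (\<lambda>k. (f (x + h k *\<^sub>R u + h k *\<^sub>R v) - f (x + h k *\<^sub>R u) - f (x + h k *\<^sub>R v) + f x) / (h k * h k))"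
  \<comment> \<open>The same difference quotients converge to both mixed derivatives, according to
    which direction is put first in \<open>second_difference_eq\<close>.\<close>
  have lim: "\<Delta> \<longlonglongrightarrow> G u' v' x" if uv: "(u' = u \<and> v' = v) \<or> (u' = v \<and> v' = u)" for u' v'
  proof -
    have "\<exists>s t. 0 < s \<and> s < h k \<and> 0 < t \<and> t < h k \<and> \<Delta> k = G u' v' (x + s *\<^sub>R u' + t *\<^sub>R v')" for k
    proof -
      obtain s t where st: "0 < s" "s < h k" "0 < t" "t < h k" and eq:
        "f (x + h k *\<^sub>R u' + h k *\<^sub>R v') - f (x + h k *\<^sub>R u') - f (x + h k *\<^sub>R v') + f x
          = h k * (h k * G u' v' (x + s *\<^sub>R u' + t *\<^sub>R v'))"
        using second_difference_eq[OF f h[of k], of x u' v'] unfolding G_def by blast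
      have "f (x + h k *\<^sub>R u + h k *\<^sub>R v) - f (x + h k *\<^sub>R u) - f (x + h k *\<^sub>R v) + f x
          = h k * (h k * G u' v' (x + s *\<^sub>R u' + t *\<^sub>R v'))"
        using eq uv by (auto simp: algebra_simps)
      then have "\<Delta> k = G u' v' (x + s *\<^sub>R u' + t *\<^sub>R v')"
        using h[of k] unfolding \<Delta>_def by simp
      then show ?thesis using st by blast
    qed
    then obtain s t where st: "\<And>k. 0 < s k \<and> s k < h k \<and> 0 < t k \<and> t k < h k"
      and eq: "\<And>k. \<Delta> k = G u' v' (x + s k *\<^sub>R u' + t k *\<^sub>R v')" by metis
    have "s \<longlonglongrightarrow> 0" "t \<longlonglongrightarrow> 0"
      by (rule real_tendsto_sandwich[OF _ _ tendsto_const h0]; use st in \<open>simp add: less_imp_le\<close>)+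
    then have "(\<lambda>k. x + s k *\<^sub>R u' + t k *\<^sub>R v') \<longlonglongrightarrow> x + 0 *\<^sub>R u' + 0 *\<^sub>R v'"
      by (intro tendsto_intros)
    then have "(\<lambda>k. G u' v' (x + s k *\<^sub>R u' + t k *\<^sub>R v')) \<longlonglongrightarrow> G u' v' x"
      using isCont_tendsto_compose[OF cont] by simp
    then show ?thesis by (simp add: eq[abs_def])
  qed
  from LIMSEQ_unique[OF lim[of u v] lim[of v u]] show ?thesis by (simp add: G_def)
qed

section \<open>Smooth functions positive exactly on a ball\<close>

definition flat_exp :: "nat \<Rightarrow> real \<Rightarrow> real" where
  "flat_exp k x = (if x > 0 then exp (- (1 / x)) / x ^ k else 0)"

lemma flat_exp_tendsto_0: "(flat_exp k \<longlongrightarrow> 0) (at 0)"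
proof (rule filterlim_split_at)
  show "(flat_exp k \<longlongrightarrow> 0) (at_left 0)"
    by (rule tendsto_eventually) (auto simp: flat_exp_def eventually_at_filter)
  have "((\<lambda>x. (inverse x) ^ k / exp (inverse x)) \<longlongrightarrow> 0) (at_right (0::real))"
    by (rule filterlim_compose[OF tendsto_power_div_exp_0 filterlim_inverse_at_top_right])
  moreover have "\<forall>\<^sub>F x in at_right 0. (inverse x) ^ k / exp (inverse x) = flat_exp k x"
    by (auto simp: eventually_at_filter flat_exp_def exp_minus field_simps intro!: always_eventually)
  ultimately show "(flat_exp k \<longlongrightarrow> 0) (at_right 0)" by (rule Lim_transform_eventually)
qed

text \<open>The powers of \<open>x\<close> in the denominator make the family closed under
  differentiation, so that smoothness follows by induction on the order for all \<open>k\<close> at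
  once.\<close>

lemma flat_exp_has_derivative:
  "(flat_exp k has_real_derivative flat_exp (k + 2) x - real k * flat_exp (k + 1) x) (at x)"
proof -
  consider "x > 0" | "x < 0" | "x = 0" by linarith
  then show ?thesis
  proof cases
    case 1
    have "((\<lambda>x. exp (- (1 / x)) / x ^ k) has_real_derivative flat_exp (k + 2) x - real k * flat_exp (k + 1) x) (at x)"
      using 1 by (auto intro!: derivative_eq_intros simp: flat_exp_def field_simps power2_eq_square)
         (cases k; simp add: field_simps)
    then show ?thesis
      by (rule has_field_derivative_transform_within_open[where S="{0<..}"]) (use 1 in \<open>auto simp: flat_exp_def\<close>)
  next
    case 2
    have "((\<lambda>x. 0) has_real_derivative flat_exp (k + 2) x - real k * flat_exp (k + 1) x) (at x)"
      using 2 by (simp add: flat_exp_def)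
    then show ?thesis
      by (rule has_field_derivative_transform_within_open[where S="{..<0}"]) (use 2 in \<open>auto simp: flat_exp_def\<close>)
  next
    case 3
    \<comment> \<open>The difference quotient at 0 is again a member of the family, so its limit is
      already known.\<close>
    have "(\<lambda>h. (flat_exp k (0 + h) - flat_exp k 0) / h) = flat_exp (Suc k)"
      by (auto simp: flat_exp_def fun_eq_iff)
    then have "(flat_exp k has_real_derivative 0) (at 0)"
      using flat_exp_tendsto_0[of "Suc k"] by (simp add: DERIV_def)
    then show ?thesis using 3 by (simp add: flat_exp_def)
  qed
qed

lemma Ck_on_flat_exp: "Ck_on n UNIV (flat_exp k)"
proof (induction n arbitrary: k)
  case 0
  show ?case using flat_exp_has_derivative DERIV_isCont
    by (metis Ck_on.simps(1) continuous_at_imp_continuous_on)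
next
  case (Suc n)
  have D: "(flat_exp k has_derivative (\<lambda>v. (flat_exp (k + 2) x - real k * flat_exp (k + 1) x) * v)) (at x)" for k x
    using flat_exp_has_derivative by (simp add: has_field_derivative_def)
  have "Ck_on n UNIV (\<lambda>x. frechet_derivative (flat_exp k) (at x) v)" for v
  proof -
    have "(\<lambda>x. frechet_derivative (flat_exp k) (at x) v) =
      (\<lambda>x. v * flat_exp (k + 2) x + (- v * real k) * flat_exp (k + 1) x)"
      using frechet_derivative_eqI[OF D] by (auto simp: algebra_simps)
    then show ?thesis
      by (simp only:) (intro Ck_on_add Ck_on_bilinear[OF bounded_bilinear_mult] Ck_on_const Suc.IH open_UNIV)
  qed
  then show ?case using D by (auto intro: differentiableI)
qed

lemma Cinf_on_flat_exp: "Cinf_on UNIV (flat_exp k)"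
  by (simp add: Cinf_on_iff_Ck_on Ck_on_flat_exp)

definition test_fun :: "('a::euclidean_space \<Rightarrow> real) \<Rightarrow> bool" where
  "test_fun \<phi> \<longleftrightarrow> Cinf_on UNIV \<phi> \<and> compact (closure {z. \<phi> z \<noteq> 0})"

lemma test_funI:
  assumes "Cinf_on UNIV \<phi>" "compact K" "\<And>z. z \<notin> K \<Longrightarrow> \<phi> z = 0" shows "test_fun \<phi>"
proof -
  have "{z. \<phi> z \<noteq> 0} \<subseteq> K" using assms(3) by auto
  then have "bounded {z. \<phi> z \<noteq> 0}" using assms(2) bounded_subset compact_imp_bounded by blast
  then show ?thesis using assms(1) by (simp add: test_fun_def)
qed

lemma test_funE:
  assumes "test_fun \<phi>"
  obtains K where "compact K" "\<And>z. z \<notin> K \<Longrightarrow> \<phi> z = 0"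
  using assms closure_subset[of "{z. \<phi> z \<noteq> 0}"] unfolding test_fun_def by blast

text \<open>The squared distance is used because, unlike the norm, it is smooth at the centre.
  Positivity on the whole ball is what the uniqueness argument needs.\<close>

lemma bump_function:
  fixes z0 :: "'a::euclidean_space"
  assumes "r > 0"
  obtains \<phi> :: "'a \<Rightarrow> real" where "test_fun \<phi>" "\<And>z. \<phi> z \<ge> 0" "\<And>z. \<phi> z > 0 \<longleftrightarrow> z \<in> ball z0 r"
proof -
  define \<phi> where "\<phi> = (\<lambda>z. flat_exp 0 (r\<^sup>2 - (z - z0) \<bullet> (z - z0)))"
  have pos: "\<phi> z > 0 \<longleftrightarrow> z \<in> ball z0 r" for z
  proof -
    have "\<phi> z > 0 \<longleftrightarrow> (norm (z - z0))\<^sup>2 < r\<^sup>2" by (simp add: \<phi>_def flat_exp_def power2_norm_eq_inner)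
    also have "\<dots> \<longleftrightarrow> norm (z - z0) < r" using assms power_mono_iff[of r "norm (z - z0)" 2] by (auto simp: not_le[symmetric])
    finally show ?thesis by (simp add: dist_norm norm_minus_commute)
  qed
  have nn: "\<phi> z \<ge> 0" for z by (simp add: \<phi>_def flat_exp_def)
  have "Cinf_on UNIV \<phi>" unfolding \<phi>_def
    by (intro Cinf_on_compose_UNIV[OF _ Cinf_on_flat_exp] Cinf_intros open_UNIV)
  moreover have "\<phi> z = 0" if "z \<notin> cball z0 r" for z
    using pos[of z] nn[of z] that by (auto simp: less_le)
  ultimately have "test_fun \<phi>" by (intro test_funI[of \<phi> "cball z0 r"]) auto
  then show ?thesis using that pos nn by blast
qed

text \<open>By the mean value inequality the bound on the derivative is also a Lipschitz bound, so
  \<open>G\<close> dominates the remainder of the first order expansion uniformly near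
  \<open>w0\<close>. Dominated convergence along arbitrary sequences does the rest.\<close>

lemma has_derivative_integral_dominated:
  fixes h :: "'a::euclidean_space \<Rightarrow> 'b::euclidean_space \<Rightarrow> real"
  assumes r: "r > 0"
    and int: "\<And>w. w \<in> ball w0 r \<Longrightarrow> integrable M (h w)"
    and der: "\<And>w v. w \<in> ball w0 r \<Longrightarrow> v \<in> space M \<Longrightarrow> ((\<lambda>w. h w v) has_derivative h' w v) (at w)"
    and meas: "\<And>e. (\<lambda>v. h' w0 v e) \<in> borel_measurable M"
    and bound: "\<And>w v e. w \<in> ball w0 r \<Longrightarrow> v \<in> space M \<Longrightarrow> \<bar>h' w v e\<bar> \<le> G v * norm e"
    and G: "integrable M G"
  shows "integrable M (\<lambda>v. h' w0 v e)"
    and "((\<lambda>w. \<integral>v. h w v \<partial>M) has_derivative (\<lambda>e. \<integral>v. h' w0 v e \<partial>M)) (at w0)"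
proof -
  have w0: "w0 \<in> ball w0 r" using r by simp
  have int': "integrable M (\<lambda>v. h' w0 v e)" for e
    by (rule Bochner_Integration.integrable_bound[OF integrable_mult_left[OF G, of "norm e"] meas])
      (use bound[OF w0] in \<open>force intro!: AE_I2 intro: order_trans[OF _ abs_ge_self]\<close>)
  then show "integrable M (\<lambda>v. h' w0 v e)" .
  have lin: "linear (h' w0 v)" if "v \<in> space M" for v
    using der[OF w0 that] has_derivative_linear by blast
  have bl: "bounded_linear (\<lambda>e. \<integral>v. h' w0 v e \<partial>M)"
  proof (rule bounded_linear_intro[where K="\<integral>v. G v \<partial>M"])
    show "(\<integral>v. h' w0 v (x + y) \<partial>M) = (\<integral>v. h' w0 v x \<partial>M) + (\<integral>v. h' w0 v y \<partial>M)" for x y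
      by (subst Bochner_Integration.integral_add[OF int' int', symmetric])
        (intro Bochner_Integration.integral_cong refl linear_add lin)
    show "(\<integral>v. h' w0 v (c *\<^sub>R x) \<partial>M) = c *\<^sub>R (\<integral>v. h' w0 v x \<partial>M)" for c x
      by (subst integral_scaleR_right[symmetric])
        (intro Bochner_Integration.integral_cong refl linear_scale lin)
    show "norm (\<integral>v. h' w0 v x \<partial>M) \<le> norm x * (\<integral>v. G v \<partial>M)" for x
    proof -
      have "norm (\<integral>v. h' w0 v x \<partial>M) \<le> (\<integral>v. G v * norm x \<partial>M)"
        by (rule Bochner_Integration.integral_norm_bound_integral[OF int' integrable_mult_left[OF G]]) (use bound[OF w0] in auto)
      then show ?thesis by (simp add: mult.commute)
    qed
  qed
  have lip: "\<bar>h w v - h w0 v\<bar> \<le> G v * norm (w - w0)" if w: "w \<in> ball w0 r" and v: "v \<in> space M" for w v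
  proof -
    have "norm (h w v - h w0 v) \<le> G v * norm (w - w0)"
    proof (rule differentiable_bound[where S="ball w0 r" and f'="\<lambda>w. h' w v"])
      show "((\<lambda>w. h w v) has_derivative h' x v) (at x within ball w0 r)" if "x \<in> ball w0 r" for x
        using der[OF that v] has_derivative_at_withinI by blast
      show "onorm (h' x v) \<le> G v" if "x \<in> ball w0 r" for x
        using bound[OF that v] by (intro onorm_le) auto
    qed (use w w0 in auto)
    then show ?thesis by simp
  qed
  have "((\<lambda>w. norm ((\<integral>v. h w v \<partial>M) - (\<integral>v. h w0 v \<partial>M) - (\<integral>v. h' w0 v (w - w0) \<partial>M)) / norm (w - w0)) \<longlongrightarrow> 0) (at w0)"
    unfolding tendsto_at_iff_sequentially
  proof (intro allI impI)
    fix X assume X1: "\<forall>i. X i \<in> UNIV - {w0}" and X2: "X \<longlonglongrightarrow> w0"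
    from X2 r obtain N where N: "\<And>n. n \<ge> N \<Longrightarrow> X n \<in> ball w0 r"
      by (metis lim_sequentially dist_commute mem_ball)
    define Y where "Y = (\<lambda>n. X (n + N))"
    have Y: "Y n \<in> ball w0 r" "Y n \<noteq> w0" for n using N X1 by (auto simp: Y_def)
    have Ylim: "Y \<longlonglongrightarrow> w0" unfolding Y_def using X2 by (rule LIMSEQ_ignore_initial_segment)
    \<comment> \<open>One \<open>G v\<close> of the dominating function \<open>2 * G v\<close> comes
      from the increment of \<open>h\<close>, the other from the linear term.\<close>
    define s where "s = (\<lambda>n v. norm (h (Y n) v - h w0 v - h' w0 v (Y n - w0)) / norm (Y n - w0))"
    have ints: "integrable M (\<lambda>v. h (Y n) v - h w0 v - h' w0 v (Y n - w0))" for n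
      by (intro Bochner_Integration.integrable_diff int int' Y w0)
    have "(\<lambda>n. \<integral>v. s n v \<partial>M) \<longlonglongrightarrow> (\<integral>v. 0 \<partial>M)"
    proof (rule integral_dominated_convergence[where w="\<lambda>v. 2 * G v"])
      show "s n \<in> borel_measurable M" for n unfolding s_def
        using ints[of n] by (auto dest: borel_measurable_integrable)
      show "AE v in M. (\<lambda>n. s n v) \<longlonglongrightarrow> 0"
      proof (rule AE_I2)
        fix v assume v: "v \<in> space M"
        have "((\<lambda>w. norm (h w v - h w0 v - h' w0 v (w - w0)) / norm (w - w0)) \<longlongrightarrow> 0) (at w0)"
          using der[OF w0 v] by (simp add: has_derivative_iff_norm)
        then show "(\<lambda>n. s n v) \<longlonglongrightarrow> 0"
          unfolding tendsto_at_iff_sequentially s_def using Y Ylim by (auto simp: o_def)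
      qed
      show "AE v in M. norm (s n v) \<le> 2 * G v" for n
      proof (rule AE_I2)
        fix v assume v: "v \<in> space M"
        have "norm (h (Y n) v - h w0 v - h' w0 v (Y n - w0)) \<le> G v * norm (Y n - w0) + G v * norm (Y n - w0)"
          using lip[OF Y(1) v, of n] bound[OF w0 v, of "Y n - w0"] by (simp add: abs_le_iff)
        then show "norm (s n v) \<le> 2 * G v"
          using Y(2)[of n] by (simp add: s_def divide_le_eq)
      qed
    qed (use G in auto)
    then have sl: "(\<lambda>n. \<integral>v. s n v \<partial>M) \<longlonglongrightarrow> 0" by simp
    have "(\<lambda>n. norm ((\<integral>v. h (Y n) v \<partial>M) - (\<integral>v. h w0 v \<partial>M) - (\<integral>v. h' w0 v (Y n - w0) \<partial>M)) / norm (Y n - w0)) \<longlonglongrightarrow> 0"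
    proof (rule Lim_null_comparison[OF _ sl], intro always_eventually allI)
      fix n
      have "(\<integral>v. h (Y n) v \<partial>M) - (\<integral>v. h w0 v \<partial>M) - (\<integral>v. h' w0 v (Y n - w0) \<partial>M)
         = (\<integral>v. h (Y n) v - h w0 v - h' w0 v (Y n - w0) \<partial>M)"
        using int[OF Y(1)] int[OF w0] int' by simp
      moreover have "norm (\<integral>v. h (Y n) v - h w0 v - h' w0 v (Y n - w0) \<partial>M)
          \<le> (\<integral>v. norm (h (Y n) v - h w0 v - h' w0 v (Y n - w0)) \<partial>M)"
        by (rule integral_norm_bound)
      ultimately show "norm (norm ((\<integral>v. h (Y n) v \<partial>M) - (\<integral>v. h w0 v \<partial>M) - (\<integral>v. h' w0 v (Y n - w0) \<partial>M)) / norm (Y n - w0))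
         \<le> (\<integral>v. s n v \<partial>M)"
        by (simp add: s_def divide_right_mono)
    qed
    then show "((\<lambda>w. norm ((\<integral>v. h w v \<partial>M) - (\<integral>v. h w0 v \<partial>M) - (\<integral>v. h' w0 v (w - w0) \<partial>M)) / norm (w - w0)) \<circ> X) \<longlonglongrightarrow> 0"
      using LIMSEQ_offset[of _ N] by (auto simp: Y_def o_def)
  qed
  then show "((\<lambda>w. \<integral>v. h w v \<partial>M) has_derivative (\<lambda>e. \<integral>v. h' w0 v e \<partial>M)) (at w0)"
    using bl by (simp add: has_derivative_iff_norm)
qed

lemma frechet_derivative_slice_fst:
  assumes "f differentiable (at (a, b))"
  shows "frechet_derivative (\<lambda>x. f (x, b)) (at a) u = frechet_derivative f (at (a, b)) (u, 0)"
  by (rule frechet_derivative_eqI[OF has_derivative_slice_fst]) (use assms frechet_derivative_works in blast)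

lemma frechet_derivative_slice_snd:
  assumes "f differentiable (at (a, b))"
  shows "frechet_derivative (\<lambda>y. f (a, y)) (at b) u = frechet_derivative f (at (a, b)) (0, u)"
  by (rule frechet_derivative_eqI[OF has_derivative_slice_snd]) (use assms frechet_derivative_works in blast)

lemma frechet_derivative_bound_Basis:
  fixes f :: "'a::euclidean_space \<Rightarrow> real"
  assumes "f differentiable (at x)"
  shows "\<bar>frechet_derivative f (at x) e\<bar> \<le> (\<Sum>b\<in>Basis. \<bar>frechet_derivative f (at x) b\<bar>) * norm e"
proof -
  have "\<bar>frechet_derivative f (at x) e\<bar> = \<bar>\<Sum>b\<in>Basis. (e \<bullet> b) * frechet_derivative f (at x) b\<bar>"
    using linear_eq_sum_Basis[OF linear_frechet_derivative[OF assms], of e] by simp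
  also have "\<dots> \<le> (\<Sum>b\<in>Basis. \<bar>(e \<bullet> b) * frechet_derivative f (at x) b\<bar>)" by (rule sum_abs)
  also have "\<dots> \<le> (\<Sum>b\<in>Basis. norm e * \<bar>frechet_derivative f (at x) b\<bar>)"
    by (intro sum_mono) (auto simp: abs_mult intro!: mult_right_mono Basis_le_norm)
  finally show ?thesis by (simp add: sum_distrib_left mult.commute)
qed

section \<open>Integrals of a locally integrable function against smooth kernels\<close>

definition loc_int :: "('a::euclidean_space \<Rightarrow> real) \<Rightarrow> bool" where
  "loc_int \<gamma> \<longleftrightarrow> (\<forall>K. compact K \<longrightarrow> set_integrable lborel K \<gamma>)"

lemma loc_int_mult_integrable:
  assumes \<gamma>: "loc_int \<gamma>" and g: "continuous_on UNIV g" and K: "compact K" "\<And>v. v \<notin> K \<Longrightarrow> g v = 0"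
  shows "integrable lborel (\<lambda>v. \<gamma> v * g v)"
proof -
  have int: "integrable lborel (\<lambda>v. indicator K v *\<^sub>R \<gamma> v)"
    using \<gamma> K(1) by (auto simp: loc_int_def set_integrable_def)
  have "bounded (g ` K)"
    using K(1) g by (intro compact_imp_bounded compact_continuous_image) (auto intro: continuous_on_subset)
  then obtain C where C: "\<And>v. v \<in> K \<Longrightarrow> \<bar>g v\<bar> \<le> C" by (auto simp: bounded_iff)
  have eq: "\<gamma> v * g v = (indicator K v *\<^sub>R \<gamma> v) * g v" for v using K(2)[of v] by (cases "v \<in> K") auto
  have gm: "g \<in> borel_measurable borel" using g by (rule borel_measurable_continuous_onI)
  show ?thesis
  proof (rule Bochner_Integration.integrable_bound[OF integrable_mult_left[OF integrable_abs[OF int], of "\<bar>C\<bar>"]])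
    show "(\<lambda>v. \<gamma> v * g v) \<in> borel_measurable lborel"
      unfolding eq using borel_measurable_integrable[OF int] gm by simp
    show "AE v in lborel. norm (\<gamma> v * g v) \<le> norm (\<bar>indicator K v *\<^sub>R \<gamma> v\<bar> * \<bar>C\<bar>)"
    proof (rule AE_I2)
      fix v show "norm (\<gamma> v * g v) \<le> norm (\<bar>indicator K v *\<^sub>R \<gamma> v\<bar> * \<bar>C\<bar>)"
        using K(2)[of v] C[of v] by (cases "v \<in> K") (auto simp: abs_mult intro!: mult_left_mono)
    qed
  qed
qed

text \<open>The support in the second variable stays in one compact set as long as the first is
  bounded. Convolution kernels have this property but not compact support in both variables, and it
  is what differentiation under the integral uses.\<close>

definition loc_supp :: "('a::euclidean_space \<times> 'b::euclidean_space \<Rightarrow> real) \<Rightarrow> bool" where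
  "loc_supp \<psi> \<longleftrightarrow> (\<forall>R. \<exists>K. compact K \<and> (\<forall>w v. norm w \<le> R \<longrightarrow> v \<notin> K \<longrightarrow> \<psi> (w, v) = 0))"

lemma loc_supp_deriv:
  assumes \<psi>: "Cinf_on UNIV \<psi>" and ls: "loc_supp \<psi>"
  shows "loc_supp (\<lambda>(w, v). frechet_derivative \<psi> (at (w, v)) (V w, 0))"
  unfolding loc_supp_def
proof
  fix R
  \<comment> \<open>The margin 1 leaves a whole ball around \<open>w\<close> on which
    \<open>\<psi>\<close> vanishes, so the derivative vanishes too.\<close>
  obtain K where K: "compact K" "\<And>w v. norm w \<le> R + 1 \<Longrightarrow> v \<notin> K \<Longrightarrow> \<psi> (w, v) = 0"
    using ls unfolding loc_supp_def by metis
  have "frechet_derivative \<psi> (at (w, v)) (e, 0) = 0" if "norm w \<le> R" "v \<notin> K" for w v e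
  proof -
    have "\<psi> (w', v) = 0" if "w' \<in> ball w 1" for w'
    proof (rule K(2))
      have "norm w' \<le> norm w + norm (w' - w)" by (metis add.commute diff_add_cancel norm_triangle_ineq)
      then show "norm w' \<le> R + 1" using that \<open>norm w \<le> R\<close> by (simp add: dist_norm norm_minus_commute)
    qed (fact \<open>v \<notin> K\<close>)
    then have "frechet_derivative (\<lambda>w. \<psi> (w, v)) (at w) e = frechet_derivative (\<lambda>w. 0) (at w) e"
      by (subst frechet_derivative_cong_open[of "ball w 1" w]) auto
    then show ?thesis
      by (simp add: frechet_derivative_slice_fst Cinf_on_differentiable[OF \<psi>])
  qed
  then show "\<exists>K. compact K \<and> (\<forall>w v. norm w \<le> R \<longrightarrow> v \<notin> K \<longrightarrow>
      (case (w, v) of (w, v) \<Rightarrow> frechet_derivative \<psi> (at (w, v)) (V w, 0)) = 0)"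
    using K(1) by auto
qed

lemma Cinf_on_deriv_fst:
  assumes "Cinf_on UNIV \<psi>" "Cinf_on UNIV V"
  shows "Cinf_on UNIV (\<lambda>(w, v). frechet_derivative \<psi> (at (w, v)) (V w, 0))"
proof -
  have "Cinf_on UNIV (\<lambda>p. frechet_derivative \<psi> (at p) (V (fst p), 0))"
    by (rule Cinf_on_frechet_app[where T=UNIV and g="\<lambda>x. x"])
      (auto intro!: Cinf_intros assms Cinf_on_compose_UNIV[OF _ assms(2)])
  then show ?thesis by (simp add: case_prod_unfold)
qed

lemma loc_supp_integrable:
  assumes "loc_int \<gamma>" "Cinf_on UNIV \<psi>" "loc_supp \<psi>"
  shows "integrable lborel (\<lambda>v. \<gamma> v * \<psi> (w, v))"
proof -
  obtain K where K: "compact K" "\<And>v. v \<notin> K \<Longrightarrow> \<psi> (w, v) = 0"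
    using assms(3) unfolding loc_supp_def by (metis order_refl)
  have "continuous_on UNIV (\<lambda>v. \<psi> (w, v))"
    by (rule continuous_on_compose2[OF Cinf_on_continuous[OF assms(2)]]) (auto intro!: continuous_intros)
  then show ?thesis by (rule loc_int_mult_integrable[OF assms(1) _ K])
qed

lemma param_integral_has_derivative:
  fixes \<psi> :: "'a::euclidean_space \<times> 'b::euclidean_space \<Rightarrow> real"
  assumes \<gamma>: "loc_int \<gamma>" and \<psi>: "Cinf_on UNIV \<psi>" and ls: "loc_supp \<psi>"
  shows "((\<lambda>w. \<integral>v. \<gamma> v * \<psi> (w, v) \<partial>lborel) has_derivative
    (\<lambda>e. \<integral>v. \<gamma> v * frechet_derivative \<psi> (at (w, v)) (e, 0) \<partial>lborel)) (at w)"
proof -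
  have int: "integrable lborel (\<lambda>v. \<gamma> v * frechet_derivative \<psi> (at (w, v)) (e, 0))" for w e
    using loc_supp_integrable[OF \<gamma> Cinf_on_deriv_fst[OF \<psi> Cinf_on_const, of e] loc_supp_deriv[OF \<psi> ls]]
    by simp
  \<comment> \<open>Vanishing within radius \<open>norm w + 2\<close> gives an open neighbourhood of
    the points within \<open>norm w + 1\<close>, hence vanishing derivatives there; the unit ball
    around \<open>w\<close> is where domination is required.\<close>
  obtain K where K: "compact K" and K2: "\<And>w' v. norm w' \<le> norm w + 2 \<Longrightarrow> v \<notin> K \<Longrightarrow> \<psi> (w', v) = 0"
    using ls unfolding loc_supp_def by metis
  have K3: "frechet_derivative \<psi> (at (w', v)) b = 0" if "norm w' \<le> norm w + 1" "v \<notin> K" for w' v b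
  proof -
    have "frechet_derivative \<psi> (at (w', v)) = frechet_derivative (\<lambda>_. 0) (at (w', v))"
    proof (rule frechet_derivative_cong_open)
      show "open (ball 0 (norm w + 2) \<times> (- K))"
        using K by (intro open_Times open_ball open_Compl compact_imp_closed)
    qed (use that K2 in auto)
    then show ?thesis by simp
  qed
  let ?S = "\<lambda>p. \<Sum>b\<in>Basis. \<bar>frechet_derivative \<psi> (at p) b\<bar>"
  have "continuous_on UNIV ?S"
    by (intro continuous_intros Cinf_on_continuous[OF Cinf_on_frechet[OF \<psi>]])
  then have "bounded (?S ` (cball 0 (norm w + 1) \<times> K))"
    using K by (intro compact_imp_bounded compact_continuous_image compact_Times) (auto intro: continuous_on_subset)
  then obtain C where C0: "\<And>x. x \<in> ?S ` (cball 0 (norm w + 1) \<times> K) \<Longrightarrow> norm x \<le> C"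
    unfolding bounded_iff by blast
  have C: "?S (w', v) \<le> C" if "norm w' \<le> norm w + 1" "v \<in> K" for w' v
    using C0[of "?S (w', v)"] that by auto
  show ?thesis
  proof (rule has_derivative_integral_dominated(2)[where r=1 and h="\<lambda>w v. \<gamma> v * \<psi> (w, v)"
        and h'="\<lambda>w v e. \<gamma> v * frechet_derivative \<psi> (at (w, v)) (e, 0)" and G="\<lambda>v. \<bar>indicator K v *\<^sub>R \<gamma> v\<bar> * C"])
    show "integrable lborel (\<lambda>v. \<gamma> v * \<psi> (w', v))" for w' by (rule loc_supp_integrable[OF \<gamma> \<psi> ls])
    show "((\<lambda>w. \<gamma> v * \<psi> (w, v)) has_derivative (\<lambda>e. \<gamma> v * frechet_derivative \<psi> (at (w', v)) (e, 0))) (at w')" for w' v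
      by (intro has_derivative_mult_right has_derivative_slice_fst Cinf_on_has_derivative[OF \<psi>]) simp
    show "(\<lambda>v. \<gamma> v * frechet_derivative \<psi> (at (w, v)) (e, 0)) \<in> borel_measurable lborel" for e
      using int by (rule borel_measurable_integrable)
    show "\<bar>\<gamma> v * frechet_derivative \<psi> (at (w', v)) (e, 0)\<bar> \<le> \<bar>indicator K v *\<^sub>R \<gamma> v\<bar> * C * norm e"
      if "w' \<in> ball w 1" for w' v e
    proof -
      have n: "norm w' \<le> norm w + 1"
        using that norm_triangle_ineq2[of w' w] by (simp add: dist_norm norm_minus_commute)
      have b: "\<bar>frechet_derivative \<psi> (at (w', v)) (e, 0)\<bar> \<le> ?S (w', v) * norm e"
        using frechet_derivative_bound_Basis[OF Cinf_on_differentiable[OF \<psi>], of "(w', v)" "(e, 0)"] by simp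
      show ?thesis
      proof (cases "v \<in> K")
        case True
        have "\<bar>frechet_derivative \<psi> (at (w', v)) (e, 0)\<bar> \<le> C * norm e"
          by (rule order_trans[OF b]) (use C[OF n True] in \<open>auto intro: mult_right_mono\<close>)
        then show ?thesis using True by (simp add: abs_mult mult.assoc mult_left_mono)
      next
        case False
        then show ?thesis using K3[OF n False] by simp
      qed
    qed
    show "integrable lborel (\<lambda>v. \<bar>indicator K v *\<^sub>R \<gamma> v\<bar> * C)"
      using \<gamma> K by (intro integrable_mult_left integrable_abs) (auto simp: loc_int_def set_integrable_def)
  qed auto
qed

text \<open>The coinduction invariant is the shape of the function: integrals of this form are
  closed under directional derivatives, with \<open>\<psi>\<close> replaced by its derivative in the
  first slot.\<close>

lemma Cinf_on_param_integral:
  fixes \<psi> :: "'a::euclidean_space \<times> 'b::euclidean_space \<Rightarrow> real"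
  assumes \<gamma>: "loc_int \<gamma>" and "Cinf_on UNIV \<psi>" and "loc_supp \<psi>"
  shows "Cinf_on UNIV (\<lambda>w. \<integral>v. \<gamma> v * \<psi> (w, v) \<partial>lborel)"
  using assms(2,3)
proof (coinduction arbitrary: \<psi>)
  case Cinf_on
  note D = param_integral_has_derivative[OF \<gamma> Cinf_on]
  have "\<exists>\<psi>'. (\<lambda>w. frechet_derivative (\<lambda>w. \<integral>v. \<gamma> v * \<psi> (w, v) \<partial>lborel) (at w) e)
      = (\<lambda>w. \<integral>v. \<gamma> v * \<psi>' (w, v) \<partial>lborel) \<and> Cinf_on UNIV \<psi>' \<and> loc_supp \<psi>'" for e
    by (rule exI[of _ "\<lambda>(w, v). frechet_derivative \<psi> (at (w, v)) (e, 0)"])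
      (use frechet_derivative_eqI[OF D] Cinf_on_deriv_fst[OF Cinf_on(1) Cinf_on_const, of e] loc_supp_deriv[OF Cinf_on, of "\<lambda>_. e"] in auto)
  then show ?case using D by (auto intro: differentiableI)
qed

lemma Cinf_on_isCont: "Cinf_on S f \<Longrightarrow> open S \<Longrightarrow> x \<in> S \<Longrightarrow> isCont f x"
  using Cinf_on_continuous continuous_on_eq_continuous_at by blast

lemma Cinf_on_inner_const: "Cinf_on UNIV (\<lambda>x. x \<bullet> b)"
  by (intro Cinf_on_bounded_linear bounded_linear_inner_left)

section \<open>Homogeneous groups and left-invariant fields\<close>

locale hgroup =
  fixes star :: "'g::euclidean_space \<Rightarrow> 'g \<Rightarrow> 'g" and ginv :: "'g \<Rightarrow> 'g" and w :: "'g \<Rightarrow> real"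
  assumes assoc: "star (star a b) c = star a (star b c)"
    and unit_l [simp]: "star 0 a = a" and unit_r [simp]: "star a 0 = a"
    and inv_r [simp]: "star a (ginv a) = 0" and inv_l [simp]: "star (ginv a) a = 0"
    and star_smooth: "Cinf_on UNIV (\<lambda>(a, b). star a b)"
    and ginv_smooth: "Cinf_on UNIV ginv"
    and pos_w: "pos_wt w"
    and wdil_star: "l > 0 \<Longrightarrow> wdil w l (star a b) = star (wdil w l a) (wdil w l b)"
begin

lemma inv_star_cancel [simp]: "star (ginv a) (star a b) = b" "star a (star (ginv a) b) = b"
  by (simp_all flip: assoc)

lemma star_inv_cancel [simp]: "star (star b a) (ginv a) = b" "star (star b (ginv a)) a = b"
  by (simp_all add: assoc)

lemma inv_unique: "star a b = 0 \<Longrightarrow> b = ginv a" by (metis inv_star_cancel(1) unit_r)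

lemma ginv_0 [simp]: "ginv 0 = 0" by (metis inv_unique unit_l)

lemma ginv_ginv [simp]: "ginv (ginv a) = a" by (metis inv_unique inv_l)

lemma ginv_star: "ginv (star a b) = star (ginv b) (ginv a)"
  by (rule inv_unique[symmetric]) (metis assoc inv_r inv_star_cancel(2))

lemma ginv_eq_0 [simp]: "ginv a = 0 \<longleftrightarrow> a = 0" by (metis ginv_0 ginv_ginv)

lemma star_ginv_eq_0: "star (ginv a) b = 0 \<longleftrightarrow> a = b" "star a (ginv b) = 0 \<longleftrightarrow> a = b"
  by (metis inv_star_cancel(2) unit_r inv_l) (metis star_inv_cancel(2) unit_l inv_r)

lemma wdil_ginv: "l > 0 \<Longrightarrow> wdil w l (ginv a) = ginv (wdil w l a)"
  by (rule inv_unique) (metis wdil_star inv_r wdil_0)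

lemma Cinf_on_star [Cinf_intros]:
  assumes "open S" "Cinf_on S f" "Cinf_on S g" shows "Cinf_on S (\<lambda>x. star (f x) (g x))"
  using Cinf_on_compose_UNIV[OF assms(1) star_smooth Cinf_on_Pair[OF assms]] by simp

lemma Cinf_on_ginv [Cinf_intros]: "open S \<Longrightarrow> Cinf_on S f \<Longrightarrow> Cinf_on S (\<lambda>x. ginv (f x))"
  by (rule Cinf_on_compose_UNIV[OF _ ginv_smooth])

lemma continuous_on_star [continuous_intros]:
  assumes "continuous_on S f" "continuous_on S g" shows "continuous_on S (\<lambda>x. star (f x) (g x))"
  using continuous_on_compose2[OF Cinf_on_continuous[OF star_smooth] continuous_on_Pair[OF assms]] by simp

lemma continuous_on_ginv [continuous_intros]: "continuous_on S f \<Longrightarrow> continuous_on S (\<lambda>x. ginv (f x))"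
  using continuous_on_compose2[OF Cinf_on_continuous[OF ginv_smooth]] by blast

lemma measurable_star_ginv [measurable]:
  "star g \<in> borel_measurable borel" "(\<lambda>z. star z g) \<in> borel_measurable borel" "ginv \<in> borel_measurable borel"
  by (intro borel_measurable_continuous_onI continuous_intros)
    (intro borel_measurable_continuous_onI continuous_on_star continuous_on_const continuous_on_id
      continuous_on_ginv[OF continuous_on_id])+

text \<open>Both partial maps at the origin are the identity because 0 is the unit, and they
  determine the derivative by linearity.\<close>

lemma star_deriv0:
  "((\<lambda>(a, b). star a b) has_derivative (\<lambda>(u, v). u + v)) (at (0, 0))"
proof -
  let ?D = "frechet_derivative (\<lambda>(a, b). star a b) (at (0, 0))"
  have D: "((\<lambda>(a, b). star a b) has_derivative ?D) (at (0, 0))"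
    by (rule Cinf_on_has_derivative[OF star_smooth]) simp
  have 1: "?D (u, 0) = u" for u
    using has_derivative_unique[OF has_derivative_slice_fst[OF D, simplified] has_derivative_ident] by (rule fun_cong)
  have 2: "?D (0, v) = v" for v
    using has_derivative_unique[OF has_derivative_slice_snd[OF D, simplified] has_derivative_ident] by (rule fun_cong)
  have "?D (u, v) = u + v" for u v
    using linear_add[OF has_derivative_linear[OF D], of "(u, 0)" "(0, v)"] by (simp add: 1 2)
  then have "?D = (\<lambda>(u, v). u + v)" by auto
  then show ?thesis using D by simp
qed

text \<open>Differentiate \<open>star a (ginv a) = 0\<close> at the origin.\<close>

lemma ginv_deriv0: "(ginv has_derivative (\<lambda>v. - v)) (at 0)"
proof -
  let ?D = "frechet_derivative ginv (at 0)"
  have D: "(ginv has_derivative ?D) (at 0)" by (rule Cinf_on_has_derivative[OF ginv_smooth]) simp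
  have "((\<lambda>a. (a, ginv a)) has_derivative (\<lambda>v. (v, ?D v))) (at 0)"
    by (intro has_derivative_Pair has_derivative_ident D)
  then have "((\<lambda>a. (\<lambda>(a, b). star a b) (a, ginv a)) has_derivative (\<lambda>v. (\<lambda>(u, v). u + v) (v, ?D v))) (at 0)"
    by (rule has_derivative_compose) (simp add: star_deriv0)
  then have "((\<lambda>a. 0) has_derivative (\<lambda>v. v + ?D v)) (at 0)" by simp
  from has_derivative_unique[OF this has_derivative_const] have "v + ?D v = 0" for v by (rule fun_cong)
  then have "?D = (\<lambda>v. - v)" by (simp add: fun_eq_iff add_eq_0_iff)
  then show ?thesis using D by simp
qed

text \<open>The translating element is itself the dilated parameter, and at parameter 0 the map is
  the identity.\<close>

lemma distr_left: "distr lborel borel (star g) = lborel"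
  by (rule distr_lborel_equivariant[where \<theta>="\<lambda>q z. star (ginv q) z" and w=w and v=w and A="\<lambda>x. x"])
    (auto intro: star_smooth pos_w simp: wdil_star)

text \<open>Inversion is equivariant on its own, so the parameter \<open>q\<close> is a dummy; the
  derivative at the origin is an involution by \<open>ginv_deriv0\<close>.\<close>

lemma distr_ginv: "distr lborel borel ginv = lborel"
proof (rule distr_lborel_equivariant[where \<phi>="\<lambda>(q::'g) z. ginv z" and \<theta>="\<lambda>q z. ginv z" and w=w and v=w and A="\<lambda>x. - x"])
  show "Cinf_on UNIV (\<lambda>(q::'g, z). ginv z)"
    unfolding case_prod_unfold by (intro Cinf_intros open_UNIV)
  show "(ginv has_derivative uminus) (at 0)" by (rule ginv_deriv0)
qed (auto intro: pos_w simp: wdil_ginv)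

end

text \<open>No measurability of \<open>f\<close> is assumed. Since \<open>T\<close> has a measurable
  right inverse, \<open>f\<close> and its composite with \<open>T\<close> are measurable together,
  and if they are not, both integrals take the default value 0.\<close>

lemma lborel_distr_eqD:
  fixes f :: "'a::euclidean_space \<Rightarrow> real"
  assumes d: "distr lborel borel T = (lborel :: 'a measure)" and T: "T \<in> borel_measurable borel"
    and T': "T' \<in> borel_measurable borel" "\<And>x. T (T' x) = x"
  shows "(\<integral>x. f (T x) \<partial>lborel) = (\<integral>x. f x \<partial>lborel)"
    and "integrable lborel (\<lambda>x. f (T x)) \<longleftrightarrow> integrable lborel f"
proof -
  have T1: "T \<in> lborel \<rightarrow>\<^sub>M borel" unfolding measurable_lborel2 by (rule T)
  have m: "f \<in> borel_measurable borel" if a: "(\<lambda>x. f (T x)) \<in> borel_measurable borel"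
  proof -
    have "(\<lambda>x. f (T (T' x))) \<in> borel_measurable borel"
      using measurable_compose[OF T'(1) a] .
    then show ?thesis by (simp only: T'(2))
  qed
  have 1: "integrable lborel (\<lambda>x. f (T x)) \<longleftrightarrow> integrable lborel f" if F: "f \<in> borel_measurable borel"
    using integrable_distr_eq[OF T1 F] unfolding d by (rule sym)
  have 2: "(\<integral>x. f (T x) \<partial>lborel) = (\<integral>x. f x \<partial>lborel)" if F: "f \<in> borel_measurable borel"
    using integral_distr[OF T1 F] unfolding d by (rule sym)
  have 3: "\<not> integrable lborel f \<and> \<not> integrable lborel (\<lambda>x. f (T x))" if "f \<notin> borel_measurable borel"
    using that m borel_measurable_integrable unfolding measurable_lborel2[symmetric, of borel] by blast
  show "integrable lborel (\<lambda>x. f (T x)) \<longleftrightarrow> integrable lborel f" using 1 3 by blast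
  show "(\<integral>x. f (T x) \<partial>lborel) = (\<integral>x. f x \<partial>lborel)"
    using 2 3 not_integrable_integral_eq by metis
qed

context hgroup begin

lemma integral_left: "(\<integral>z. f (star g z) \<partial>lborel) = (\<integral>z. f z \<partial>lborel)" for f :: "'g \<Rightarrow> real"
  by (rule lborel_distr_eqD(1)[OF distr_left, where T'="star (ginv g)"]) simp_all

lemma integral_ginv: "(\<integral>z. f (ginv z) \<partial>lborel) = (\<integral>z. f z \<partial>lborel)" for f :: "'g \<Rightarrow> real"
  by (rule lborel_distr_eqD(1)[OF distr_ginv, where T'=ginv]) simp_all

lemma left_translation_has_derivative:
  "(star z has_derivative frechet_derivative (star z) (at a)) (at a)"
  by (rule Cinf_on_has_derivative[where S=UNIV]) (auto intro!: Cinf_intros)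

text \<open>\<open>left_inv\<close> is stated for scalar functions; testing it on the coordinates at
  the origin recovers the vector identity.\<close>

lemma left_inv_at_0:
  assumes "left_inv star V" shows "frechet_derivative (star z) (at 0) (V 0) = V z"
proof (rule euclidean_eqI)
  fix b :: 'g
  have "vf_app V (\<lambda>x. star z x \<bullet> b) 0 = vf_app V (\<lambda>x. x \<bullet> b) (star z 0)"
    using assms[unfolded left_inv_def, rule_format, OF Cinf_on_inner_const, of z b 0] by simp
  moreover have "vf_app V (\<lambda>x. x \<bullet> b) z = V z \<bullet> b"
    unfolding vf_app_def by (rule frechet_derivative_eqI) (auto intro!: derivative_eq_intros)
  moreover have "vf_app V (\<lambda>x. star z x \<bullet> b) 0 = frechet_derivative (star z) (at 0) (V 0) \<bullet> b"
    unfolding vf_app_def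
    by (rule frechet_derivative_eqI) (intro has_derivative_inner_left left_translation_has_derivative)
  ultimately show "frechet_derivative (star z) (at 0) (V 0) \<bullet> b = V z \<bullet> b" by simp
qed

text \<open>Acting with \<open>V\<close> means differentiating along right translations at the unit,
  in the fixed direction \<open>V 0\<close>. Unlike \<open>left_inv\<close> itself this applies to
  functions differentiable at the single point \<open>z\<close>, hence to kernels singular at the
  origin.\<close>

lemma left_inv_deriv:
  assumes V: "left_inv star V" and f: "f differentiable (at z)"
  shows "((\<lambda>a. f (star z a)) has_derivative (\<lambda>v. frechet_derivative f (at z) (frechet_derivative (star z) (at 0) v))) (at 0)"
    and "frechet_derivative f (at z) (V z) = frechet_derivative (\<lambda>a. f (star z a)) (at 0) (V 0)"
proof -
  have f': "(f has_derivative frechet_derivative f (at z)) (at (star z 0))"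
    using f[unfolded frechet_derivative_works] by simp
  show d: "((\<lambda>a. f (star z a)) has_derivative (\<lambda>v. frechet_derivative f (at z) (frechet_derivative (star z) (at 0) v))) (at 0)"
    by (rule has_derivative_compose[OF left_translation_has_derivative f'])
  show "frechet_derivative f (at z) (V z) = frechet_derivative (\<lambda>a. f (star z a)) (at 0) (V 0)"
    by (simp add: frechet_derivative_eqI[OF d] left_inv_at_0[OF V])
qed

lemma homog1_eq:
  assumes "homog1 (wdil w) V" "l > 0" shows "wdil w l (V z) = l *\<^sub>R V (wdil w l z)"
proof (rule euclidean_eqI)
  fix b :: 'g
  have "vf_app V (\<lambda>x. wdil w l x \<bullet> b) z = l * vf_app V (\<lambda>x. x \<bullet> b) (wdil w l z)"
    using assms(1)[unfolded homog1_def, rule_format, OF assms(2) Cinf_on_inner_const] .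
  moreover have "vf_app V (\<lambda>x. x \<bullet> b) z = V z \<bullet> b" for z
    unfolding vf_app_def by (rule frechet_derivative_eqI) (auto intro!: derivative_eq_intros)
  moreover have "vf_app V (\<lambda>x. wdil w l x \<bullet> b) z = wdil w l (V z) \<bullet> b"
    unfolding vf_app_def
    by (rule frechet_derivative_eqI) (intro has_derivative_inner_left linear_imp_has_derivative linear_wdil)
  ultimately show "wdil w l (V z) \<bullet> b = (l *\<^sub>R V (wdil w l z)) \<bullet> b" by simp
qed

text \<open>Homogeneity of degree 1 makes every diagonal entry of the derivative of \<open>V\<close>
  a continuous function of degree -1, hence zero. Consequently the transpose of \<open>V\<close> is
  \<open>- V\<close>.\<close>

lemma homog1_div_free:
  assumes V: "Cinf_on UNIV V" and h: "homog1 (wdil w) V" shows "vf_div V z = 0"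
proof -
  have d0: "frechet_derivative V (at z) e \<bullet> e = 0" if e: "e \<in> Basis" for e
  proof (rule dilation_degree_neg1_zero[OF pos_w, of "\<lambda>z. frechet_derivative V (at z) e \<bullet> e"])
    have "Cinf_on UNIV (\<lambda>z. frechet_derivative V (at z) e \<bullet> e)"
      by (intro Cinf_intros Cinf_on_frechet V open_UNIV)
    then show "isCont (\<lambda>z. frechet_derivative V (at z) e \<bullet> e) 0"
      by (rule Cinf_on_isCont) auto
    fix l :: real and z assume l: "l > 0"
    have dV: "(V has_derivative frechet_derivative V (at y)) (at y)" for y
      by (rule Cinf_on_has_derivative[OF V]) simp
    have wd: "(wdil w l has_derivative wdil w l) (at y)" for y
      by (intro linear_imp_has_derivative linear_wdil)
    have 1: "((\<lambda>z. wdil w l (V z)) has_derivative (\<lambda>v. wdil w l (frechet_derivative V (at z) v))) (at z)"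
      by (rule has_derivative_compose[OF dV wd])
    have 2: "((\<lambda>z. l *\<^sub>R V (wdil w l z)) has_derivative (\<lambda>v. l *\<^sub>R frechet_derivative V (at (wdil w l z)) (wdil w l v))) (at z)"
      by (intro has_derivative_scaleR_right has_derivative_compose[OF wd dV])
    have D2: "((\<lambda>z. wdil w l (V z)) has_derivative (\<lambda>v. l *\<^sub>R frechet_derivative V (at (wdil w l z)) (wdil w l v))) (at z)"
      using 2 by (simp only: homog1_eq[OF h l])
    have "wdil w l (frechet_derivative V (at z) e) = l *\<^sub>R frechet_derivative V (at (wdil w l z)) (wdil w l e)"
      using has_derivative_unique[OF 1 D2] by (rule fun_cong)
    then have "wdil w l (frechet_derivative V (at z) e) \<bullet> e = (l *\<^sub>R frechet_derivative V (at (wdil w l z)) (wdil w l e)) \<bullet> e"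
      by simp
    then have "l powr w e * (frechet_derivative V (at z) e \<bullet> e) = l powr w e * (l * (frechet_derivative V (at (wdil w l z)) e \<bullet> e))"
      using e by (simp add: wdil_Basis linear_scale[OF has_derivative_linear[OF dV]])
    then show "l * (frechet_derivative V (at (wdil w l z)) e \<bullet> e) = frechet_derivative V (at z) e \<bullet> e"
      using l by simp
  qed
  show ?thesis by (simp add: vf_div_def d0)
qed

end

section \<open>The heat operator\<close>

lemma zop_eq:
  assumes "g differentiable (at \<zeta>)"
  shows "zop V g \<zeta> = frechet_derivative g (at \<zeta>) (0, V (snd \<zeta>))"
  using assms by (cases \<zeta>) (simp add: zop_def frechet_derivative_slice_snd)

lemma dtau_slice_has_derivative:
  assumes "g differentiable (at (\<tau>, z))"
  shows "((\<lambda>\<tau>. g (\<tau>, z)) has_real_derivative frechet_derivative g (at (\<tau>, z)) (1, 0)) (at \<tau>)"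
proof -
  note D = assms[unfolded frechet_derivative_works]
  have "frechet_derivative g (at (\<tau>, z)) (v, 0) = frechet_derivative g (at (\<tau>, z)) (1, 0) * v" for v
    using linear_scale[OF has_derivative_linear[OF D], of v "(1, 0)"] by simp
  then have "(\<lambda>v. frechet_derivative g (at (\<tau>, z)) (v, 0)) = (\<lambda>v. frechet_derivative g (at (\<tau>, z)) (1, 0) * v)"
    by (rule ext)
  with has_derivative_slice_fst[OF D] show ?thesis by (simp only: has_field_derivative_def)
qed

lemma dtau_eq:
  assumes "g differentiable (at \<zeta>)"
  shows "dtau g \<zeta> = frechet_derivative g (at \<zeta>) (1, 0)"
  using assms by (cases \<zeta>) (simp add: dtau_def DERIV_imp_deriv[OF dtau_slice_has_derivative])

lemma Cinf_on_zop:
  assumes S: "open S" and g: "Cinf_on S g" and V: "Cinf_on UNIV V" shows "Cinf_on S (zop V g)"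
proof (subst Cinf_on_cong[OF S])
  show "zop V g \<zeta> = frechet_derivative g (at \<zeta>) (0, V (snd \<zeta>))" if "\<zeta> \<in> S" for \<zeta>
    by (intro zop_eq Cinf_on_differentiable[OF g that])
  show "Cinf_on S (\<lambda>\<zeta>. frechet_derivative g (at \<zeta>) (0, V (snd \<zeta>)))"
    by (rule Cinf_on_frechet_app[OF S S g Cinf_on_ident])
      (intro Cinf_intros S Cinf_on_compose_UNIV[OF S V], auto)
qed

lemma Cinf_on_dtau:
  assumes S: "open S" and g: "Cinf_on S g" shows "Cinf_on S (dtau g)"
proof (subst Cinf_on_cong[OF S])
  show "dtau g \<zeta> = frechet_derivative g (at \<zeta>) (1, 0)" if "\<zeta> \<in> S" for \<zeta>
    by (intro dtau_eq Cinf_on_differentiable[OF g that])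
qed (rule Cinf_on_frechet[OF g])

definition heat :: "nat \<Rightarrow> (nat \<Rightarrow> 'g::euclidean_space \<Rightarrow> 'g) \<Rightarrow> (real \<times> 'g \<Rightarrow> real) \<Rightarrow> real \<times> 'g \<Rightarrow> real" where
  "heat m Z g \<zeta> = (\<Sum>j=1..m. zop (Z j) (zop (Z j) g) \<zeta>) - dtau g \<zeta>"

definition heatT :: "nat \<Rightarrow> (nat \<Rightarrow> 'g::euclidean_space \<Rightarrow> 'g) \<Rightarrow> (real \<times> 'g \<Rightarrow> real) \<Rightarrow> real \<times> 'g \<Rightarrow> real" where
  "heatT m Z g \<zeta> = (\<Sum>j=1..m. zop (Z j) (zop (Z j) g) \<zeta>) + dtau g \<zeta>"

lemma zop_0_outside:
  assumes "open U" "\<zeta> \<in> U" "\<And>x. x \<in> U \<Longrightarrow> g x = 0" shows "zop V g \<zeta> = 0" "dtau g \<zeta> = 0"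
proof -
  have d: "(g has_derivative (\<lambda>_. 0)) (at \<zeta>)"
    by (rule has_derivative_transform_within_open[of "\<lambda>_. 0" "\<lambda>_. 0" \<zeta> UNIV U g]) (use assms in auto)
  then have "g differentiable (at \<zeta>)" by (rule differentiableI)
  then show "zop V g \<zeta> = 0" "dtau g \<zeta> = 0" by (simp_all add: zop_eq dtau_eq frechet_derivative_eqI[OF d])
qed

lemma second_derivative_at_max:
  fixes g :: "'a::euclidean_space \<Rightarrow> real"
  assumes g: "Cinf_on UNIV g" and V: "Cinf_on UNIV V" and max: "\<And>z. g z \<le> g z0"
  shows "frechet_derivative (\<lambda>z. frechet_derivative g (at z) (V z)) (at z0) (V z0) \<le> 0"
proof -
  define c where "c = V z0"
  have dg: "(g has_derivative frechet_derivative g (at z)) (at z)" for z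
    by (rule Cinf_on_has_derivative[OF g]) simp
  have dV: "(V has_derivative frechet_derivative V (at z)) (at z)" for z
    by (rule Cinf_on_has_derivative[OF V]) simp
  let ?g2 = "\<lambda>e. frechet_derivative (\<lambda>z. frechet_derivative g (at z) e) (at z0)"
  have d2: "((\<lambda>z. frechet_derivative g (at z) e) has_derivative ?g2 e) (at z0)" for e
    by (rule Cinf_on_has_derivative[OF Cinf_on_frechet[OF g]]) simp
  have crit: "frechet_derivative g (at z0) = (\<lambda>v. 0)"
    by (rule has_derivative_local_max[OF dg]) (simp add: max)
  have lin: "frechet_derivative g (at z) v = (\<Sum>e\<in>Basis. (v \<bullet> e) * frechet_derivative g (at z) e)" for z v
    using linear_eq_sum_Basis[OF has_derivative_linear[OF dg[of z]], of v] by simp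
  have "((\<lambda>z. \<Sum>e\<in>Basis. (V z \<bullet> e) * frechet_derivative g (at z) e) has_derivative
     (\<lambda>v. \<Sum>e\<in>Basis. (V z0 \<bullet> e) * ?g2 e v + (frechet_derivative V (at z0) v \<bullet> e) * frechet_derivative g (at z0) e)) (at z0)"
    by (intro has_derivative_sum has_derivative_mult has_derivative_inner_left dV d2)
  from frechet_derivative_eqI[OF this[folded lin], of c]
  have 1: "frechet_derivative (\<lambda>z. frechet_derivative g (at z) (V z)) (at z0) c = (\<Sum>e\<in>Basis. (c \<bullet> e) * ?g2 e c)"
    by (simp add: crit c_def)
  have "((\<lambda>z. \<Sum>e\<in>Basis. (c \<bullet> e) * frechet_derivative g (at z) e) has_derivative
     (\<lambda>v. \<Sum>e\<in>Basis. (c \<bullet> e) * ?g2 e v)) (at z0)"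
    by (intro has_derivative_sum has_derivative_mult_right d2)
  from frechet_derivative_eqI[OF this[folded lin], of c]
  have 2: "?g2 c c = (\<Sum>e\<in>Basis. (c \<bullet> e) * ?g2 e c)" .
  define h1 where "h1 = (\<lambda>r. frechet_derivative g (at (z0 + r *\<^sub>R c)) c)"
  have line: "((\<lambda>r. z0 + r *\<^sub>R c) has_derivative (\<lambda>r. r *\<^sub>R c)) (at r)" for r
    by (auto intro!: derivative_eq_intros)
  have h: "((\<lambda>r. g (z0 + r *\<^sub>R c)) has_real_derivative h1 r) (at r)" for r
  proof -
    have "((\<lambda>r. g (z0 + r *\<^sub>R c)) has_derivative (\<lambda>s. frechet_derivative g (at (z0 + r *\<^sub>R c)) (s *\<^sub>R c))) (at r)"
      by (rule has_derivative_compose[OF line dg])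
    moreover have "(\<lambda>s. frechet_derivative g (at (z0 + r *\<^sub>R c)) (s *\<^sub>R c)) = (\<lambda>s. h1 r * s)"
      by (simp add: h1_def linear_scale[OF has_derivative_linear[OF dg]] mult.commute)
    ultimately show ?thesis by (simp add: has_field_derivative_def)
  qed
  have h2: "(h1 has_real_derivative ?g2 c c) (at 0)"
  proof -
    have d2': "((\<lambda>z. frechet_derivative g (at z) c) has_derivative ?g2 c) (at (z0 + 0 *\<^sub>R c))" using d2 by simp
    have "(h1 has_derivative (\<lambda>s. ?g2 c (s *\<^sub>R c))) (at 0)"
      unfolding h1_def by (rule has_derivative_compose[OF line d2'])
    moreover have "(\<lambda>s. ?g2 c (s *\<^sub>R c)) = (\<lambda>s. ?g2 c c * s)"
      by (simp add: linear_scale[OF has_derivative_linear[OF d2]] mult.commute)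
    ultimately show ?thesis by (simp add: has_field_derivative_def)
  qed
  have "?g2 c c \<le> 0"
  proof (rule ccontr)
    assume "\<not> ?g2 c c \<le> 0"
    then obtain d where d: "d > 0" "\<And>r. 0 < r \<Longrightarrow> r < d \<Longrightarrow> h1 0 < h1 (0 + r)"
      using DERIV_pos_inc_right[OF h2] by auto
    have h10: "h1 0 = 0" by (simp add: h1_def crit)
    have "d / 2 > 0" using d by simp
    from MVT2[OF this h]
    obtain r where r: "0 < r" "r < d / 2" "g (z0 + (d / 2) *\<^sub>R c) - g (z0 + 0 *\<^sub>R c) = (d / 2 - 0) * h1 r" by auto
    have "h1 r > 0" using d(2)[of r] r h10 d(1) by simp
    then have "(d / 2 - 0) * h1 r > 0" using d(1) by simp
    then show False using r(3) max[of "z0 + (d / 2) *\<^sub>R c"] by simp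
  qed
  then show ?thesis using 1 2 by (simp add: c_def)
qed

lemma zop_zop_at_max:
  assumes u: "Cinf_on UNIV u" and V: "Cinf_on UNIV V" and max: "\<And>z. u (\<tau>, z) \<le> u (\<tau>, z0)"
  shows "zop V (zop V u) (\<tau>, z0) \<le> 0"
proof -
  have "Cinf_on UNIV (\<lambda>z. u (\<tau>, z))"
    by (intro Cinf_on_compose_UNIV[OF _ u] Cinf_intros open_UNIV)
  from second_derivative_at_max[OF this V max] show ?thesis by (simp add: zop_def)
qed

text \<open>The perturbation \<open>- e arctan \<tau>\<close> turns a solution into a strict subsolution that is still below its
  supremum at infinity, so the maximum is attained.\<close>

lemma heat_maximum_principle_le:
  fixes u :: "real \<times> 'g::euclidean_space \<Rightarrow> real"
  assumes Z: "\<And>j. j \<in> {1..m} \<Longrightarrow> Cinf_on UNIV (Z j)"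
    and u: "Cinf_on UNIV u" and heat: "\<And>\<zeta>. heat m Z u \<zeta> = 0" and lim: "(u \<longlongrightarrow> 0) at_infinity"
  shows "u \<zeta>1 \<le> 0"
proof (rule ccontr)
  assume "\<not> u \<zeta>1 \<le> 0"
  define M where "M = u \<zeta>1"
  have M: "M > 0" using \<open>\<not> u \<zeta>1 \<le> 0\<close> by (simp add: M_def)
  \<comment> \<open>As \<open>arctan\<close> is below 2 in absolute value, the perturbation is below
    \<open>M / 4\<close>. Then \<open>v\<close> exceeds \<open>3 * M / 4\<close> at
    \<open>\<zeta>1\<close> and is below \<open>M / 2\<close> wherever
    \<open>\<bar>u \<zeta>\<bar> < M / 4\<close>, so the maximum over a large ball is
    global.\<close>
  define v where "v = (\<lambda>\<zeta>. u \<zeta> - (M / 8) * arctan (fst \<zeta>))"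
  have arct: "\<bar>arctan s\<bar> < 2" for s using arctan_bounded[of s] pi_less_4 by auto
  have small: "\<bar>(M / 8) * arctan s\<bar> < M / 4" for s
    using mult_strict_left_mono[OF arct[of s], of "M / 8"] M by (simp add: abs_mult)
  have "M / 4 > 0" using M by simp
  with lim obtain R where R0: "\<forall>\<zeta>. norm \<zeta> \<ge> R \<longrightarrow> dist (u \<zeta>) 0 < M / 4"
    unfolding Lim_at_infinity by blast
  have R: "\<bar>u \<zeta>\<bar> < M / 4" if "norm \<zeta> \<ge> R" for \<zeta>
  proof -
    have "dist (u \<zeta>) 0 < M / 4" using that R0 by blast
    then show ?thesis by (simp add: dist_norm)
  qed
  define R' where "R' = max R (norm \<zeta>1)"
  have cont: "continuous_on UNIV v" unfolding v_def
    by (intro continuous_intros Cinf_on_continuous[OF u])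
  have "compact (cball (0 :: real \<times> 'g) R')" "cball (0 :: real \<times> 'g) R' \<noteq> {}"
    by (auto simp: R'_def intro!: exI[of _ \<zeta>1])
  then obtain \<zeta>0 where "\<zeta>0 \<in> cball 0 R'" and m0: "\<And>\<zeta>. \<zeta> \<in> cball 0 R' \<Longrightarrow> v \<zeta> \<le> v \<zeta>0"
    using continuous_attains_sup[of "cball 0 R'" v] continuous_on_subset[OF cont subset_UNIV] by blast
  have v1: "v \<zeta>1 > 3 * M / 4" using small[of "fst \<zeta>1"] by (simp add: v_def M_def)
  have v10: "v \<zeta>1 \<le> v \<zeta>0" by (rule m0) (simp add: R'_def)
  have max: "v \<zeta> \<le> v \<zeta>0" for \<zeta>
  proof (cases "\<zeta> \<in> cball 0 R'")
    case False
    then have "\<bar>u \<zeta>\<bar> < M / 4" by (intro R) (simp add: R'_def)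
    then have "v \<zeta> < M / 2" using small[of "fst \<zeta>"] unfolding v_def by linarith
    then show ?thesis using v1 v10 M by linarith
  qed (rule m0)
  obtain \<tau>0 z0 where \<zeta>0: "\<zeta>0 = (\<tau>0, z0)" by (cases \<zeta>0)
  have "zop (Z j) (zop (Z j) u) \<zeta>0 \<le> 0" if "j \<in> {1..m}" for j
    unfolding \<zeta>0 using max[of "(\<tau>0, _)"] by (intro zop_zop_at_max u Z that) (simp add: \<zeta>0 v_def)
  then have 1: "(\<Sum>j=1..m. zop (Z j) (zop (Z j) u) \<zeta>0) \<le> 0" by (intro sum_nonpos)
  have ud: "u differentiable (at \<zeta>0)" by (rule Cinf_on_differentiable[OF u]) simp
  have du: "((\<lambda>\<tau>. u (\<tau>, z0)) has_real_derivative dtau u \<zeta>0) (at \<tau>0)"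
    using dtau_slice_has_derivative[of u \<tau>0 z0] ud by (simp add: \<zeta>0 dtau_eq)
  have "((\<lambda>\<tau>. v (\<tau>, z0)) has_real_derivative dtau u \<zeta>0 - (M / 8) * inverse (1 + \<tau>0\<^sup>2)) (at \<tau>0)"
    unfolding v_def fst_conv by (intro DERIV_diff du DERIV_cmult DERIV_arctan)
  then have "dtau u \<zeta>0 - (M / 8) * inverse (1 + \<tau>0\<^sup>2) = 0"
    by (rule DERIV_local_max[where d=1]) (use max \<zeta>0 in auto)
  \<comment> \<open>This is the time derivative of \<open>u\<close> at the maximum, and its being
    strictly positive makes \<open>heat m Z u\<close> negative there.\<close>
  moreover have "(M / 8) * inverse (1 + \<tau>0\<^sup>2) > 0"
    using M by (intro mult_pos_pos) (auto simp: add_pos_nonneg)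
  ultimately have "heat m Z u \<zeta>0 < 0" using 1 by (simp add: heat_def)
  then show False by (simp add: heat)
qed

lemma zop_add:
  assumes "f differentiable (at \<zeta>)" "g differentiable (at \<zeta>)"
  shows "zop V (\<lambda>x. f x + g x) \<zeta> = zop V f \<zeta> + zop V g \<zeta>" "dtau (\<lambda>x. f x + g x) \<zeta> = dtau f \<zeta> + dtau g \<zeta>"
proof -
  have d: "((\<lambda>x. f x + g x) has_derivative (\<lambda>v. frechet_derivative f (at \<zeta>) v + frechet_derivative g (at \<zeta>) v)) (at \<zeta>)"
    using assms[unfolded frechet_derivative_works] by (intro has_derivative_add)
  show "zop V (\<lambda>x. f x + g x) \<zeta> = zop V f \<zeta> + zop V g \<zeta>" "dtau (\<lambda>x. f x + g x) \<zeta> = dtau f \<zeta> + dtau g \<zeta>"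
    using assms by (simp_all add: zop_eq dtau_eq differentiableI[OF d] frechet_derivative_eqI[OF d])
qed

lemma zop_cmult:
  assumes "f differentiable (at \<zeta>)"
  shows "zop V (\<lambda>x. c * f x) \<zeta> = c * zop V f \<zeta>" "dtau (\<lambda>x. c * f x) \<zeta> = c * dtau f \<zeta>"
proof -
  have d: "((\<lambda>x. c * f x) has_derivative (\<lambda>v. c * frechet_derivative f (at \<zeta>) v)) (at \<zeta>)"
    using assms[unfolded frechet_derivative_works] by (intro has_derivative_mult_right)
  show "zop V (\<lambda>x. c * f x) \<zeta> = c * zop V f \<zeta>" "dtau (\<lambda>x. c * f x) \<zeta> = c * dtau f \<zeta>"
    using assms by (simp_all add: zop_eq dtau_eq differentiableI[OF d] frechet_derivative_eqI[OF d])
qed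

lemma heat_lincomb:
  assumes Z: "\<And>j. j \<in> {1..m} \<Longrightarrow> Cinf_on UNIV (Z j)" and f: "Cinf_on UNIV f" and g: "Cinf_on UNIV g"
  shows "heat m Z (\<lambda>x. f x + c * g x) \<zeta> = heat m Z f \<zeta> + c * heat m Z g \<zeta>"
proof -
  note d = Cinf_on_differentiable[OF _ UNIV_I]
  have cg: "Cinf_on UNIV (\<lambda>x. c * g x)" by (intro Cinf_intros g open_UNIV)
  have z1: "zop V (\<lambda>x. f x + c * g x) = (\<lambda>\<zeta>. zop V f \<zeta> + c * zop V g \<zeta>)" for V
    by (rule ext) (simp add: zop_add d f g cg zop_cmult)
  have "zop (Z j) (zop (Z j) (\<lambda>x. f x + c * g x)) \<zeta> = zop (Z j) (zop (Z j) f) \<zeta> + c * zop (Z j) (zop (Z j) g) \<zeta>"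
    if j: "j \<in> {1..m}" for j
  proof -
    have fz: "Cinf_on UNIV (zop (Z j) f)" and gz: "Cinf_on UNIV (zop (Z j) g)"
      by (intro Cinf_on_zop open_UNIV f g Z j)+
    have "Cinf_on UNIV (\<lambda>x. c * zop (Z j) g x)" by (intro Cinf_intros gz open_UNIV)
    then show ?thesis unfolding z1 by (simp add: zop_add d fz gz zop_cmult)
  qed
  then show ?thesis
    by (simp add: heat_def zop_add d f g cg zop_cmult sum.distrib sum_distrib_left algebra_simps)
qed

theorem heat_maximum_principle:
  fixes u :: "real \<times> 'g::euclidean_space \<Rightarrow> real"
  assumes Z: "\<And>j. j \<in> {1..m} \<Longrightarrow> Cinf_on UNIV (Z j)"
    and u: "Cinf_on UNIV u" and heat: "\<And>\<zeta>. heat m Z u \<zeta> = 0" and lim: "(u \<longlongrightarrow> 0) at_infinity"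
  shows "u \<zeta> = 0"
proof -
  have "Cinf_on UNIV (\<lambda>x. 0 + (- 1) * u x)" by (intro Cinf_intros u open_UNIV)
  moreover have "heat m Z (\<lambda>x. 0 + (- 1) * u x) \<zeta> = 0" for \<zeta>
  proof -
    have "zop V (\<lambda>x. 0) = (\<lambda>_. 0)" "dtau (\<lambda>x::real \<times> 'g. 0) = (\<lambda>_. 0)" for V :: "'g \<Rightarrow> 'g"
      by (auto intro!: ext zop_0_outside[of UNIV])
    then have "heat m Z (\<lambda>x. 0) \<zeta> = 0" by (simp add: heat_def)
    then show ?thesis by (subst heat_lincomb) (use Z u heat Cinf_on_const in auto)
  qed
  moreover have "((\<lambda>x. 0 + (- 1) * u x) \<longlongrightarrow> 0) at_infinity" using tendsto_minus[OF lim] by simp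
  ultimately have "0 + (- 1) * u \<zeta> \<le> 0"
    by (intro heat_maximum_principle_le[where u="\<lambda>x. 0 + (- 1) * u x" and m=m and Z=Z] Z)
  moreover have "u \<zeta> \<le> 0" by (rule heat_maximum_principle_le[where m=m and Z=Z, OF Z u heat lim])
  ultimately show ?thesis by simp
qed

section \<open>Convolution with a fundamental solution\<close>

definition prod_star :: "('g \<Rightarrow> 'g \<Rightarrow> 'g) \<Rightarrow> real \<times> 'g \<Rightarrow> real \<times> 'g \<Rightarrow> real \<times> 'g" where
  "prod_star star p q = (fst p + fst q, star (snd p) (snd q))"

definition prod_inv :: "('g \<Rightarrow> 'g) \<Rightarrow> real \<times> 'g \<Rightarrow> real \<times> 'g" where
  "prod_inv ginv p = (- fst p, ginv (snd p))"

text \<open>Time has weight 2, matching the homogeneity of the heat operator.\<close>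

definition prod_wt :: "('g::euclidean_space \<Rightarrow> real) \<Rightarrow> real \<times> 'g \<Rightarrow> real" where
  "prod_wt w e = (if snd e = 0 then 2 else w (snd e))"

lemma wdil_prod_wt: "l > 0 \<Longrightarrow> wdil (prod_wt w) l (\<tau>, z) = (l\<^sup>2 * \<tau>, wdil w l z)"
  unfolding wdil_Pair prod_wt_def
  by (auto simp: wdil_def nonzero_Basis powr_numeral intro!: sum.cong)

lemma pos_prod_wt: "pos_wt w \<Longrightarrow> pos_wt (prod_wt w)"
  by (auto simp: pos_wt_def prod_wt_def Basis_prod_def)

text \<open>Space-time is a homogeneous group again, so invariance of Lebesgue measure under
  translations and inversion is available there without further proof.\<close>

lemma (in hgroup) hgroup_prod: "hgroup (prod_star star) (prod_inv ginv) (prod_wt w)"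
proof
  show "Cinf_on UNIV (\<lambda>(a, b). prod_star star a b)"
    unfolding prod_star_def case_prod_unfold by (intro Cinf_intros open_UNIV)
  show "Cinf_on UNIV (prod_inv ginv)"
    unfolding prod_inv_def by (intro Cinf_intros open_UNIV)
  show "wdil (prod_wt w) l (prod_star star a b) = prod_star star (wdil (prod_wt w) l a) (wdil (prod_wt w) l b)"
    if "l > 0" for l a b
    using that by (cases a; cases b) (simp add: prod_star_def wdil_prod_wt wdil_star algebra_simps)
qed (auto simp: prod_star_def prod_inv_def assoc pos_w pos_prod_wt prod_eq_iff)

lemma integrable_test_fun:
  assumes "test_fun \<phi>" shows "integrable lborel \<phi>"
proof -
  obtain K where K: "compact K" "\<And>z. z \<notin> K \<Longrightarrow> \<phi> z = 0" using test_funE[OF assms] by blast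
  have c: "continuous_on UNIV \<phi>" using assms by (simp add: test_fun_def Cinf_on_continuous)
  have "integrable lborel (\<lambda>z. indicator K z *\<^sub>R \<phi> z)"
    by (rule borel_integrable_compact[OF K(1) continuous_on_subset[OF c]]) simp
  moreover have "(\<lambda>z. indicator K z *\<^sub>R \<phi> z) = \<phi>" using K(2) by (auto simp: indicator_def fun_eq_iff)
  ultimately show ?thesis by (simp only:)
qed

lemma tendsto_0_at_infinity_homeo:
  fixes f :: "'a::euclidean_space \<Rightarrow> real"
  assumes f: "(f \<longlongrightarrow> 0) at_infinity" and T': "continuous_on UNIV T'" "\<And>x. T' (T x) = x"
  shows "((\<lambda>x. f (T x)) \<longlongrightarrow> 0) at_infinity"
  unfolding Lim_at_infinity
proof (intro allI impI)
  fix e :: real assume "e > 0"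
  then obtain b where b: "\<And>x. norm x \<ge> b \<Longrightarrow> dist (f x) 0 < e" using f unfolding Lim_at_infinity by blast
  have "bounded (T' ` cball 0 b)"
    using T'(1) by (intro compact_imp_bounded compact_continuous_image) (auto intro: continuous_on_subset)
  then obtain B where "\<forall>y\<in>T' ` cball 0 b. norm y < B" unfolding bounded_pos_less by blast
  then have B: "norm (T' y) < B" if "y \<in> cball 0 b" for y using that by blast
  have "dist (f (T x)) 0 < e" if "norm x \<ge> B" for x
  proof (rule b, rule ccontr)
    assume "\<not> b \<le> norm (T x)"
    then have "norm (T' (T x)) < B" by (intro B) simp
    then show False using that T'(2) by simp
  qed
  then show "\<exists>b. \<forall>x. b \<le> norm x \<longrightarrow> dist (f (T x)) 0 < e" by blast
qed

lemma loc_int_homeo: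
  fixes f :: "'a::euclidean_space \<Rightarrow> real" and T T' :: "'a \<Rightarrow> 'a"
  assumes f: "loc_int f" and T: "continuous_on UNIV T" "\<And>x. T' (T x) = x"
    and int: "\<And>g :: 'a \<Rightarrow> real. integrable lborel g \<Longrightarrow> integrable lborel (\<lambda>x. g (T x))"
  shows "loc_int (\<lambda>x. f (T x))"
  unfolding loc_int_def
proof (intro allI impI)
  fix K :: "'a set" assume "compact K"
  then have "compact (T ` K)" using T(1) by (intro compact_continuous_image) (auto intro: continuous_on_subset)
  then have "integrable lborel (\<lambda>x. indicator (T ` K) x *\<^sub>R f x)"
    using f by (simp add: loc_int_def set_integrable_def)
  from int[OF this] have "integrable lborel (\<lambda>x. indicator (T ` K) (T x) *\<^sub>R f (T x))" .
  moreover have "indicator (T ` K) (T x) = (indicator K x :: real)" for x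
    using T(2) by (auto simp: indicator_def image_iff) metis
  ultimately show "set_integrable lborel K (\<lambda>x. f (T x))" by (simp add: set_integrable_def)
qed

locale heat_group = hgroup star ginv w
  for star :: "'g::euclidean_space \<Rightarrow> 'g \<Rightarrow> 'g" and ginv w +
  fixes m :: nat and Z :: "nat \<Rightarrow> 'g \<Rightarrow> 'g"
  assumes Z_smooth: "j \<in> {1..m} \<Longrightarrow> Cinf_on UNIV (Z j)"
    and Z_left: "j \<in> {1..m} \<Longrightarrow> left_inv star (Z j)"
    and Z_homog: "j \<in> {1..m} \<Longrightarrow> homog1 (wdil w) (Z j)"
begin

abbreviation "H \<equiv> heat m Z"
abbreviation "HT \<equiv> heatT m Z"
abbreviation "conv \<phi> \<equiv> (\<lambda>(\<omega>, \<nu>). \<phi> (prod_star star \<omega> (prod_inv ginv \<nu>)))"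

interpretation E: hgroup "prod_star star" "prod_inv ginv" "prod_wt w" by (rule hgroup_prod)

lemma Cinf_on_heat: "Cinf_on UNIV \<phi> \<Longrightarrow> Cinf_on UNIV (H \<phi>)"
  unfolding heat_def[abs_def] by (intro Cinf_intros Cinf_on_zop Cinf_on_dtau Z_smooth open_UNIV) auto

lemma test_fun_heat: assumes "test_fun \<phi>" shows "test_fun (H \<phi>)"
proof -
  obtain K where K: "compact K" "\<And>z. z \<notin> K \<Longrightarrow> \<phi> z = 0" using test_funE[OF assms] by blast
  have U: "open (- K)" using K(1) by (simp add: compact_imp_closed open_Compl)
  have "zop V \<phi> x = 0" "dtau \<phi> x = 0" if "x \<notin> K" for V x
    using zop_0_outside[OF U, of x \<phi>] that K(2) by auto
  note z = this
  have zz: "zop V (zop V \<phi>) x = 0" if "x \<notin> K" for V x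
    by (rule zop_0_outside(1)[OF U]) (use that z(1) in auto)
  have "H \<phi> x = 0" if "x \<notin> K" for x using z(2)[OF that] zz[OF that] by (simp add: heat_def)
  then show ?thesis using K(1) assms by (intro test_funI[of _ K] Cinf_on_heat) (auto simp: test_fun_def)
qed

text \<open>Each \<open>Z j\<close> is free of divergence, so its transpose is \<open>- Z j\<close>
  and the sign disappears in the square; only the time derivative changes sign.\<close>

lemma heat_transpose_eq:
  assumes \<phi>: "Cinf_on UNIV \<phi>" shows "heat_transpose m Z \<phi> = HT \<phi>"
proof
  fix \<zeta>
  have "ztrans (Z j) (ztrans (Z j) \<phi>) \<zeta> = zop (Z j) (zop (Z j) \<phi>) \<zeta>" if j: "j \<in> {1..m}" for j
  proof -
    have div: "vf_div (Z j) z = 0" for z by (intro homog1_div_free Z_smooth Z_homog j)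
    have 1: "ztrans (Z j) \<phi> = (\<lambda>\<zeta>. (- 1) * zop (Z j) \<phi> \<zeta>)" by (auto simp: ztrans_def div)
    have "Cinf_on UNIV (zop (Z j) \<phi>)" by (intro Cinf_on_zop \<phi> Z_smooth j open_UNIV)
    from zop_cmult(1)[OF Cinf_on_differentiable[OF this UNIV_I], of "Z j" "- 1" \<zeta>] 
    show ?thesis unfolding 1 by (simp add: ztrans_def div)
  qed
  then show "heat_transpose m Z \<phi> \<zeta> = HT \<phi> \<zeta>" by (simp add: heat_transpose_def heatT_def)
qed

lemma Cinf_on_conv: "Cinf_on UNIV \<phi> \<Longrightarrow> Cinf_on UNIV (conv \<phi>)"
  unfolding case_prod_unfold
  by (rule Cinf_on_compose_UNIV[where f=\<phi>, OF open_UNIV], assumption) (intro Cinf_intros open_UNIV)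

text \<open>Moving \<open>\<omega>\<close> along a left-invariant field inserts a factor
  \<open>a\<close> between \<open>\<omega>\<close> and the inverse of \<open>\<nu>\<close>; moving
  \<open>\<nu>\<close> inserts the inverse of \<open>a\<close> in the same place. This is why the
  kernel carries the inverse of \<open>\<nu>\<close> on the right.\<close>

lemma zop_conv:
  assumes \<phi>: "Cinf_on UNIV \<phi>" and V: "left_inv star V"
  shows "zop V (\<lambda>\<omega>. conv \<phi> (\<omega>, \<nu>)) \<omega> = - zop V (\<lambda>\<nu>. conv \<phi> (\<omega>, \<nu>)) \<nu>"
proof -
  obtain \<tau> z where \<omega>: "\<omega> = (\<tau>, z)" by (cases \<omega>)
  obtain \<tau>' z' where \<nu>: "\<nu> = (\<tau>', z')" by (cases \<nu>)
  let ?q1 = "\<lambda>z. \<phi> (\<tau> - \<tau>', star z (ginv z'))" and ?q2 = "\<lambda>z'. \<phi> (\<tau> - \<tau>', star z (ginv z'))"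
  let ?Q = "\<lambda>a. \<phi> (\<tau> - \<tau>', star (star z a) (ginv z'))"
  have c: "Cinf_on UNIV ?q1" "Cinf_on UNIV ?q2" "Cinf_on UNIV ?Q"
    by (intro Cinf_on_compose_UNIV[OF _ \<phi>] Cinf_intros open_UNIV)+
  have Q: "(?Q has_derivative frechet_derivative ?Q (at 0)) (at (ginv 0))"
    using Cinf_on_has_derivative[OF c(3), of 0] by simp
  have "zop V (\<lambda>\<omega>. conv \<phi> (\<omega>, \<nu>)) \<omega> = frechet_derivative ?q1 (at z) (V z)"
    by (simp add: zop_def \<omega> \<nu> prod_star_def prod_inv_def)
  also have "\<dots> = frechet_derivative ?Q (at 0) (V 0)"
    by (rule left_inv_deriv(2)[OF V]) (rule Cinf_on_differentiable[OF c(1) UNIV_I])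
  finally have 1: "zop V (\<lambda>\<omega>. conv \<phi> (\<omega>, \<nu>)) \<omega> = frechet_derivative ?Q (at 0) (V 0)" .
  have "zop V (\<lambda>\<nu>. conv \<phi> (\<omega>, \<nu>)) \<nu> = frechet_derivative ?q2 (at z') (V z')"
    by (simp add: zop_def \<omega> \<nu> prod_star_def prod_inv_def)
  also have "\<dots> = frechet_derivative (\<lambda>a. ?q2 (star z' a)) (at 0) (V 0)"
    by (rule left_inv_deriv(2)[OF V]) (rule Cinf_on_differentiable[OF c(2) UNIV_I])
  also have "(\<lambda>a. ?q2 (star z' a)) = (\<lambda>a. ?Q (ginv a))" by (simp add: ginv_star assoc)
  also have "frechet_derivative (\<lambda>a. ?Q (ginv a)) (at 0) (V 0) = frechet_derivative ?Q (at 0) (- V 0)"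
    by (rule frechet_derivative_eqI[OF has_derivative_compose[OF ginv_deriv0 Q]])
  also have "\<dots> = - frechet_derivative ?Q (at 0) (V 0)"
    using linear_neg[OF has_derivative_linear[OF Q]] by simp
  finally show ?thesis using 1 by simp
qed

lemma dtau_conv:
  assumes \<phi>: "Cinf_on UNIV \<phi>"
  shows "dtau (\<lambda>\<omega>. conv \<phi> (\<omega>, \<nu>)) \<omega> = - dtau (\<lambda>\<nu>. conv \<phi> (\<omega>, \<nu>)) \<nu>"
proof -
  obtain \<tau> z where \<omega>: "\<omega> = (\<tau>, z)" by (cases \<omega>)
  obtain \<tau>' z' where \<nu>: "\<nu> = (\<tau>', z')" by (cases \<nu>)
  let ?z = "star z (ginv z')"
  have D: "((\<lambda>t. \<phi> (t, ?z)) has_real_derivative dtau \<phi> (\<tau> - \<tau>', ?z)) (at (\<tau> - \<tau>'))"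
    using dtau_slice_has_derivative[of \<phi> "\<tau> - \<tau>'" ?z] Cinf_on_differentiable[OF \<phi> UNIV_I] by (simp add: dtau_eq)
  have s1: "((\<lambda>t. t - \<tau>') has_real_derivative 1) (at \<tau>)" and s2: "((\<lambda>t. \<tau> - t) has_real_derivative - 1) (at \<tau>')"
    by (auto intro!: derivative_eq_intros)
  have 1: "dtau (\<lambda>\<omega>. conv \<phi> (\<omega>, \<nu>)) \<omega> = dtau \<phi> (\<tau> - \<tau>', ?z)"
  proof -
    have "dtau (\<lambda>\<omega>. conv \<phi> (\<omega>, \<nu>)) \<omega> = deriv (\<lambda>t. \<phi> (t - \<tau>', ?z)) \<tau>"
      by (simp add: dtau_def \<omega> \<nu> prod_star_def prod_inv_def)
    then show ?thesis using DERIV_imp_deriv[OF DERIV_chain2[OF D s1]] by simp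
  qed
  have 2: "dtau (\<lambda>\<nu>. conv \<phi> (\<omega>, \<nu>)) \<nu> = - dtau \<phi> (\<tau> - \<tau>', ?z)"
  proof -
    have "dtau (\<lambda>\<nu>. conv \<phi> (\<omega>, \<nu>)) \<nu> = deriv (\<lambda>t. \<phi> (\<tau> - t, ?z)) \<tau>'"
      by (simp add: dtau_def \<omega> \<nu> prod_star_def prod_inv_def)
    then show ?thesis using DERIV_imp_deriv[OF DERIV_chain2[OF D s2]] by simp
  qed
  show ?thesis using 1 2 by simp
qed

text \<open>The fields act on different variables, so no coefficient is differentiated, and symmetry
  of the second derivative in two frozen directions is enough.\<close>

lemma zop_commute:
  fixes \<psi> :: "(real \<times> 'g) \<times> (real \<times> 'g) \<Rightarrow> real"
  assumes \<psi>: "Cinf_on UNIV \<psi>"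
  shows "zop V (\<lambda>\<omega>. zop W (\<lambda>\<nu>. \<psi> (\<omega>, \<nu>)) \<nu>) \<omega> = zop W (\<lambda>\<nu>. zop V (\<lambda>\<omega>. \<psi> (\<omega>, \<nu>)) \<omega>) \<nu>"
proof -
  note d = Cinf_on_differentiable[OF _ UNIV_I]
  have s: "Cinf_on UNIV (\<lambda>\<nu>. f (\<omega>, \<nu>))" "Cinf_on UNIV (\<lambda>\<omega>. f (\<omega>, \<nu>))" if "Cinf_on UNIV f"
    for f :: "(real \<times> 'g) \<times> (real \<times> 'g) \<Rightarrow> real" and \<omega> \<nu>
    by (intro Cinf_on_compose_UNIV[OF _ that] Cinf_intros open_UNIV)+
  let ?u = "((0, V (snd \<omega>)), 0)" and ?v = "(0, (0, W (snd \<nu>)))"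
  have F: "Cinf_on UNIV (\<lambda>p. frechet_derivative \<psi> (at p) c)" for c by (rule Cinf_on_frechet[OF \<psi>])
  have 1: "zop W (\<lambda>\<nu>. \<psi> (\<omega>, \<nu>)) \<nu> = frechet_derivative \<psi> (at (\<omega>, \<nu>)) ?v" for \<omega>
    by (simp add: zop_eq d s \<psi> frechet_derivative_slice_snd)
  have 2: "zop V (\<lambda>\<omega>. \<psi> (\<omega>, \<nu>)) \<omega> = frechet_derivative \<psi> (at (\<omega>, \<nu>)) ?u" for \<nu>
    by (simp add: zop_eq d s \<psi> frechet_derivative_slice_fst)
  have 3: "zop V (\<lambda>\<omega>. frechet_derivative \<psi> (at (\<omega>, \<nu>)) c) \<omega>
      = frechet_derivative (\<lambda>p. frechet_derivative \<psi> (at p) c) (at (\<omega>, \<nu>)) ?u" for c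
    using zop_eq[OF d[OF s(2)[OF F]]] frechet_derivative_slice_fst[OF d[OF F]] by simp
  have 4: "zop W (\<lambda>\<nu>. frechet_derivative \<psi> (at (\<omega>, \<nu>)) c) \<nu>
      = frechet_derivative (\<lambda>p. frechet_derivative \<psi> (at p) c) (at (\<omega>, \<nu>)) ?v" for c
    using zop_eq[OF d[OF s(1)[OF F]]] frechet_derivative_slice_snd[OF d[OF F]] by simp
  show ?thesis unfolding 1 2 3 4 by (rule frechet_derivative_commute[OF \<psi>])
qed

text \<open>Every derivative changes sign when it is moved from \<open>\<omega>\<close> to
  \<open>\<nu>\<close>: the squares are unaffected, the time derivative is not. The factors of a
  square are moved one at a time, and \<open>zop_commute\<close> allows the second to pass the
  first.\<close>

lemma heat_conv:
  assumes \<phi>: "Cinf_on UNIV \<phi>"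
  shows "H (\<lambda>\<omega>. conv \<phi> (\<omega>, \<nu>)) \<omega> = HT (\<lambda>\<nu>. conv \<phi> (\<omega>, \<nu>)) \<nu>"
proof -
  note \<psi> = Cinf_on_conv[OF \<phi>]
  have s: "Cinf_on UNIV (\<lambda>\<nu>. conv \<phi> (\<omega>, \<nu>))" "Cinf_on UNIV (\<lambda>\<omega>. conv \<phi> (\<omega>, \<nu>))" for \<omega> \<nu>
    by (intro Cinf_on_compose_UNIV[OF _ \<psi>] Cinf_intros open_UNIV)+
  have neg: "zop V (\<lambda>x. - g x) \<zeta> = - zop V g \<zeta>" if "g differentiable (at \<zeta>)" for V g and \<zeta> :: "real \<times> 'g"
    using zop_cmult(1)[OF that, of V "- 1"] by simp
  have "zop (Z j) (zop (Z j) (\<lambda>\<omega>. conv \<phi> (\<omega>, \<nu>))) \<omega> = zop (Z j) (zop (Z j) (\<lambda>\<nu>. conv \<phi> (\<omega>, \<nu>))) \<nu>"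
    if j: "j \<in> {1..m}" for j
  proof -
    let ?A = "\<lambda>\<omega> \<nu>. zop (Z j) (\<lambda>\<omega>. conv \<phi> (\<omega>, \<nu>)) \<omega>" and ?B = "\<lambda>\<omega> \<nu>. zop (Z j) (\<lambda>\<nu>. conv \<phi> (\<omega>, \<nu>)) \<nu>"
    have A: "?A \<omega> \<nu> = - ?B \<omega> \<nu>" for \<omega> \<nu> by (rule zop_conv[OF \<phi> Z_left[OF j]])
    have dB: "?B \<omega> differentiable (at \<nu>)" and dA: "(\<lambda>\<omega>. ?A \<omega> \<nu>) differentiable (at \<omega>)" for \<omega> \<nu>
      by (intro Cinf_on_differentiable[OF _ UNIV_I] Cinf_on_zop open_UNIV s Z_smooth j)+
    have "zop (Z j) (\<lambda>\<nu>. ?A \<omega> \<nu>) \<nu> = zop (Z j) (\<lambda>\<nu>. - ?B \<omega> \<nu>) \<nu>" by (simp only: A)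
    also have "\<dots> = - zop (Z j) (?B \<omega>) \<nu>" by (rule neg[OF dB])
    finally have "zop (Z j) (?B \<omega>) \<nu> = - zop (Z j) (\<lambda>\<nu>. ?A \<omega> \<nu>) \<nu>" by simp
    also have "zop (Z j) (\<lambda>\<nu>. ?A \<omega> \<nu>) \<nu> = zop (Z j) (\<lambda>\<omega>. ?B \<omega> \<nu>) \<omega>"
      by (rule zop_commute[OF \<psi>, symmetric])
    also have "(\<lambda>\<omega>. ?B \<omega> \<nu>) = (\<lambda>\<omega>. - ?A \<omega> \<nu>)" by (rule ext) (simp only: A minus_minus)
    also have "zop (Z j) (\<lambda>\<omega>. - ?A \<omega> \<nu>) \<omega> = - zop (Z j) (\<lambda>\<omega>. ?A \<omega> \<nu>) \<omega>" by (rule neg[OF dA])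
    finally show ?thesis by simp
  qed
  then show ?thesis using dtau_conv[OF \<phi>, of \<nu> \<omega>] by (simp add: heat_def heatT_def)
qed

lemma test_fun_conv:
  assumes "test_fun \<phi>" shows "test_fun (\<lambda>\<nu>. conv \<phi> (\<omega>, \<nu>))" and "loc_supp (conv \<phi>)"
proof -
  obtain K where K: "compact K" "\<And>z. z \<notin> K \<Longrightarrow> \<phi> z = 0" using test_funE[OF assms] by blast
  have \<phi>: "Cinf_on UNIV \<phi>" using assms by (simp add: test_fun_def)
  \<comment> \<open>The condition \<open>\<omega> \<star> \<nu>\<^sup>-\<^sup>1 \<in> K\<close> says
    that \<open>\<nu>\<close> lies in \<open>K\<^sup>-\<^sup>1 \<star> \<omega>\<close>.\<close>
  let ?S = "\<lambda>R. (\<lambda>(k, \<omega>). prod_star star (prod_inv ginv k) \<omega>) ` (K \<times> cball 0 R)"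
  have S: "compact (?S R)" for R unfolding case_prod_unfold
    by (intro compact_continuous_image compact_Times K compact_cball E.continuous_on_star E.continuous_on_ginv continuous_intros)
  have 0: "conv \<phi> (\<omega>, \<nu>) = 0" if "norm \<omega> \<le> R" "\<nu> \<notin> ?S R" for \<omega> \<nu> R
  proof -
    have "prod_star star \<omega> (prod_inv ginv \<nu>) \<notin> K"
    proof
      assume a: "prod_star star \<omega> (prod_inv ginv \<nu>) \<in> K"
      have "\<nu> = prod_star star (prod_inv ginv (prod_star star \<omega> (prod_inv ginv \<nu>))) \<omega>"
        by (simp add: E.ginv_star E.assoc)
      then show False using a that by (auto intro!: image_eqI[where x="(prod_star star \<omega> (prod_inv ginv \<nu>), \<omega>)"])
    qed
    then show ?thesis using K(2) by simp
  qed
  show "loc_supp (conv \<phi>)" unfolding loc_supp_def using S 0 by blast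
  have "Cinf_on UNIV (\<lambda>\<nu>. conv \<phi> (\<omega>, \<nu>))"
    by (intro Cinf_on_compose_UNIV[OF _ Cinf_on_conv[OF \<phi>]] Cinf_intros open_UNIV)
  then show "test_fun (\<lambda>\<nu>. conv \<phi> (\<omega>, \<nu>))"
    by (rule test_funI[OF _ S[of "norm \<omega>"]]) (use 0 in blast)
qed

text \<open>These properties are bundled because they pass together to the rescaled and to the
  reflected function. Continuity off the origin enters separately, where equal integrals are turned
  into equal values.\<close>

definition green :: "(real \<times> 'g \<Rightarrow> real) \<Rightarrow> bool" where
  "green \<gamma> \<longleftrightarrow> loc_int \<gamma> \<and> (\<gamma> \<longlongrightarrow> 0) at_infinity \<and>
     (\<forall>\<phi>. test_fun \<phi> \<longrightarrow> (\<integral>\<zeta>. \<gamma> \<zeta> * HT \<phi> \<zeta> \<partial>lborel) = - \<phi> 0)"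

text \<open>The group convolution of \<open>\<phi>\<close> with \<open>\<gamma>\<close>, written so
  that \<open>\<omega>\<close> occurs in the smooth factor alone.\<close>

definition pot :: "(real \<times> 'g \<Rightarrow> real) \<Rightarrow> (real \<times> 'g \<Rightarrow> real) \<Rightarrow> real \<times> 'g \<Rightarrow> real" where
  "pot \<gamma> \<phi> \<omega> = (\<integral>\<nu>. \<gamma> \<nu> * conv \<phi> (\<omega>, \<nu>) \<partial>lborel)"

lemma Cinf_on_pot: "green \<gamma> \<Longrightarrow> test_fun \<phi> \<Longrightarrow> Cinf_on UNIV (pot \<gamma> \<phi>)"
  unfolding pot_def[abs_def]
  by (rule Cinf_on_param_integral) (auto intro: test_fun_conv Cinf_on_conv simp: green_def test_fun_def)

lemma param_integral_zop:
  fixes \<psi> :: "(real \<times> 'g) \<times> (real \<times> 'g) \<Rightarrow> real" and V :: "'g \<Rightarrow> 'g"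
  assumes \<gamma>: "loc_int \<gamma>" and \<psi>: "Cinf_on UNIV \<psi>" "loc_supp \<psi>" and V: "Cinf_on UNIV V"
  shows "zop V (\<lambda>\<omega>. \<integral>\<nu>. \<gamma> \<nu> * \<psi> (\<omega>, \<nu>) \<partial>lborel) = (\<lambda>\<omega>. \<integral>\<nu>. \<gamma> \<nu> * zop V (\<lambda>\<omega>. \<psi> (\<omega>, \<nu>)) \<omega> \<partial>lborel)"
    and "dtau (\<lambda>\<omega>. \<integral>\<nu>. \<gamma> \<nu> * \<psi> (\<omega>, \<nu>) \<partial>lborel) = (\<lambda>\<omega>. \<integral>\<nu>. \<gamma> \<nu> * dtau (\<lambda>\<omega>. \<psi> (\<omega>, \<nu>)) \<omega> \<partial>lborel)"
    and "Cinf_on UNIV (\<lambda>(\<omega>, \<nu>). zop V (\<lambda>\<omega>. \<psi> (\<omega>, \<nu>)) \<omega>)" "loc_supp (\<lambda>(\<omega>, \<nu>). zop V (\<lambda>\<omega>. \<psi> (\<omega>, \<nu>)) \<omega>)"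
    and "integrable lborel (\<lambda>\<nu>. \<gamma> \<nu> * dtau (\<lambda>\<omega>. \<psi> (\<omega>, \<nu>)) \<omega>)"
proof -
  note d = Cinf_on_differentiable[OF _ UNIV_I]
  have s: "Cinf_on UNIV (\<lambda>\<omega>. \<psi> (\<omega>, \<nu>))" for \<nu>
    by (intro Cinf_on_compose_UNIV[OF _ \<psi>(1)] Cinf_intros open_UNIV)
  have V': "Cinf_on UNIV (\<lambda>\<omega>::real \<times> 'g. (0::real, V (snd \<omega>)))"
    by (intro Cinf_intros Cinf_on_compose_UNIV[OF _ V] open_UNIV)
  have 1: "zop V (\<lambda>\<omega>. \<psi> (\<omega>, \<nu>)) \<omega> = frechet_derivative \<psi> (at (\<omega>, \<nu>)) ((0, V (snd \<omega>)), 0)"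
    and 2: "dtau (\<lambda>\<omega>. \<psi> (\<omega>, \<nu>)) \<omega> = frechet_derivative \<psi> (at (\<omega>, \<nu>)) ((1, 0), 0)" for \<omega> \<nu>
    using frechet_derivative_slice_fst[OF d[OF \<psi>(1)]] by (simp_all add: zop_eq dtau_eq d[OF s])
  note D = param_integral_has_derivative[OF \<gamma> \<psi>]
  show "zop V (\<lambda>\<omega>. \<integral>\<nu>. \<gamma> \<nu> * \<psi> (\<omega>, \<nu>) \<partial>lborel) = (\<lambda>\<omega>. \<integral>\<nu>. \<gamma> \<nu> * zop V (\<lambda>\<omega>. \<psi> (\<omega>, \<nu>)) \<omega> \<partial>lborel)"
    unfolding 1 by (rule ext) (simp add: zop_eq differentiableI[OF D] frechet_derivative_eqI[OF D])
  show "dtau (\<lambda>\<omega>. \<integral>\<nu>. \<gamma> \<nu> * \<psi> (\<omega>, \<nu>) \<partial>lborel) = (\<lambda>\<omega>. \<integral>\<nu>. \<gamma> \<nu> * dtau (\<lambda>\<omega>. \<psi> (\<omega>, \<nu>)) \<omega> \<partial>lborel)"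
    unfolding 2 by (rule ext) (simp add: dtau_eq differentiableI[OF D] frechet_derivative_eqI[OF D])
  show "Cinf_on UNIV (\<lambda>(\<omega>, \<nu>). zop V (\<lambda>\<omega>. \<psi> (\<omega>, \<nu>)) \<omega>)" "loc_supp (\<lambda>(\<omega>, \<nu>). zop V (\<lambda>\<omega>. \<psi> (\<omega>, \<nu>)) \<omega>)"
    unfolding 1 by (rule Cinf_on_deriv_fst[OF \<psi>(1) V'] loc_supp_deriv[OF \<psi>])+
  show "integrable lborel (\<lambda>\<nu>. \<gamma> \<nu> * dtau (\<lambda>\<omega>. \<psi> (\<omega>, \<nu>)) \<omega>)"
    using loc_supp_integrable[OF \<gamma> Cinf_on_deriv_fst[OF \<psi>(1) Cinf_on_const] loc_supp_deriv[OF \<psi>], of "(1, 0)" \<omega>]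
    unfolding 2 by simp
qed

text \<open>Under the integral \<open>H\<close> falls on the smooth factor, \<open>heat_conv\<close>
  turns it into \<open>HT\<close> in the variable of integration, and the distributional equation
  evaluates the result at \<open>\<nu> = 0\<close>.\<close>

lemma heat_pot:
  assumes g: "green \<gamma>" and t: "test_fun \<phi>" shows "H (pot \<gamma> \<phi>) \<omega> = - \<phi> \<omega>"
proof -
  have \<gamma>: "loc_int \<gamma>" using g by (simp add: green_def)
  have \<phi>: "Cinf_on UNIV \<phi>" using t by (simp add: test_fun_def)
  note \<psi> = Cinf_on_conv[OF \<phi>] test_fun_conv(2)[OF t]
  let ?A = "\<lambda>j. (\<lambda>(\<omega>, \<nu>). zop (Z j) (\<lambda>\<omega>. conv \<phi> (\<omega>, \<nu>)) \<omega>)"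
  have zz: "zop (Z j) (zop (Z j) (pot \<gamma> \<phi>)) \<omega> = (\<integral>\<nu>. \<gamma> \<nu> * zop (Z j) (\<lambda>\<omega>. ?A j (\<omega>, \<nu>)) \<omega> \<partial>lborel)"
    and zi: "integrable lborel (\<lambda>\<nu>. \<gamma> \<nu> * zop (Z j) (\<lambda>\<omega>. ?A j (\<omega>, \<nu>)) \<omega>)" if j: "j \<in> {1..m}" for j
  proof -
    note 1 = param_integral_zop[OF \<gamma> \<psi> Z_smooth[OF j]]
    note 2 = param_integral_zop[OF \<gamma> 1(3,4) Z_smooth[OF j]]
    show "zop (Z j) (zop (Z j) (pot \<gamma> \<phi>)) \<omega> = (\<integral>\<nu>. \<gamma> \<nu> * zop (Z j) (\<lambda>\<omega>. ?A j (\<omega>, \<nu>)) \<omega> \<partial>lborel)"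
      using fun_cong[OF 2(1), of \<omega>] unfolding pot_def[abs_def] 1(1) by simp
    show "integrable lborel (\<lambda>\<nu>. \<gamma> \<nu> * zop (Z j) (\<lambda>\<omega>. ?A j (\<omega>, \<nu>)) \<omega>)"
      using loc_supp_integrable[OF \<gamma> 2(3,4), of \<omega>] by simp
  qed
  \<comment> \<open>\<open>param_integral_zop\<close> is stated for a field; its clauses on the time
    derivative are instantiated with the zero field.\<close>
  have Z0: "Cinf_on UNIV (\<lambda>x::'g. 0 :: 'g)" by (rule Cinf_on_const)
  have "H (pot \<gamma> \<phi>) \<omega> = (\<Sum>j=1..m. \<integral>\<nu>. \<gamma> \<nu> * zop (Z j) (\<lambda>\<omega>. ?A j (\<omega>, \<nu>)) \<omega> \<partial>lborel)
      - (\<integral>\<nu>. \<gamma> \<nu> * dtau (\<lambda>\<omega>. conv \<phi> (\<omega>, \<nu>)) \<omega> \<partial>lborel)"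
    using zz param_integral_zop(2)[OF \<gamma> \<psi> Z0] by (simp add: heat_def pot_def[abs_def])
  also have "\<dots> = (\<integral>\<nu>. (\<Sum>j=1..m. \<gamma> \<nu> * zop (Z j) (\<lambda>\<omega>. ?A j (\<omega>, \<nu>)) \<omega>) - \<gamma> \<nu> * dtau (\<lambda>\<omega>. conv \<phi> (\<omega>, \<nu>)) \<omega> \<partial>lborel)"
    using zi param_integral_zop(5)[OF \<gamma> \<psi> Z0]
    by (subst Bochner_Integration.integral_diff) (auto simp: Bochner_Integration.integral_sum)
  also have "\<dots> = (\<integral>\<nu>. \<gamma> \<nu> * H (\<lambda>\<omega>. conv \<phi> (\<omega>, \<nu>)) \<omega> \<partial>lborel)"
    by (simp add: heat_def algebra_simps sum_distrib_left)
  also have "\<dots> = (\<integral>\<nu>. \<gamma> \<nu> * HT (\<lambda>\<nu>. conv \<phi> (\<omega>, \<nu>)) \<nu> \<partial>lborel)" by (simp only: heat_conv[OF \<phi>])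
  also have "\<dots> = - conv \<phi> (\<omega>, 0)" using g test_fun_conv(1)[OF t, of \<omega>] unfolding green_def by blast
  finally show ?thesis by simp
qed

text \<open>For distant \<open>\<omega>\<close> the kernel is supported where
  \<open>\<gamma>\<close> is small, and its mass in \<open>\<nu>\<close> does not depend on
  \<open>\<omega>\<close>, because Lebesgue measure is invariant under inversion and left
  translation.\<close>

lemma pot_tendsto_0:
  assumes g: "green \<gamma>" and t: "test_fun \<phi>" shows "(pot \<gamma> \<phi> \<longlongrightarrow> 0) at_infinity"
  unfolding Lim_at_infinity
proof (intro allI impI)
  fix e :: real assume e: "e > 0"
  obtain K where K: "compact K" "\<And>z. z \<notin> K \<Longrightarrow> \<phi> z = 0" using test_funE[OF t] by blast
  define C where "C = (\<integral>z. \<bar>\<phi> z\<bar> \<partial>lborel)"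
  have C: "C \<ge> 0" by (simp add: C_def)
  \<comment> \<open>The summand 1 covers the case \<open>C = 0\<close>.\<close>
  define \<epsilon> where "\<epsilon> = e / (C + 1)"
  have \<epsilon>: "\<epsilon> > 0" using e C by (simp add: \<epsilon>_def)
  have \<epsilon>C: "\<epsilon> * C < e"
  proof -
    have "e * C < e * (C + 1)" using e by simp
    then show ?thesis using C by (simp add: \<epsilon>_def pos_divide_less_eq)
  qed
  have "(\<gamma> \<longlongrightarrow> 0) at_infinity" using g by (simp add: green_def)
  then obtain R where R0: "\<forall>x. norm x \<ge> R \<longrightarrow> dist (\<gamma> x) 0 < \<epsilon>"
    using \<epsilon> unfolding Lim_at_infinity by blast
  have R: "\<bar>\<gamma> x\<bar> \<le> \<epsilon>" if "norm x \<ge> R" for x using R0[rule_format, OF that] by (simp only: dist_norm diff_zero real_norm_def)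
  have "compact ((\<lambda>p. prod_star star (fst p) (snd p)) ` (K \<times> cball 0 R))"
    by (intro compact_continuous_image compact_Times K compact_cball E.continuous_on_star continuous_intros)
  from compact_imp_bounded[OF this] obtain B where
    B: "\<And>x. x \<in> (\<lambda>p. prod_star star (fst p) (snd p)) ` (K \<times> cball 0 R) \<Longrightarrow> norm x \<le> B"
    unfolding bounded_iff by blast
  have "dist (pot \<gamma> \<phi> \<omega>) 0 < e" if \<omega>: "norm \<omega> \<ge> B + 1" for \<omega>
  proof -
    have i1: "integrable lborel (\<lambda>\<nu>. \<gamma> \<nu> * conv \<phi> (\<omega>, \<nu>))"
      using g t by (intro loc_supp_integrable Cinf_on_conv test_fun_conv) (auto simp: green_def test_fun_def)
    have i2: "integrable lborel (\<lambda>\<nu>. \<epsilon> * \<bar>conv \<phi> (\<omega>, \<nu>)\<bar>)"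
      by (intro integrable_mult_right integrable_abs integrable_test_fun test_fun_conv t)
    have "\<bar>\<gamma> \<nu> * conv \<phi> (\<omega>, \<nu>)\<bar> \<le> \<epsilon> * \<bar>conv \<phi> (\<omega>, \<nu>)\<bar>" for \<nu>
    proof (cases "conv \<phi> (\<omega>, \<nu>) = 0")
      case False
      then have "\<phi> (prod_star star \<omega> (prod_inv ginv \<nu>)) \<noteq> 0" by simp
      then have k: "prod_star star \<omega> (prod_inv ginv \<nu>) \<in> K" using K(2) by blast
      have "norm \<nu> \<ge> R"
      proof (rule ccontr)
        assume "\<not> norm \<nu> \<ge> R"
        then have "prod_star star (prod_star star \<omega> (prod_inv ginv \<nu>)) \<nu> \<in> (\<lambda>p. prod_star star (fst p) (snd p)) ` (K \<times> cball 0 R)"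
          using k by (intro image_eqI[where x="(prod_star star \<omega> (prod_inv ginv \<nu>), \<nu>)"]) auto
        from B[OF this] show False using \<omega> by simp
      qed
      then show ?thesis using R by (simp add: abs_mult mult_right_mono)
    qed simp
    then have "norm (pot \<gamma> \<phi> \<omega>) \<le> (\<integral>\<nu>. \<epsilon> * \<bar>conv \<phi> (\<omega>, \<nu>)\<bar> \<partial>lborel)"
      unfolding pot_def real_norm_def[symmetric]
      by (intro Bochner_Integration.integral_norm_bound_integral[OF i1 i2[unfolded real_norm_def[symmetric]]])
    then have "\<bar>pot \<gamma> \<phi> \<omega>\<bar> \<le> (\<integral>\<nu>. \<epsilon> * \<bar>conv \<phi> (\<omega>, \<nu>)\<bar> \<partial>lborel)" by (simp only: real_norm_def)
    also have "\<dots> = \<epsilon> * (\<integral>\<nu>. \<bar>\<phi> (prod_star star \<omega> (prod_inv ginv \<nu>))\<bar> \<partial>lborel)" by simp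
    also have "(\<integral>\<nu>. \<bar>\<phi> (prod_star star \<omega> (prod_inv ginv \<nu>))\<bar> \<partial>lborel) = C"
      using E.integral_ginv[of "\<lambda>\<nu>. \<bar>\<phi> (prod_star star \<omega> \<nu>)\<bar>"] E.integral_left[of "\<lambda>\<nu>. \<bar>\<phi> \<nu>\<bar>" \<omega>] by (simp add: C_def)
    finally show ?thesis using \<epsilon>C by (simp only: dist_norm diff_zero real_norm_def)
  qed
  then show "\<exists>b. \<forall>x. b \<le> norm x \<longrightarrow> dist (pot \<gamma> \<phi> x) 0 < e" by blast
qed

text \<open>The distributional equation tests \<open>\<gamma>\<close> against \<open>HT\<close>
  only. That convolution with \<open>\<gamma>\<close> inverts \<open>H\<close> from this side as
  well is a consequence of the maximum principle: \<open>pot \<gamma> (H \<phi>) + \<phi>\<close>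
  solves the heat equation by \<open>heat_pot\<close> and vanishes at infinity.\<close>

lemma pot_heat:
  assumes g: "green \<gamma>" and t: "test_fun \<phi>" shows "pot \<gamma> (H \<phi>) \<omega> = - \<phi> \<omega>"
proof -
  have \<phi>: "Cinf_on UNIV \<phi>" using t by (simp add: test_fun_def)
  have th: "test_fun (H \<phi>)" by (rule test_fun_heat[OF t])
  let ?u = "\<lambda>\<omega>. pot \<gamma> (H \<phi>) \<omega> + 1 * \<phi> \<omega>"
  have "?u \<omega> = 0"
  proof (rule heat_maximum_principle[where u="?u" and m=m and Z=Z, OF Z_smooth])
    show "Cinf_on UNIV ?u" by (intro Cinf_intros Cinf_on_pot g th \<phi> open_UNIV)
    show "H ?u \<zeta> = 0" for \<zeta>
      using heat_lincomb[where m=m and Z=Z and c=1, OF Z_smooth Cinf_on_pot[OF g th] \<phi>] heat_pot[OF g th] by simp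
    have "(\<phi> \<longlongrightarrow> 0) at_infinity"
    proof -
      obtain K where K: "compact K" "\<And>z. z \<notin> K \<Longrightarrow> \<phi> z = 0" using test_funE[OF t] by blast
      obtain B where "\<And>z. z \<in> K \<Longrightarrow> norm z \<le> B" using compact_imp_bounded[OF K(1)] bounded_iff by blast
      then have "\<forall>z. norm z \<ge> B + 1 \<longrightarrow> \<phi> z = 0" using K(2) by (smt (verit))
      then show ?thesis by (intro tendsto_eventually) (auto simp: eventually_at_infinity)
    qed
    then show "(?u \<longlongrightarrow> 0) at_infinity" using tendsto_add[OF pot_tendsto_0[OF g th]] by fastforce
  qed
  then show ?thesis by simp
qed

lemma pot_unique:
  assumes "green \<gamma>1" "green \<gamma>2" and t: "test_fun \<phi>" shows "pot \<gamma>1 \<phi> \<omega> = pot \<gamma>2 \<phi> \<omega>"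
proof -
  let ?u = "\<lambda>\<omega>. pot \<gamma>1 \<phi> \<omega> + (- 1) * pot \<gamma>2 \<phi> \<omega>"
  have "?u \<omega> = 0"
  proof (rule heat_maximum_principle[where u="?u" and m=m and Z=Z, OF Z_smooth])
    show "Cinf_on UNIV ?u" by (intro Cinf_intros Cinf_on_pot assms open_UNIV)
    show "H ?u \<zeta> = 0" for \<zeta>
      using heat_lincomb[where m=m and Z=Z and c="- 1", OF Z_smooth Cinf_on_pot[OF assms(1) t] Cinf_on_pot[OF assms(2) t]]
        heat_pot[OF assms(1) t] heat_pot[OF assms(2) t] by simp
    show "(?u \<longlongrightarrow> 0) at_infinity"
      using tendsto_diff[OF pot_tendsto_0[OF assms(1) t] pot_tendsto_0[OF assms(2) t]] by simp
  qed
  then show ?thesis by simp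
qed

end

section \<open>Uniqueness, homogeneity and symmetry of the fundamental solution\<close>

lemma wdil_lborel:
  fixes f :: "'a::euclidean_space \<Rightarrow> real"
  assumes l: "l > 0" and f: "f \<in> borel_measurable borel"
  shows "(\<integral>x. f (wdil w l x) \<partial>lborel) = l powr (- (\<Sum>e\<in>Basis. w e)) * (\<integral>x. f x \<partial>lborel)"
    and "integrable lborel (\<lambda>x. f (wdil w l x)) \<longleftrightarrow> integrable lborel f"
proof -
  define J where "J = l powr (\<Sum>e\<in>Basis. w (e::'a))"
  have J: "J > 0" using l by (simp add: J_def)
  have J': "l powr (- (\<Sum>e\<in>Basis. w (e::'a))) = 1 / J" using l by (simp add: J_def powr_minus_divide)
  have "(\<lambda>x. 0 + (\<Sum>j\<in>Basis. (l powr w j * (x \<bullet> j)) *\<^sub>R j)) = wdil w l" by (auto simp: wdil_def)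
  moreover have "(\<Prod>j\<in>Basis. \<bar>l powr w (j::'a)\<bar>) = J" using l by (simp add: J_def powr_sum)
  ultimately have eq: "lborel = density (distr lborel borel (wdil w l)) (\<lambda>_. ennreal J)"
    using lborel_affine_euclidean[of "\<lambda>e. l powr w e" "0::'a"] l by simp
  have T: "wdil w l \<in> lborel \<rightarrow>\<^sub>M borel"
    unfolding measurable_lborel2 by (intro borel_measurable_continuous_onI linear_continuous_on bounded_linear_wdil)
  have fd: "f \<in> borel_measurable (distr lborel borel (wdil w l))" using f by simp
  have "(\<integral>x. f x \<partial>lborel) = (\<integral>x. f x \<partial>density (distr lborel borel (wdil w l)) (\<lambda>_. ennreal J))"
    by (subst eq) (rule refl)
  also have "\<dots> = (\<integral>x. J *\<^sub>R f x \<partial>distr lborel borel (wdil w l))"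
    using J by (intro integral_density[OF fd]) auto
  also have "\<dots> = J * (\<integral>x. f (wdil w l x) \<partial>lborel)"
    using integral_distr[OF T f] by simp
  finally show "(\<integral>x. f (wdil w l x) \<partial>lborel) = l powr (- (\<Sum>e\<in>Basis. w e)) * (\<integral>x. f x \<partial>lborel)"
    using J by (simp add: J')
  have "integrable lborel f \<longleftrightarrow> integrable (density (distr lborel borel (wdil w l)) (\<lambda>_. ennreal J)) f"
    by (subst eq) (rule refl)
  also have "\<dots> \<longleftrightarrow> integrable (distr lborel borel (wdil w l)) (\<lambda>x. J *\<^sub>R f x)"
    using J by (intro integrable_density[OF fd]) auto
  also have "\<dots> \<longleftrightarrow> integrable (distr lborel borel (wdil w l)) f" using J by simp
  also have "\<dots> \<longleftrightarrow> integrable lborel (\<lambda>x. f (wdil w l x))" by (rule integrable_distr_eq[OF T f])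
  finally show "integrable lborel (\<lambda>x. f (wdil w l x)) \<longleftrightarrow> integrable lborel f" by simp
qed

lemma not_AE_zero_on_ball:
  assumes "r > 0" "AE x in lborel. f x = 0" shows "\<exists>x\<in>ball (z::'a::euclidean_space) r. f x = 0"
proof (rule ccontr)
  assume n: "\<not> (\<exists>x\<in>ball z r. f x = 0)"
  obtain N where N: "N \<in> null_sets lborel" "{x \<in> space lborel. f x \<noteq> 0} \<subseteq> N"
    using assms(2) by (auto simp: eventually_ae_filter)
  then have "ball z r \<subseteq> N" using n by auto
  moreover have "negligible N" using N(1) by (simp add: negligible_iff_null_sets null_sets_completionI)
  ultimately have "negligible (ball z r)" by (meson negligible_subset)
  then show False using assms(1) open_not_negligible[of "ball z r"] by simp
qed

lemma linear_deriv_compose: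
  assumes T: "bounded_linear T" and g: "g differentiable (at (T x))"
  shows "(\<lambda>x. g (T x)) differentiable (at x)"
    and "frechet_derivative (\<lambda>x. g (T x)) (at x) v = frechet_derivative g (at (T x)) (T v)"
proof -
  have d: "((\<lambda>x. g (T x)) has_derivative (\<lambda>v. frechet_derivative g (at (T x)) (T v))) (at x)"
    by (rule has_derivative_compose[OF bounded_linear_imp_has_derivative[OF T] g[unfolded frechet_derivative_works]])
  show "(\<lambda>x. g (T x)) differentiable (at x)" by (rule differentiableI[OF d])
  show "frechet_derivative (\<lambda>x. g (T x)) (at x) v = frechet_derivative g (at (T x)) (T v)"
    by (rule frechet_derivative_eqI[OF d])
qed

context heat_group begin

interpretation E: hgroup "prod_star star" "prod_inv ginv" "prod_wt w" by (rule hgroup_prod)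

abbreviation "\<Delta> \<equiv> wdil (prod_wt w)"

lemma test_fun_homeo:
  assumes t: "test_fun \<phi>" and T: "Cinf_on UNIV T" and T': "continuous_on UNIV T'" "\<And>x. T' (T x) = x"
  shows "test_fun (\<lambda>x. \<phi> (T x))"
proof -
  obtain K where K: "compact K" "\<And>z. z \<notin> K \<Longrightarrow> \<phi> z = 0" using test_funE[OF t] by blast
  have "compact (T' ` K)" using T'(1) K(1) by (intro compact_continuous_image) (auto intro: continuous_on_subset)
  moreover have "Cinf_on UNIV (\<lambda>x. \<phi> (T x))"
    using t by (intro Cinf_on_compose_UNIV[OF _ _ T]) (auto simp: test_fun_def)
  moreover have "\<phi> (T z) = 0" if "z \<notin> T' ` K" for z using that T'(2)[of z] K(2)[of "T z"] by (metis imageI)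
  ultimately show ?thesis by (intro test_funI[where K="T' ` K"])
qed

lemma green_integral_unique:
  assumes "green \<gamma>1" "green \<gamma>2" and t: "test_fun \<rho>"
  shows "(\<integral>\<zeta>. \<gamma>1 \<zeta> * \<rho> \<zeta> \<partial>lborel) = (\<integral>\<zeta>. \<gamma>2 \<zeta> * \<rho> \<zeta> \<partial>lborel)"
proof -
  have "test_fun (\<lambda>\<nu>. \<rho> (prod_inv ginv \<nu>))"
    by (rule test_fun_homeo[OF t E.ginv_smooth Cinf_on_continuous[OF E.ginv_smooth]]) simp
  \<comment> \<open>At \<open>\<omega> = 0\<close> the kernel is the test function composed with
    inversion, and the two inversions cancel.\<close>
  from pot_unique[OF assms(1,2) this, of 0] show ?thesis by (simp add: pot_def)
qed

theorem green_unique: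
  assumes g: "green \<gamma>1" "green \<gamma>2" and c: "continuous_on (UNIV - {0}) \<gamma>1" "continuous_on (UNIV - {0}) \<gamma>2"
    and \<zeta>: "\<zeta> \<noteq> 0"
  shows "\<gamma>1 \<zeta> = \<gamma>2 \<zeta>"
proof (rule ccontr)
  assume ne: "\<gamma>1 \<zeta> \<noteq> \<gamma>2 \<zeta>"
  \<comment> \<open>The sign makes the difference positive at \<open>\<zeta>\<close>, hence by
    continuity on a ball. A bump function on that ball then contradicts the equality of
    integrals.\<close>
  define \<delta> where "\<delta> = (\<lambda>x. sgn (\<gamma>1 \<zeta> - \<gamma>2 \<zeta>) * (\<gamma>1 x - \<gamma>2 x))"
  have \<delta>: "\<delta> \<zeta> > 0" using ne by (simp add: \<delta>_def sgn_real_def)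
  have "isCont \<gamma>1 \<zeta>" "isCont \<gamma>2 \<zeta>"
    using c \<zeta> by (auto simp: continuous_on_eq_continuous_at open_delete)
  then have "isCont \<delta> \<zeta>" unfolding \<delta>_def by (intro continuous_intros)
  then have "\<forall>\<^sub>F x in at \<zeta>. \<delta> x > 0" unfolding isCont_def using \<delta> by (rule order_tendstoD)
  then obtain r where r: "r > 0" and "\<And>x. x \<noteq> \<zeta> \<Longrightarrow> dist x \<zeta> < r \<Longrightarrow> \<delta> x > 0"
    unfolding eventually_at by blast
  then have r2: "\<delta> x > 0" if "x \<in> ball \<zeta> r" for x
    using \<delta> that by (cases "x = \<zeta>") (auto simp: dist_commute)
  obtain \<phi> :: "real \<times> 'g \<Rightarrow> real" where t: "test_fun \<phi>" and \<phi>: "\<And>z. \<phi> z \<ge> 0" "\<And>z. \<phi> z > 0 \<longleftrightarrow> z \<in> ball \<zeta> r"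
    using bump_function[OF r] by blast
  obtain K where K: "compact K" "\<And>z. z \<notin> K \<Longrightarrow> \<phi> z = 0" using test_funE[OF t] by blast
  have i: "integrable lborel (\<lambda>x. \<gamma> x * \<phi> x)" if "green \<gamma>" for \<gamma>
    using that t K by (intro loc_int_mult_integrable[OF _ _ K] Cinf_on_continuous) (auto simp: green_def test_fun_def)
  have eq: "\<delta> x * \<phi> x = sgn (\<gamma>1 \<zeta> - \<gamma>2 \<zeta>) * (\<gamma>1 x * \<phi> x - \<gamma>2 x * \<phi> x)" for x
    by (simp add: \<delta>_def algebra_simps)
  have int: "integrable lborel (\<lambda>x. \<delta> x * \<phi> x)" unfolding eq
    by (intro integrable_mult_right Bochner_Integration.integrable_diff i g)
  have "(\<integral>x. \<delta> x * \<phi> x \<partial>lborel) = 0" unfolding eq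
    using green_integral_unique[OF g t] i[OF g(1)] i[OF g(2)] by simp
  moreover have pos: "\<delta> x * \<phi> x \<ge> 0" for x
    using \<phi>[of x] r2[of x] by (cases "x \<in> ball \<zeta> r") (auto simp: less_le)
  ultimately have "AE x in lborel. \<delta> x * \<phi> x = 0" using integral_nonneg_eq_0_iff_AE[OF int] by simp
  from not_AE_zero_on_ball[OF r this, of \<zeta>] obtain x where x: "x \<in> ball \<zeta> r" "\<delta> x * \<phi> x = 0" by blast
  have "\<delta> x * \<phi> x > 0" using r2[OF x(1)] \<phi>(2) x(1) by (intro mult_pos_pos) blast+
  then show False using x(2) by simp
qed

section \<open>Dilations, and homogeneity of the fundamental solution\<close>

lemma dtau_wdil:
  assumes l: "l > 0" and g: "g differentiable (at (\<Delta> l \<zeta>))"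
  shows "dtau (\<lambda>\<zeta>. g (\<Delta> l \<zeta>)) \<zeta> = l\<^sup>2 * dtau g (\<Delta> l \<zeta>)"
proof -
  have "\<Delta> l (1, 0) = l\<^sup>2 *\<^sub>R (1, 0)" using l by (simp add: wdil_prod_wt)
  then show ?thesis using linear_deriv_compose[OF bounded_linear_wdil g]
    by (simp add: dtau_eq g linear_scale[OF linear_frechet_derivative[OF g]] del: scaleR_Pair)
qed

lemma zop_wdil:
  assumes l: "l > 0" and g: "g differentiable (at (\<Delta> l \<zeta>))" and j: "j \<in> {1..m}"
  shows "zop (Z j) (\<lambda>\<zeta>. g (\<Delta> l \<zeta>)) \<zeta> = l * zop (Z j) g (\<Delta> l \<zeta>)"
proof -
  note d = linear_deriv_compose[OF bounded_linear_wdil g]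
  have s: "snd (\<Delta> l \<zeta>) = wdil w l (snd \<zeta>)" using l by (cases \<zeta>) (simp add: wdil_prod_wt)
  have "\<Delta> l (0, Z j (snd \<zeta>)) = l *\<^sub>R (0, Z j (snd (\<Delta> l \<zeta>)))"
    using l homog1_eq[OF Z_homog[OF j] l, of "snd \<zeta>"] by (simp add: wdil_prod_wt s)
  then show ?thesis
    by (simp add: zop_eq[OF d(1)] d(2) zop_eq[OF g] linear_scale[OF linear_frechet_derivative[OF g]] del: scaleR_Pair)
qed

lemma HT_wdil:
  assumes l: "l > 0" and g: "Cinf_on UNIV g"
  shows "HT (\<lambda>\<zeta>. g (\<Delta> l \<zeta>)) \<zeta> = l\<^sup>2 * HT g (\<Delta> l \<zeta>)"
proof -
  note d = Cinf_on_differentiable[OF _ UNIV_I]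
  have "zop (Z j) (zop (Z j) (\<lambda>\<zeta>. g (\<Delta> l \<zeta>))) \<zeta> = l\<^sup>2 * zop (Z j) (zop (Z j) g) (\<Delta> l \<zeta>)" if j: "j \<in> {1..m}" for j
  proof -
    have zg: "Cinf_on UNIV (zop (Z j) g)" by (intro Cinf_on_zop g Z_smooth j open_UNIV)
    have 1: "zop (Z j) (\<lambda>\<zeta>. g (\<Delta> l \<zeta>)) = (\<lambda>\<zeta>. l * zop (Z j) g (\<Delta> l \<zeta>))"
      by (rule ext) (rule zop_wdil[OF l d[OF g] j])
    have "zop (Z j) (\<lambda>\<zeta>. l * zop (Z j) g (\<Delta> l \<zeta>)) \<zeta> = l * zop (Z j) (\<lambda>\<zeta>. zop (Z j) g (\<Delta> l \<zeta>)) \<zeta>"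
      by (rule zop_cmult(1)) (rule linear_deriv_compose(1)[OF bounded_linear_wdil d[OF zg]])
    then show ?thesis unfolding 1 by (simp add: zop_wdil[OF l d[OF zg] j] power2_eq_square)
  qed
  then show ?thesis
    by (simp add: heatT_def dtau_wdil[OF l d[OF g]] sum_distrib_left algebra_simps)
qed

text \<open>The homogeneous dimension Q of the space group; with time of weight 2, space-time has
  dimension Q + 2.\<close>

definition hom_dim :: real where "hom_dim = (\<Sum>e\<in>Basis. w e)"

lemma sum_prod_wt: "(\<Sum>e\<in>Basis. prod_wt w e) = 2 + hom_dim"
proof -
  have "(\<Sum>e\<in>Basis. prod_wt w e) = (\<Sum>i\<in>Basis. prod_wt w (i, 0)) + (\<Sum>i\<in>Basis. prod_wt w (0, i))"
    unfolding Basis_prod_def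
    by (subst sum.union_disjoint) (auto simp: sum.reindex inj_on_def nonzero_Basis)
  also have "(\<Sum>i\<in>Basis. prod_wt w (0, i)) = hom_dim"
    unfolding hom_dim_def by (intro sum.cong) (auto simp: prod_wt_def nonzero_Basis)
  finally show ?thesis by (simp add: prod_wt_def)
qed

lemma HT_test:
  assumes "test_fun \<phi>"
  obtains K where "compact K" "continuous_on UNIV (HT \<phi>)" "\<And>z. z \<notin> K \<Longrightarrow> HT \<phi> z = 0"
proof -
  obtain K where K: "compact K" "\<And>z. z \<notin> K \<Longrightarrow> \<phi> z = 0" using test_funE[OF assms] by blast
  have \<phi>: "Cinf_on UNIV \<phi>" using assms by (simp add: test_fun_def)
  have U: "open (- K)" using K(1) by (simp add: compact_imp_closed open_Compl)
  have z: "zop V \<phi> x = 0" "dtau \<phi> x = 0" if "x \<notin> K" for V x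
    using zop_0_outside[OF U, of x \<phi>] that K(2) by auto
  have zz: "zop V (zop V \<phi>) x = 0" if "x \<notin> K" for V x
    by (rule zop_0_outside(1)[OF U]) (use that z(1) in auto)
  have "HT \<phi> x = 0" if "x \<notin> K" for x using z(2)[OF that] zz[OF that] by (simp add: heatT_def)
  moreover have "Cinf_on UNIV (HT \<phi>)" unfolding heatT_def[abs_def]
    by (intro Cinf_intros Cinf_on_zop Cinf_on_dtau Z_smooth \<phi> open_UNIV) auto
  ultimately show ?thesis using that K(1) Cinf_on_continuous by blast
qed

text \<open>The substitution contributes \<open>l powr (- (2 + hom_dim))\<close>, the homogeneity of
  \<open>HT\<close> removes the 2, and the prefactor compensates what remains.\<close>

lemma green_wdil:
  assumes g: "green \<gamma>" and l: "l > 0" shows "green (\<lambda>\<zeta>. l powr hom_dim * \<gamma> (\<Delta> l \<zeta>))"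
  unfolding green_def
proof (intro conjI allI impI)
  have \<gamma>: "loc_int \<gamma>" using g by (simp add: green_def)
  have "loc_int (\<lambda>\<zeta>. \<gamma> (\<Delta> l \<zeta>))"
  proof (rule loc_int_homeo[OF \<gamma>, where T="\<Delta> l" and T'="\<Delta> (1 / l)"])
    show "continuous_on UNIV (\<Delta> l)" by (intro linear_continuous_on bounded_linear_wdil)
    show "integrable lborel (\<lambda>x. g (\<Delta> l x))" if "integrable lborel g" for g :: "real \<times> 'g \<Rightarrow> real"
      using that wdil_lborel(2)[OF l, of g] borel_measurable_integrable[OF that] unfolding measurable_lborel2 by blast
  qed (simp add: wdil_inverse l)
  then show "loc_int (\<lambda>\<zeta>. l powr hom_dim * \<gamma> (\<Delta> l \<zeta>))"
    by (auto simp: loc_int_def intro!: set_integrable_mult_right)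
  have "((\<lambda>\<zeta>. \<gamma> (\<Delta> l \<zeta>)) \<longlongrightarrow> 0) at_infinity"
  proof (rule tendsto_0_at_infinity_homeo[where f=\<gamma> and T="\<Delta> l" and T'="\<Delta> (1 / l)"])
    show "(\<gamma> \<longlongrightarrow> 0) at_infinity" using g by (simp add: green_def)
    show "continuous_on UNIV (\<Delta> (1 / l))" by (intro linear_continuous_on bounded_linear_wdil)
  qed (rule wdil_inverse(2)[OF l])
  then show "((\<lambda>\<zeta>. l powr hom_dim * \<gamma> (\<Delta> l \<zeta>)) \<longlongrightarrow> 0) at_infinity" by (rule tendsto_mult_right_zero)
  fix \<phi> :: "real \<times> 'g \<Rightarrow> real" assume t: "test_fun \<phi>"
  have l': "1 / l > 0" using l by simp
  let ?\<psi> = "\<lambda>\<zeta>. \<phi> (\<Delta> (1 / l) \<zeta>)"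
  have t': "test_fun ?\<psi>"
    by (rule test_fun_homeo[OF t, where T="\<Delta> (1 / l)" and T'="\<Delta> l"])
      (auto intro!: linear_continuous_on bounded_linear_wdil Cinf_on_bounded_linear simp: wdil_inverse l)
  obtain K where K: "compact K" "continuous_on UNIV (HT ?\<psi>)" "\<And>z. z \<notin> K \<Longrightarrow> HT ?\<psi> z = 0"
    using HT_test[OF t'] by blast
  \<comment> \<open>This supplies the measurability of the integrand that the substitution
    requires.\<close>
  have "integrable lborel (\<lambda>\<zeta>. \<gamma> \<zeta> * HT ?\<psi> \<zeta>)" by (rule loc_int_mult_integrable[OF \<gamma> K(2,1,3)])
  from borel_measurable_integrable[OF this]
  have m: "(\<lambda>\<zeta>. \<gamma> \<zeta> * HT ?\<psi> \<zeta>) \<in> borel_measurable borel" unfolding measurable_lborel2 .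
  have \<phi>: "Cinf_on UNIV \<phi>" using t by (simp add: test_fun_def)
  have "HT ?\<psi> (\<Delta> l \<zeta>) = (1 / l)\<^sup>2 * HT \<phi> \<zeta>" for \<zeta>
    using HT_wdil[OF l' \<phi>, of "\<Delta> l \<zeta>"] l by (simp add: wdil_inverse)
  then have "(\<integral>\<zeta>. \<gamma> (\<Delta> l \<zeta>) * ((1 / l)\<^sup>2 * HT \<phi> \<zeta>) \<partial>lborel)
      = l powr (- (2 + hom_dim)) * (\<integral>\<zeta>. \<gamma> \<zeta> * HT ?\<psi> \<zeta> \<partial>lborel)"
    using wdil_lborel(1)[OF l m, of "prod_wt w"] by (simp add: sum_prod_wt)
  also have "(\<integral>\<zeta>. \<gamma> \<zeta> * HT ?\<psi> \<zeta> \<partial>lborel) = - \<phi> 0" using g t' by (simp add: green_def)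
  finally have "(1 / l)\<^sup>2 * (\<integral>\<zeta>. \<gamma> (\<Delta> l \<zeta>) * HT \<phi> \<zeta> \<partial>lborel) = l powr (- (2 + hom_dim)) * (- \<phi> 0)"
    by (subst integral_mult_right_zero[symmetric]) (simp add: mult.left_commute)
  then have "(\<integral>\<zeta>. \<gamma> (\<Delta> l \<zeta>) * HT \<phi> \<zeta> \<partial>lborel) = l powr 2 * l powr (- (2 + hom_dim)) * (- \<phi> 0)"
    using l by (simp add: field_simps powr_numeral)
  also have "l powr 2 * l powr (- (2 + hom_dim)) = l powr (- hom_dim)" by (simp flip: powr_add)
  finally have "l powr hom_dim * (\<integral>\<zeta>. \<gamma> (\<Delta> l \<zeta>) * HT \<phi> \<zeta> \<partial>lborel) = (l powr hom_dim * l powr (- hom_dim)) * (- \<phi> 0)"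
    by simp
  also have "l powr hom_dim * l powr (- hom_dim) = 1" using l by (simp flip: powr_add)
  finally show "(\<integral>\<zeta>. l powr hom_dim * \<gamma> (\<Delta> l \<zeta>) * HT \<phi> \<zeta> \<partial>lborel) = - \<phi> 0"
    by (simp add: mult.assoc)
qed

theorem green_homogeneous:
  assumes g: "green \<gamma>" and c: "continuous_on (UNIV - {0}) \<gamma>" and l: "l > 0" and \<zeta>: "\<zeta> \<noteq> 0"
  shows "\<gamma> (\<Delta> l \<zeta>) = l powr (- hom_dim) * \<gamma> \<zeta>"
proof -
  have "continuous_on (UNIV - {0}) (\<lambda>\<zeta>. l powr hom_dim * \<gamma> (\<Delta> l \<zeta>))"
    by (intro continuous_intros continuous_on_compose2[OF c] linear_continuous_on bounded_linear_wdil)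
      (use l in auto)
  from green_unique[OF green_wdil[OF g l] g this c \<zeta>]
  have "l powr hom_dim * \<gamma> (\<Delta> l \<zeta>) = \<gamma> \<zeta>" .
  then show ?thesis using l by (simp add: powr_minus field_simps)
qed

text \<open>The map composed with the kernel in the mixed formula. It differs from the group inverse
  \<open>prod_inv\<close>, which reverses time as well.\<close>

definition refl_inv :: "real \<times> 'g \<Rightarrow> real \<times> 'g" where "refl_inv = (\<lambda>(\<tau>, z). (\<tau>, ginv z))"

lemma refl_inv_refl_inv [simp]: "refl_inv (refl_inv \<zeta>) = \<zeta>"
  by (simp add: refl_inv_def split: prod.split)

lemma refl_inv_eq_0 [simp]: "refl_inv \<zeta> = 0 \<longleftrightarrow> \<zeta> = 0"
  by (cases \<zeta>) (simp add: refl_inv_def zero_prod_def)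

lemma Cinf_on_refl_inv: "Cinf_on UNIV refl_inv"
  unfolding refl_inv_def case_prod_unfold by (intro Cinf_intros open_UNIV)

lemma refl_inv_wdil: "l > 0 \<Longrightarrow> refl_inv (\<Delta> l \<zeta>) = \<Delta> l (refl_inv \<zeta>)"
  by (cases \<zeta>) (simp add: refl_inv_def wdil_prod_wt wdil_ginv)

lemma refl_inv_deriv0: "(refl_inv has_derivative (\<lambda>v. (fst v, - snd v))) (at 0)"
proof -
  have "(ginv has_derivative (\<lambda>v. - v)) (at (snd (0::real \<times> 'g)))" using ginv_deriv0 by simp
  then have "((\<lambda>\<zeta>::real \<times> 'g. (fst \<zeta>, ginv (snd \<zeta>))) has_derivative (\<lambda>v. (fst v, - snd v))) (at 0)"
    by (intro has_derivative_Pair has_derivative_compose[where f=snd and g=ginv] has_derivative_fst has_derivative_snd has_derivative_ident)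
  then show ?thesis by (simp add: refl_inv_def case_prod_unfold)
qed

lemma distr_refl_inv: "distr lborel borel refl_inv = lborel"
proof (rule distr_lborel_equivariant[where \<phi>="\<lambda>(q::real). refl_inv" and \<theta>="\<lambda>q. refl_inv"
      and w="prod_wt w" and v="\<lambda>_. 1" and A="\<lambda>v. (fst v, - snd v)"])
  show "Cinf_on UNIV (\<lambda>(q::real, z). refl_inv z)"
    unfolding case_prod_unfold by (rule Cinf_on_compose_UNIV[OF open_UNIV Cinf_on_refl_inv]) (rule Cinf_on_bounded_linear[OF bounded_linear_snd])
  show "refl_inv \<in> borel_measurable borel"
    by (intro borel_measurable_continuous_onI Cinf_on_continuous Cinf_on_refl_inv)
qed (auto simp: pos_wt_def[of "\<lambda>_. 1"] pos_prod_wt pos_w refl_inv_wdil refl_inv_deriv0)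

lemma integral_refl_inv:
  fixes f :: "real \<times> 'g \<Rightarrow> real"
  shows "(\<integral>\<zeta>. f (refl_inv \<zeta>) \<partial>lborel) = (\<integral>\<zeta>. f \<zeta> \<partial>lborel)"
    and "integrable lborel (\<lambda>\<zeta>. f (refl_inv \<zeta>)) \<longleftrightarrow> integrable lborel f"
proof -
  have "refl_inv \<in> borel_measurable borel"
    by (intro borel_measurable_continuous_onI Cinf_on_continuous Cinf_on_refl_inv)
  note * = lborel_distr_eqD[OF distr_refl_inv this this refl_inv_refl_inv]
  show "(\<integral>\<zeta>. f (refl_inv \<zeta>) \<partial>lborel) = (\<integral>\<zeta>. f \<zeta> \<partial>lborel)" by (rule *(1))
  show "integrable lborel (\<lambda>\<zeta>. f (refl_inv \<zeta>)) \<longleftrightarrow> integrable lborel f" by (rule *(2))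
qed

text \<open>Potentials of \<open>\<gamma>\<close> invert the heat operator on both sides, which makes
  \<open>\<gamma>(-\<tau>, z\<^sup>-\<^sup>1)\<close> a fundamental solution of the transposed operator; time reversal brings it back to the
  heat operator itself.\<close>

lemma green_refl:
  assumes g: "green \<gamma>" shows "green (\<lambda>\<zeta>. \<gamma> (refl_inv \<zeta>))"
  unfolding green_def
proof (intro conjI allI impI)
  have \<gamma>: "loc_int \<gamma>" using g by (simp add: green_def)
  have cr: "continuous_on UNIV refl_inv" by (rule Cinf_on_continuous[OF Cinf_on_refl_inv])
  show "loc_int (\<lambda>\<zeta>. \<gamma> (refl_inv \<zeta>))"
    by (rule loc_int_homeo[OF \<gamma> cr, where T'=refl_inv]) (simp_all add: integral_refl_inv(2))
  show "((\<lambda>\<zeta>. \<gamma> (refl_inv \<zeta>)) \<longlongrightarrow> 0) at_infinity"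
    using g by (intro tendsto_0_at_infinity_homeo[where f=\<gamma> and T=refl_inv and T'=refl_inv, OF _ cr refl_inv_refl_inv])
      (simp add: green_def)
  fix \<rho> :: "real \<times> 'g \<Rightarrow> real" assume t: "test_fun \<rho>"
  define T :: "real \<times> 'g \<Rightarrow> real \<times> 'g" where "T = (\<lambda>\<zeta>. (- fst \<zeta>, snd \<zeta>))"
  have T: "bounded_linear T" unfolding T_def
    by (intro bounded_linear_Pair bounded_linear_minus bounded_linear_fst bounded_linear_snd)
  have TT: "T (T \<zeta>) = \<zeta>" for \<zeta> by (simp add: T_def)
  have t': "test_fun (\<lambda>\<zeta>. \<rho> (T \<zeta>))"
    by (rule test_fun_homeo[OF t, where T=T and T'=T]) (auto intro!: Cinf_on_bounded_linear T linear_continuous_on TT)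
  have \<rho>: "Cinf_on UNIV \<rho>" using t by (simp add: test_fun_def)
  note d = Cinf_on_differentiable[OF _ UNIV_I]
  have zT: "zop V (\<lambda>\<zeta>. f (T \<zeta>)) = (\<lambda>\<zeta>. zop V f (T \<zeta>))" if "Cinf_on UNIV f" for V f
  proof
    fix \<zeta>
    have f: "f differentiable (at (T \<zeta>))" by (rule d[OF that])
    have "T (0, v) = (0, v)" "snd (T \<zeta>) = snd \<zeta>" for v by (simp_all add: T_def)
    then show "zop V (\<lambda>\<zeta>. f (T \<zeta>)) \<zeta> = zop V f (T \<zeta>)"
      by (simp add: zop_eq linear_deriv_compose[OF T f] f)
  qed
  have tT: "dtau (\<lambda>\<zeta>. \<rho> (T \<zeta>)) \<zeta> = - dtau \<rho> (T \<zeta>)" for \<zeta>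
  proof -
    have f: "\<rho> differentiable (at (T \<zeta>))" by (rule d[OF \<rho>])
    have "T (1, 0) = - (1, 0)" by (simp add: T_def)
    then show ?thesis
      by (simp add: dtau_eq linear_deriv_compose[OF T f] f linear_neg[OF linear_frechet_derivative[OF f]] del: uminus_Pair)
  qed
  have HT: "H (\<lambda>\<zeta>. \<rho> (T \<zeta>)) \<zeta> = HT \<rho> (T \<zeta>)" for \<zeta>
  proof -
    have "zop (Z j) (zop (Z j) (\<lambda>\<zeta>. \<rho> (T \<zeta>))) \<zeta> = zop (Z j) (zop (Z j) \<rho>) (T \<zeta>)" if "j \<in> {1..m}" for j
      using Cinf_on_zop[OF open_UNIV \<rho> Z_smooth[OF that]] by (simp add: zT \<rho>)
    then show ?thesis by (simp add: heat_def heatT_def tT)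
  qed
  \<comment> \<open>Time reversal cancels the sign that the group inverse puts on time. Hence
    \<open>pot_heat\<close> at the origin is a statement about \<open>\<gamma>\<close> paired with
    \<open>HT \<rho>\<close> in reflected variables.\<close>
  have "T (prod_inv ginv \<nu>) = refl_inv \<nu>" for \<nu> by (cases \<nu>) (simp add: T_def prod_inv_def refl_inv_def)
  then have "pot \<gamma> (H (\<lambda>\<zeta>. \<rho> (T \<zeta>))) 0 = (\<integral>\<nu>. \<gamma> \<nu> * HT \<rho> (refl_inv \<nu>) \<partial>lborel)"
    by (simp add: pot_def HT)
  also have "\<dots> = (\<integral>\<nu>. \<gamma> (refl_inv \<nu>) * HT \<rho> \<nu> \<partial>lborel)"
    using integral_refl_inv(1)[of "\<lambda>\<nu>. \<gamma> \<nu> * HT \<rho> (refl_inv \<nu>)"] by simp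
  finally show "(\<integral>\<nu>. \<gamma> (refl_inv \<nu>) * HT \<rho> \<nu> \<partial>lborel) = - \<rho> 0"
    using pot_heat[OF g t', of 0] by (simp add: T_def zero_prod_def)
qed

theorem green_symmetric:
  assumes g: "green \<gamma>" and c: "continuous_on (UNIV - {0}) \<gamma>" and \<zeta>: "\<zeta> \<noteq> 0"
  shows "\<gamma> (refl_inv \<zeta>) = \<gamma> \<zeta>"
proof -
  have "continuous_on (UNIV - {0}) (\<lambda>\<zeta>. \<gamma> (refl_inv \<zeta>))"
    by (intro continuous_on_compose2[OF c] continuous_on_subset[OF Cinf_on_continuous[OF Cinf_on_refl_inv]]) auto
  from green_unique[OF green_refl[OF g] g this c \<zeta>] show ?thesis .
qed

end

section \<open>Integrals of homogeneous functions\<close>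

text \<open>The cube of points with all coordinates in \<open>[-1, 1]\<close>, dilated by
  \<open>2 ^ k\<close>.\<close>

definition dyadic_box :: "('a::euclidean_space \<Rightarrow> real) \<Rightarrow> nat \<Rightarrow> 'a set" where
  "dyadic_box w k = cbox (- (\<Sum>e\<in>Basis. (2 ^ k) powr w e *\<^sub>R e)) (\<Sum>e\<in>Basis. (2 ^ k) powr w e *\<^sub>R e)"

lemma mem_dyadic_box: "x \<in> dyadic_box w k \<longleftrightarrow> (\<forall>e\<in>Basis. \<bar>x \<bullet> e\<bar> \<le> (2 ^ k) powr w e)"
  by (auto simp: dyadic_box_def mem_box inner_sum_left_Basis abs_le_iff)

lemma dyadic_box_UN:
  assumes w: "pos_wt w" shows "\<exists>k. x \<in> dyadic_box w k"
proof -
  have "(\<lambda>k. wdil w ((1/2)^k) x) \<longlonglongrightarrow> 0" by (rule wdil_half_tendsto_0[OF w])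
  then obtain k where k: "norm (wdil w ((1/2)^k) x) < 1"
    by (metis LIMSEQ_D diff_zero le_refl zero_less_one)
  have "\<bar>x \<bullet> e\<bar> \<le> (2 ^ k) powr w e" if e: "e \<in> Basis" for e
  proof -
    have "\<bar>((1/2)^k) powr w e * (x \<bullet> e)\<bar> \<le> 1"
      using Basis_le_norm[OF e, of "wdil w ((1/2)^k) x"] k e by simp
    then have "((1/2)^k) powr w e * \<bar>x \<bullet> e\<bar> \<le> 1" by (simp add: abs_mult)
    moreover have "((1/2)^k) powr w e = 1 / (2 ^ k) powr w e" by (simp add: power_one_over powr_divide)
    ultimately show ?thesis by (simp add: divide_le_eq)
  qed
  then show ?thesis using mem_dyadic_box by blast
qed

lemma dyadic_box_mono:
  assumes w: "pos_wt w" and "j \<le> k" shows "dyadic_box w j \<subseteq> dyadic_box w k"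
proof
  fix x assume x: "x \<in> dyadic_box w j"
  have "(2 ^ j) powr w e \<le> (2 ^ k) powr w e" if "e \<in> Basis" for e
    using w that assms(2) by (intro powr_mono2) (auto simp: pos_wt_def less_imp_le)
  then show "x \<in> dyadic_box w k" using x unfolding mem_dyadic_box by (meson order_trans)
qed

lemma integral_dyadic_box:
  shows "integrable lborel (\<lambda>x. indicator (dyadic_box w k) x :: real)"
    and "(\<integral>x. indicator (dyadic_box w k) (x::'a::euclidean_space) \<partial>lborel) = 2 ^ DIM('a) * (2 powr (\<Sum>e\<in>Basis. w e)) ^ k"
proof -
  let ?u = "\<Sum>e\<in>Basis. (2 ^ k) powr w e *\<^sub>R e :: 'a"
  show "integrable lborel (\<lambda>x. indicator (dyadic_box w k) x :: real)"
    unfolding dyadic_box_def by (rule integrable_real_indicator) (simp_all add: emeasure_lborel_cbox_finite)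
  have "(\<integral>x. indicator (dyadic_box w k) x \<partial>lborel) = measure lborel (cbox (- ?u) ?u)"
    by (simp add: dyadic_box_def)
  also have "\<dots> = (\<Prod>e\<in>Basis. 2 * (2 ^ k) powr w (e::'a))"
  proof -
    have "- ?u \<bullet> i \<le> ?u \<bullet> i" if "i \<in> Basis" for i using that by (simp add: inner_sum_left_Basis)
    then have "measure lborel (cbox (- ?u) ?u) = (\<Prod>i\<in>Basis. ?u \<bullet> i - (- ?u) \<bullet> i)"
      by (intro content_cbox) blast
    also have "\<dots> = (\<Prod>e\<in>Basis. 2 * (2 ^ k) powr w e)"
      by (rule prod.cong) (simp_all add: inner_sum_left_Basis)
    finally show ?thesis .
  qed
  also have "\<dots> = 2 ^ DIM('a) * (2 ^ k) powr (\<Sum>e\<in>Basis. w (e::'a))"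
    by (simp add: prod.distrib powr_sum)
  finally show "(\<integral>x. indicator (dyadic_box w k) x \<partial>lborel) = 2 ^ DIM('a) * (2 powr (\<Sum>e\<in>Basis. w e)) ^ k"
    by (simp add: power_powr_swap)
qed

text \<open>\<open>c\<close> is the parameter and \<open>x\<close> the variable of integration.
  Dilating a large \<open>x\<close> down to a fixed shell moves a bounded parameter close to 0, so
  integrability at infinity is governed by the slice over parameter 0, where only
  \<open>x = 0\<close> may be missing from \<open>\<Omega>\<close>.\<close>

locale homogeneous_kernel =
  fixes v :: "'c::euclidean_space \<Rightarrow> real" and w :: "'b::euclidean_space \<Rightarrow> real"
    and \<Omega> :: "('c \<times> 'b) set"
  assumes pos_v: "pos_wt v" and pos_w: "pos_wt w" and open_\<Omega>: "open \<Omega>"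
    and dil_\<Omega>: "l > 0 \<Longrightarrow> (c, x) \<in> \<Omega> \<Longrightarrow> (wdil v l c, wdil w l x) \<in> \<Omega>"
    and zero_\<Omega>: "x \<noteq> 0 \<Longrightarrow> (0, x) \<in> \<Omega>"
begin

text \<open>The shell between consecutive dyadic boxes is rescaled to a fixed compact one. Each step
  outwards costs a factor \<open>2 powr (- d)\<close> in the values and gains 2 to the sum of the
  weights in volume, which is less.\<close>

lemma homogeneous_dominated:
  fixes F :: "'c \<times> 'b \<Rightarrow> real"
  assumes F: "continuous_on \<Omega> F" and C: "compact C" "C \<times> UNIV \<subseteq> \<Omega>"
    and hom: "\<And>l c x. l > 0 \<Longrightarrow> (c, x) \<in> \<Omega> \<Longrightarrow> F (wdil v l c, wdil w l x) = l powr (- d) * F (c, x)"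
    and d: "d > (\<Sum>e\<in>Basis. w e)"
  obtains G where "integrable lborel G" "\<And>c x. c \<in> C \<Longrightarrow> \<bar>F (c, x)\<bar> \<le> G x"
proof -
  let ?B = "dyadic_box w"
  \<comment> \<open>The rescaled shell is compact and avoids 0, so \<open>{0} \<times> S\<close>
    lies in \<open>\<Omega>\<close> together with a tube around it.\<close>
  define S where "S = ?B 1 \<inter> {x. \<exists>e\<in>Basis. \<bar>x \<bullet> e\<bar> \<ge> 1}"
  have "{x::'b. \<exists>e\<in>Basis. \<bar>x \<bullet> e\<bar> \<ge> 1} = (\<Union>e\<in>Basis. {x. \<bar>x \<bullet> e\<bar> \<ge> 1})" by auto
  also have "closed \<dots>" by (intro closed_UN finite_Basis ballI closed_Collect_le continuous_intros)
  finally have S: "compact S" unfolding S_def dyadic_box_def by (intro compact_Int_closed compact_cbox)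
  have S0: "x \<noteq> 0" if "x \<in> S" for x using that by (auto simp: S_def)
  have "compact ({0::'c} \<times> S)" "{0::'c} \<times> S \<subseteq> \<Omega>" using S S0 zero_\<Omega> by (auto intro: compact_Times)
  then obtain \<epsilon> where \<epsilon>: "\<epsilon> > 0" "(\<Union>x\<in>{0::'c} \<times> S. ball x \<epsilon>) \<subseteq> \<Omega>"
    using compact_subset_open_imp_ball_epsilon_subset[OF _ open_\<Omega>] by metis
  have tube: "cball (0::'c) (\<epsilon>/2) \<times> S \<subseteq> \<Omega>"
  proof
    fix p assume p: "p \<in> cball (0::'c) (\<epsilon>/2) \<times> S"
    then have "p \<in> ball (0, snd p) \<epsilon>" using \<epsilon>(1) by (cases p) (auto simp: dist_Pair_Pair)
    moreover have "(0, snd p) \<in> {0} \<times> S" using p by auto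
    ultimately have "p \<in> (\<Union>x\<in>{0::'c} \<times> S. ball x \<epsilon>)" by blast
    then show "p \<in> \<Omega>" using \<epsilon>(2) by blast
  qed
  have bdd: "\<exists>M\<ge>0. \<forall>p\<in>K. \<bar>F p\<bar> \<le> M" if "compact K" "K \<subseteq> \<Omega>" for K
  proof -
    have "bounded (F ` K)" using that F by (intro compact_imp_bounded compact_continuous_image) (auto intro: continuous_on_subset)
    then obtain M where "\<forall>y\<in>F ` K. norm y \<le> M" unfolding bounded_iff by blast
    then have "\<forall>p\<in>K. \<bar>F p\<bar> \<le> max M 0" by auto
    then show ?thesis by (intro exI[of _ "max M 0"]) auto
  qed
  have "compact (cball (0::'c) (\<epsilon>/2) \<times> S)" using S by (intro compact_Times compact_cball)
  from bdd[OF this tube] obtain M1 where M1: "M1 \<ge> 0" "\<And>p. p \<in> cball (0::'c) (\<epsilon>/2) \<times> S \<Longrightarrow> \<bar>F p\<bar> \<le> M1"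
    by blast
  obtain R where R: "R > 0" "\<And>c. c \<in> C \<Longrightarrow> norm c \<le> R"
    using compact_imp_bounded[OF C(1)] unfolding bounded_pos by blast
  \<comment> \<open>From \<open>k0\<close> on, the dilation carries all of \<open>C\<close> into the
    tube. The points \<open>x\<close> of the box with index \<open>k0\<close> are left to
    compactness.\<close>
  have "(\<lambda>k. (\<Sum>e\<in>Basis. ((1/2)^k) powr v (e::'c)) * R) \<longlonglongrightarrow> 0"
    by (intro tendsto_mult_left_zero sum_half_powr_tendsto_0 pos_v)
  from order_tendstoD(2)[OF this, of "\<epsilon>/2"] obtain k0
    where k0: "\<And>k. k \<ge> k0 \<Longrightarrow> (\<Sum>e\<in>Basis. ((1/2)^k) powr v (e::'c)) * R < \<epsilon>/2"
    using \<epsilon>(1) unfolding eventually_sequentially by auto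
  have small: "wdil v ((1/2)^k) c \<in> cball 0 (\<epsilon>/2)" if "k \<ge> k0" "c \<in> C" for k c
  proof -
    have "norm (wdil v ((1/2)^k) c) \<le> (\<Sum>e\<in>Basis. ((1/2)^k) powr v (e::'c)) * norm c" by (rule norm_wdil_le)
    also have "\<dots> \<le> (\<Sum>e\<in>Basis. ((1/2)^k) powr v (e::'c)) * R"
      by (intro mult_left_mono R that sum_nonneg) simp
    finally show ?thesis using k0[OF that(1)] by simp
  qed
  have "compact (C \<times> ?B k0)" "C \<times> ?B k0 \<subseteq> \<Omega>"
    using C unfolding dyadic_box_def by (auto intro: compact_Times)
  from bdd[OF this] obtain M2 where M2: "M2 \<ge> 0" "\<And>p. p \<in> C \<times> ?B k0 \<Longrightarrow> \<bar>F p\<bar> \<le> M2" by blast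
  define q where "q = 2 powr (- d)"
  \<comment> \<open>A point first reached by the box \<open>Suc k\<close> will satisfy the bound
    \<open>M1 * q ^ k\<close>. Taking the full box instead of the shell as support costs only a
    constant factor in the integral.\<close>
  define g where "g = (\<lambda>k x. M1 * q ^ k * indicator (?B (Suc k)) x)"
  have sw: "(\<Sum>e\<in>Basis. w e) \<ge> 0" using pos_w by (intro sum_nonneg) (auto simp: pos_wt_def less_imp_le)
  have q: "0 < q" "q < 1" using d sw unfolding q_def by (auto simp: powr_less_one)
  have gn: "g k x \<ge> 0" for k x using M1(1) q by (simp add: g_def)
  have gs: "summable (\<lambda>k. norm (g k x))" for x
  proof (rule summable_comparison_test[where g="\<lambda>k. M1 * q ^ k"])
    show "\<exists>N. \<forall>n\<ge>N. norm (norm (g n x)) \<le> M1 * q ^ n"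
      using M1(1) q by (auto simp: g_def indicator_def)
    show "summable (\<lambda>k. M1 * q ^ k)" using q by (intro summable_mult summable_geometric) simp
  qed
  define Q where "Q = 2 powr (\<Sum>e\<in>Basis. w (e::'b))"
  have gi: "integrable lborel (g k)" for k unfolding g_def
    by (intro integrable_mult_right integral_dyadic_box)
  have int_g: "(\<integral>x. norm (g k x) \<partial>lborel) = M1 * 2 ^ DIM('b) * Q * (q * Q) ^ k" for k
  proof -
    have "(\<integral>x. norm (g k x) \<partial>lborel) = (\<integral>x. g k x \<partial>lborel)" using gn by (intro Bochner_Integration.integral_cong) auto
    also have "\<dots> = M1 * q ^ k * (2 ^ DIM('b) * Q ^ Suc k)"
      unfolding g_def Q_def by (simp only: integral_mult_right_zero integral_dyadic_box(2))
    finally show ?thesis by (simp add: power_mult_distrib mult_ac)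
  qed
  \<comment> \<open>The ratio of the geometric series is 2 to the sum of the weights minus
    \<open>d\<close>.\<close>
  have "q * Q < 1" "0 < q * Q"
    using d by (auto simp: q_def Q_def simp flip: powr_add intro!: powr_less_one)
  then have "summable (\<lambda>k. \<integral>x. norm (g k x) \<partial>lborel)"
    unfolding int_g by (intro summable_mult summable_geometric) simp
  then have gsum: "integrable lborel (\<lambda>x. \<Sum>k. g k x)"
    by (intro integrable_suminf gi) (use gs in auto)
  define G where "G = (\<lambda>x. M2 * indicator (?B k0) x + (\<Sum>k. g k x))"
  have "integrable lborel G" unfolding G_def
    by (intro Bochner_Integration.integrable_add integrable_mult_right integral_dyadic_box gsum)
  moreover have "\<bar>F (c, x)\<bar> \<le> G x" if c: "c \<in> C" for c x
  proof (cases "x \<in> ?B k0")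
    case True
    have "0 \<le> (\<Sum>k. g k x)" using gs[of x] gn by (intro suminf_nonneg) (auto simp: abs_of_nonneg)
    then show ?thesis using M2(2)[of "(c, x)"] c True by (simp add: G_def)
  next
    case False
    obtain k1 where "x \<in> ?B k1" using dyadic_box_UN[OF pos_w] by blast
    \<comment> \<open>The least box containing \<open>x\<close> has index \<open>Suc k\<close> with
      \<open>k \<ge> k0\<close>. Since \<open>x\<close> is not in box \<open>k\<close>, its
      rescaling by \<open>(1/2)^k\<close> lies in the shell \<open>S\<close>.\<close>
    define k2 where "k2 = (LEAST k. x \<in> ?B k)"
    have k2: "x \<in> ?B k2" "\<And>k. k < k2 \<Longrightarrow> x \<notin> ?B k"
      unfolding k2_def using \<open>x \<in> ?B k1\<close> by (auto intro: LeastI dest: not_less_Least)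
    have "k0 < k2" using False k2(1) dyadic_box_mono[OF pos_w, of k2 k0] by (meson linorder_not_less subsetD)
    then obtain k where k: "k2 = Suc k" "k \<ge> k0" by (metis Suc_diff_Suc less_Suc_eq_le not_less_eq_eq old.nat.exhaust not_less0)
    let ?c = "wdil v ((1/2)^k) c" and ?x = "wdil w ((1/2)^k) x"
    have half: "((1/2)^k) powr a = 1 / (2 ^ k) powr a" for a :: real by (simp add: power_one_over powr_divide)
    have "?x \<in> S"
    proof -
      have "\<bar>?x \<bullet> e\<bar> \<le> (2 ^ 1) powr w e" if e: "e \<in> Basis" for e
      proof -
        have "\<bar>x \<bullet> e\<bar> \<le> (2 ^ Suc k) powr w e" using k2(1) e unfolding k(1) mem_dyadic_box by blast
        also have "(2 ^ Suc k) powr w e = 2 powr w e * (2 ^ k) powr w e" by (simp add: powr_mult)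
        finally show ?thesis using e by (simp add: abs_mult half divide_le_eq)
      qed
      moreover obtain e where e: "e \<in> Basis" "\<bar>x \<bullet> e\<bar> > (2 ^ k) powr w e"
        using k2(2)[of k] k(1) unfolding mem_dyadic_box by force
      then have "\<bar>?x \<bullet> e\<bar> \<ge> 1" by (simp add: abs_mult half le_divide_eq)
      ultimately show ?thesis unfolding S_def using e(1) by (auto simp: mem_dyadic_box)
    qed
    then have p: "(?c, ?x) \<in> cball (0::'c) (\<epsilon>/2) \<times> S" using small[OF k(2) c] by simp
    then have "(?c, ?x) \<in> \<Omega>" using tube by blast
    from hom[OF _ this, of "2 ^ k"]
    have "F (wdil v (2 ^ k) ?c, wdil w (2 ^ k) ?x) = (2 ^ k) powr (- d) * F (?c, ?x)" by simp
    moreover have "wdil v (2 ^ k) ?c = c" "wdil w (2 ^ k) ?x = x"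
      using wdil_inverse(1)[of "2 ^ k"] by (simp_all add: power_one_over)
    moreover have "(2 ^ k) powr (- d) = q ^ k" by (simp add: q_def power_powr_swap)
    ultimately have "F (c, x) = q ^ k * F (?c, ?x)" by simp
    then have "\<bar>F (c, x)\<bar> \<le> q ^ k * M1"
      using M1(2)[OF p] q by (simp add: abs_mult mult_left_mono)
    also have "\<dots> = g k x" using k2(1) by (simp add: g_def k(1))
    also have "\<dots> = (\<Sum>j\<in>{k}. g j x)" by simp
    also have "\<dots> \<le> (\<Sum>j. g j x)" using gs[of x] gn by (intro sum_le_suminf) (auto simp: abs_of_nonneg)
    also have "\<dots> = G x" using False by (simp add: G_def)
    finally show ?thesis .
  qed
  ultimately show ?thesis using that by blast
qed

text \<open>A derivative in a parameter direction raises the decay exponent by the weight of that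
  direction, so \<open>homogeneous_dominated\<close> applies to it with room to spare.\<close>

lemma homogeneous_deriv:
  fixes F :: "'c \<times> 'b \<Rightarrow> real"
  assumes F: "Cinf_on \<Omega> F" and b: "b \<in> Basis" and l: "l > 0" and p: "(c, x) \<in> \<Omega>"
    and hom: "\<And>l c x. l > 0 \<Longrightarrow> (c, x) \<in> \<Omega> \<Longrightarrow> F (wdil v l c, wdil w l x) = l powr (- d) * F (c, x)"
  shows "frechet_derivative F (at (wdil v l c, wdil w l x)) (b, 0)
      = l powr (- (d + v b)) * frechet_derivative F (at (c, x)) (b, 0)"
proof -
  define T where "T = (\<lambda>p. (wdil v l (fst p), wdil w l (snd p)))"
  have T: "bounded_linear T" unfolding T_def
    by (intro bounded_linear_Pair bounded_linear_compose[OF bounded_linear_wdil] bounded_linear_fst bounded_linear_snd)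
  have FT: "F differentiable (at (T (c, x)))"
    using Cinf_on_differentiable[OF F dil_\<Omega>[OF l p]] by (simp add: T_def)
  have "frechet_derivative (\<lambda>p. F (T p)) (at (c, x)) = frechet_derivative (\<lambda>p. l powr (- d) * F p) (at (c, x))"
    by (rule frechet_derivative_cong_open[OF open_\<Omega> p]) (auto simp: T_def hom l)
  then have "frechet_derivative F (at (T (c, x))) (T (b, 0)) = l powr (- d) * frechet_derivative F (at (c, x)) (b, 0)"
    using linear_deriv_compose(2)[OF T FT, of "(b, 0)"]
      frechet_derivative_eqI[OF has_derivative_mult_right[OF Cinf_on_has_derivative[OF F p]], of "l powr (- d)" "(b, 0)"]
    by simp
  moreover have "T (b, 0) = l powr v b *\<^sub>R (b, 0)" using b by (simp add: T_def wdil_Basis)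
  ultimately have "l powr v b * frechet_derivative F (at (T (c, x))) (b, 0) = l powr (- d) * frechet_derivative F (at (c, x)) (b, 0)"
    by (simp add: linear_scale[OF linear_frechet_derivative[OF FT]] del: scaleR_Pair)
  then have "frechet_derivative F (at (T (c, x))) (b, 0) = (l powr (- d) / l powr v b) * frechet_derivative F (at (c, x)) (b, 0)"
    using l by (simp add: field_simps)
  also have "l powr (- d) / l powr v b = l powr (- (d + v b))" using l by (simp flip: powr_diff)
  finally show ?thesis by (simp add: T_def)
qed

lemma homogeneous_param_integral:
  fixes F :: "'c \<times> 'b \<Rightarrow> real"
  assumes F: "Cinf_on \<Omega> F" and U: "open U" "U \<times> UNIV \<subseteq> \<Omega>" and c0: "c0 \<in> U"
    and hom: "\<And>l c x. l > 0 \<Longrightarrow> (c, x) \<in> \<Omega> \<Longrightarrow> F (wdil v l c, wdil w l x) = l powr (- d) * F (c, x)"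
    and d: "d > (\<Sum>e\<in>Basis. w e)"
  shows "integrable lborel (\<lambda>x. F (c0, x))"
    and "((\<lambda>c. \<integral>x. F (c, x) \<partial>lborel) has_derivative
      (\<lambda>e. \<integral>x. frechet_derivative F (at (c0, x)) (e, 0) \<partial>lborel)) (at c0)"
proof -
  obtain r where r: "r > 0" "cball c0 r \<subseteq> U" using U(1) c0 open_contains_cball by blast
  have C: "compact (cball c0 r)" "cball c0 r \<times> UNIV \<subseteq> \<Omega>" using r U by auto
  have in\<Omega>: "(c, x) \<in> \<Omega>" if "c \<in> cball c0 r" for c x using C(2) that by blast
  have meas: "(\<lambda>x. f (c, x)) \<in> borel_measurable lborel" if "continuous_on \<Omega> f" "c \<in> cball c0 r" for c and f :: "'c \<times> 'b \<Rightarrow> real"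
    unfolding measurable_lborel2
    by (intro borel_measurable_continuous_onI continuous_on_compose2[OF that(1)] continuous_intros) (use in\<Omega>[OF that(2)] in auto)
  obtain G0 where G0: "integrable lborel G0" "\<And>c x. c \<in> cball c0 r \<Longrightarrow> \<bar>F (c, x)\<bar> \<le> G0 x"
    using homogeneous_dominated[OF Cinf_on_continuous[OF F] C hom d] by blast
  have int: "integrable lborel (\<lambda>x. F (c, x))" if "c \<in> cball c0 r" for c
    by (rule Bochner_Integration.integrable_bound[OF G0(1) meas[OF Cinf_on_continuous[OF F] that]])
      (use G0(2)[OF that] in \<open>auto intro: order_trans[OF _ abs_ge_self]\<close>)
  have "\<exists>G. integrable lborel G \<and> (\<forall>c\<in>cball c0 r. \<forall>x. \<bar>frechet_derivative F (at (c, x)) (b, 0)\<bar> \<le> G x)"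
    if b: "b \<in> Basis" for b
  proof -
    have d': "d + v b > (\<Sum>e\<in>Basis. w e)" using d pos_v b by (auto simp: pos_wt_def add_strict_increasing2 intro: less_trans)
    obtain G where "integrable lborel G" "\<And>c x. c \<in> cball c0 r \<Longrightarrow> \<bar>frechet_derivative F (at (c, x)) (b, 0)\<bar> \<le> G x"
      using homogeneous_dominated[OF Cinf_on_continuous[OF Cinf_on_frechet[OF F, of "(b, 0)"]] C
          homogeneous_deriv[OF F b _ _ hom] d'] by blast
    then show ?thesis by blast
  qed
  then obtain G where G: "\<And>b. b \<in> Basis \<Longrightarrow> integrable lborel (G b)"
    "\<And>b c x. b \<in> Basis \<Longrightarrow> c \<in> cball c0 r \<Longrightarrow> \<bar>frechet_derivative F (at (c, x)) (b, 0)\<bar> \<le> G b x" by metis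
  show "integrable lborel (\<lambda>x. F (c0, x))" using r by (intro int) simp
  show "((\<lambda>c. \<integral>x. F (c, x) \<partial>lborel) has_derivative
      (\<lambda>e. \<integral>x. frechet_derivative F (at (c0, x)) (e, 0) \<partial>lborel)) (at c0)"
  proof (rule has_derivative_integral_dominated(2)[where r=r and h="\<lambda>c x. F (c, x)"
        and h'="\<lambda>c x e. frechet_derivative F (at (c, x)) (e, 0)" and G="\<lambda>x. \<Sum>b\<in>Basis. G b x"])
    show "integrable lborel (\<lambda>x. F (c, x))" if "c \<in> ball c0 r" for c using that by (intro int) auto
    show "((\<lambda>c. F (c, x)) has_derivative (\<lambda>e. frechet_derivative F (at (c, x)) (e, 0))) (at c)" if "c \<in> ball c0 r" for c x
      using that by (intro has_derivative_slice_fst Cinf_on_has_derivative[OF F] in\<Omega>) auto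
    show "(\<lambda>x. frechet_derivative F (at (c0, x)) (e, 0)) \<in> borel_measurable lborel" for e
      using r(1) by (intro meas[where f="\<lambda>p. frechet_derivative F (at p) (e, 0)"] Cinf_on_continuous Cinf_on_frechet F) simp
    show "\<bar>frechet_derivative F (at (c, x)) (e, 0)\<bar> \<le> (\<Sum>b\<in>Basis. G b x) * norm e" if c: "c \<in> ball c0 r" for c x e
    proof -
      have cc: "c \<in> cball c0 r" using c by simp
      have Fd: "((\<lambda>c. F (c, x)) has_derivative (\<lambda>e. frechet_derivative F (at (c, x)) (e, 0))) (at c)"
        by (intro has_derivative_slice_fst Cinf_on_has_derivative[OF F] in\<Omega> cc)
      then have dd: "(\<lambda>c. F (c, x)) differentiable (at c)" by (rule differentiableI)
      have "\<bar>frechet_derivative F (at (c, x)) (e, 0)\<bar> \<le> (\<Sum>b\<in>Basis. \<bar>frechet_derivative F (at (c, x)) (b, 0)\<bar>) * norm e"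
        using frechet_derivative_bound_Basis[OF dd, of e] by (simp add: frechet_derivative_eqI[OF Fd])
      also have "\<dots> \<le> (\<Sum>b\<in>Basis. G b x) * norm e"
        by (intro mult_right_mono sum_mono G(2) cc norm_ge_zero)
      finally show ?thesis .
    qed
    show "integrable lborel (\<lambda>x. \<Sum>b\<in>Basis. G b x)" by (intro Bochner_Integration.integrable_sum G(1))
  qed (rule r(1))
qed

end

section \<open>Projectable fields and the fibration\<close>

text \<open>The classical notion: a field on the total space that is related by the projection to a
  field on the base.\<close>

definition projectable :: "('x \<times> 'y \<Rightarrow> 'x \<times> 'y) \<Rightarrow> bool" where
  "projectable V \<longleftrightarrow> (\<forall>p q. fst p = fst q \<longrightarrow> fst (V p) = fst (V q))"

text \<open>The horizontal part of \<open>V\<close> factors through the projection, hence so does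
  its derivative; vertical directions contribute nothing.\<close>

lemma projectable_deriv:
  fixes V :: "'x::euclidean_space \<times> 'y::euclidean_space \<Rightarrow> 'x \<times> 'y"
  assumes V: "Cinf_on UNIV V" and p: "projectable V"
  shows "fst (frechet_derivative V (at (x, \<xi>)) u) = frechet_derivative (\<lambda>x. fst (V (x, 0))) (at x) (fst u)"
proof -
  have dV: "(V has_derivative frechet_derivative V (at (x, \<xi>))) (at (x, \<xi>))"
    by (rule Cinf_on_has_derivative[OF V]) simp
  have "Cinf_on UNIV (\<lambda>x. fst (V (x, 0)))"
    by (intro Cinf_on_fst Cinf_on_compose_UNIV[OF open_UNIV V] Cinf_on_Pair Cinf_on_ident Cinf_on_const open_UNIV)
  then have f: "((\<lambda>x. fst (V (x, 0))) has_derivative frechet_derivative (\<lambda>x. fst (V (x, 0))) (at x)) (at (fst (x, \<xi>)))"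
    using Cinf_on_has_derivative[of UNIV _ x] by simp
  have 1: "((\<lambda>q. fst (V (fst q, 0))) has_derivative (\<lambda>u. frechet_derivative (\<lambda>x. fst (V (x, 0))) (at x) (fst u))) (at (x, \<xi>))"
    by (rule has_derivative_compose[OF has_derivative_fst[OF has_derivative_ident] f])
  have "fst (V (fst q, 0)) = fst (V q)" for q using p unfolding projectable_def by (metis fst_conv)
  then have 2: "((\<lambda>q. fst (V q)) has_derivative (\<lambda>u. frechet_derivative (\<lambda>x. fst (V (x, 0))) (at x) (fst u))) (at (x, \<xi>))"
    using 1 by simp
  show ?thesis using has_derivative_unique[OF has_derivative_fst[OF dV] 2] by (rule fun_cong)
qed

text \<open>The bracket is the one case with content: by \<open>projectable_deriv\<close> the
  horizontal part of each of its terms depends on horizontal data alone.\<close>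

lemma lie_gen_projectable:
  fixes A :: "('x::euclidean_space \<times> 'y::euclidean_space \<Rightarrow> 'x \<times> 'y) set"
  assumes A: "\<And>V. V \<in> A \<Longrightarrow> Cinf_on UNIV V \<and> projectable V" and V: "V \<in> lie_gen A"
  shows "Cinf_on UNIV V \<and> projectable V"
  using V
proof (induction rule: lie_gen.induct)
  case (gen V) then show ?case by (rule A)
next
  case zero show ?case by (simp add: Cinf_on_const projectable_def)
next
  case (add V W)
  have "projectable (\<lambda>x. V x + W x)" unfolding projectable_def
  proof (intro allI impI)
    fix p q :: "'x \<times> 'y" assume "fst p = fst q"
    then have "fst (V p) = fst (V q)" "fst (W p) = fst (W q)" using add.IH unfolding projectable_def by blast+
    then show "fst (V p + W p) = fst (V q + W q)" by simp
  qed
  then show ?case using add.IH by (simp add: Cinf_on_add)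
next
  case (scale V c)
  have "projectable (\<lambda>x. c *\<^sub>R V x)" unfolding projectable_def
  proof (intro allI impI)
    fix p q :: "'x \<times> 'y" assume "fst p = fst q"
    then have "fst (V p) = fst (V q)" using scale.IH unfolding projectable_def by blast
    then show "fst (c *\<^sub>R V p) = fst (c *\<^sub>R V q)" by simp
  qed
  then show ?case using scale.IH by (simp add: Cinf_on_scaleR Cinf_on_const)
next
  case (br V W)
  have V: "Cinf_on UNIV V" "projectable V" and W: "Cinf_on UNIV W" "projectable W" using br by auto
  have "Cinf_on UNIV (lie_br V W)" unfolding lie_br_def
    by (rule Cinf_on_diff[OF open_UNIV Cinf_on_frechet_app[OF open_UNIV open_UNIV W(1) Cinf_on_ident V(1) UNIV_I]
          Cinf_on_frechet_app[OF open_UNIV open_UNIV V(1) Cinf_on_ident W(1) UNIV_I]])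
  moreover have "projectable (lie_br V W)"
    unfolding projectable_def
  proof (intro allI impI)
    fix p q :: "'x \<times> 'y" assume pq: "fst p = fst q"
    have "fst (V p) = fst (V q)" "fst (W p) = fst (W q)" using V(2) W(2) pq unfolding projectable_def by blast+
    moreover have "fst (frechet_derivative V (at p) u) = frechet_derivative (\<lambda>x. fst (V (x, 0))) (at (fst p)) (fst u)"
      "fst (frechet_derivative W (at p) u) = frechet_derivative (\<lambda>x. fst (W (x, 0))) (at (fst p)) (fst u)" for p u
      using projectable_deriv[OF V, of "fst p" "snd p" u] projectable_deriv[OF W, of "fst p" "snd p" u] by simp_all
    ultimately show "fst (lie_br V W p) = fst (lie_br V W q)" by (simp add: lie_br_def pq)
  qed
  ultimately show ?case by blast
qed

text \<open>The squared norm has derivative at most \<open>2 * L\<close> times itself, so multiplied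
  by \<open>exp (- 2 * L * s)\<close> it does not increase.\<close>

lemma gronwall_zero:
  fixes e :: "real \<Rightarrow> 'a::real_inner"
  assumes d: "\<And>s. s \<in> {0..1} \<Longrightarrow> (e has_vector_derivative e' s) (at s)"
    and b: "\<And>s. s \<in> {0..1} \<Longrightarrow> norm (e' s) \<le> L * norm (e s)" and 0: "e 0 = 0"
  shows "e 1 = 0"
proof -
  define h where "h = (\<lambda>s. exp (- 2 * L * s) * (e s \<bullet> e s))"
  have "\<exists>y. (h has_real_derivative y) (at s) \<and> y \<le> 0" if s: "0 \<le> s" "s \<le> 1" for s
  proof -
    have de: "((\<lambda>s. e s \<bullet> e s) has_real_derivative 2 * (e s \<bullet> e' s)) (at s)"
    proof -
      have "(e has_derivative (\<lambda>r. r *\<^sub>R e' s)) (at s)" using d s by (simp add: has_vector_derivative_def)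
      then have "((\<lambda>s. e s \<bullet> e s) has_derivative (\<lambda>r. e s \<bullet> (r *\<^sub>R e' s) + (r *\<^sub>R e' s) \<bullet> e s)) (at s)"
        by (intro has_derivative_inner)
      moreover have "(\<lambda>r. e s \<bullet> (r *\<^sub>R e' s) + (r *\<^sub>R e' s) \<bullet> e s) = (*) (2 * (e s \<bullet> e' s))"
        by (auto simp: fun_eq_iff inner_commute)
      ultimately show ?thesis by (simp only: has_field_derivative_def)
    qed
    have ex: "((\<lambda>s. exp (- 2 * L * s)) has_real_derivative exp (- 2 * L * s) * (- 2 * L)) (at s)"
      by (auto intro!: derivative_eq_intros)
    have "(h has_real_derivative exp (- 2 * L * s) * (- 2 * L) * (e s \<bullet> e s) + 2 * (e s \<bullet> e' s) * exp (- 2 * L * s)) (at s)"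
      unfolding h_def by (rule DERIV_mult[OF ex de])
    moreover have "exp (- 2 * L * s) * (- 2 * L) * (e s \<bullet> e s) + 2 * (e s \<bullet> e' s) * exp (- 2 * L * s)
        = exp (- 2 * L * s) * 2 * ((e s \<bullet> e' s) - L * (e s \<bullet> e s))" by (simp add: algebra_simps)
    moreover have "e s \<bullet> e' s \<le> L * (e s \<bullet> e s)"
    proof -
      have "e s \<bullet> e' s \<le> norm (e s) * norm (e' s)" by (rule norm_cauchy_schwarz)
      also have "\<dots> \<le> norm (e s) * (L * norm (e s))" using b s by (intro mult_left_mono) auto
      also have "\<dots> = L * (e s \<bullet> e s)" by (simp add: dot_square_norm power2_eq_square)
      finally show ?thesis .
    qed
    ultimately show ?thesis by (auto simp: mult_nonneg_nonpos)
  qed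
  then have "h 1 \<le> h 0" by (intro DERIV_nonpos_imp_nonincreasing[of 0 1 h]) auto
  then have "exp (- 2 * L) * (e 1 \<bullet> e 1) \<le> 0" by (simp add: h_def 0)
  then have "e 1 \<bullet> e 1 \<le> 0" by (simp add: mult_le_0_iff)
  then show ?thesis by (metis inner_gt_zero_iff not_le)
qed

section \<open>Right translations and the fibres of the projection\<close>

context hgroup begin

text \<open>The left-invariant field with value \<open>v\<close> at the unit; \<open>v\<close> is an
  argument because it will vary along a curve in \<open>fibre_invariant\<close>.\<close>

definition linv_field :: "'g \<Rightarrow> 'g \<Rightarrow> 'g" where
  "linv_field v z = frechet_derivative (star z) (at 0) v"

lemma linv_field_eq: "linv_field v z = frechet_derivative (\<lambda>(a, b). star a b) (at (z, 0)) (0, v)"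
proof -
  have "(\<lambda>(a, b). star a b) differentiable (at (z, 0))" by (rule Cinf_on_differentiable[OF star_smooth UNIV_I])
  from frechet_derivative_slice_snd[OF this, of v] show ?thesis by (simp add: linv_field_def)
qed

lemma Cinf_on_linv_field: "Cinf_on UNIV (\<lambda>(z, v). linv_field v z)"
proof -
  have "Cinf_on UNIV (\<lambda>p. frechet_derivative (\<lambda>(a, b). star a b) (at ((fst p, 0)::'g \<times> 'g)) (0, snd p))"
    by (rule Cinf_on_frechet_app[OF open_UNIV open_UNIV star_smooth])
      (intro Cinf_on_Pair Cinf_on_fst Cinf_on_snd Cinf_on_ident Cinf_on_const open_UNIV UNIV_I)+
  then show ?thesis by (simp add: linv_field_eq case_prod_unfold)
qed

lemma star_translate_deriv: "frechet_derivative (star g) (at z) (linv_field v z) = linv_field v (star g z)"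
proof -
  have 1: "(star g has_derivative frechet_derivative (star g) (at z)) (at (star z 0))"
    using left_translation_has_derivative[of g z] by simp
  have "((\<lambda>a. star g (star z a)) has_derivative (\<lambda>v. frechet_derivative (star g) (at z) (frechet_derivative (star z) (at 0) v))) (at 0)"
    by (rule has_derivative_compose[OF left_translation_has_derivative 1])
  then have "(star (star g z) has_derivative (\<lambda>v. frechet_derivative (star g) (at z) (frechet_derivative (star z) (at 0) v))) (at 0)"
    by (simp only: assoc[symmetric])
  from frechet_derivative_eqI[OF this] show ?thesis by (simp add: linv_field_def)
qed

lemma left_inv_linv_field: "left_inv star (linv_field v)"
  unfolding left_inv_def
proof (intro allI impI)
  fix f g z assume f: "Cinf_on UNIV (f :: 'g \<Rightarrow> real)"
  have "((\<lambda>w. f (star g w)) has_derivative (\<lambda>u. frechet_derivative f (at (star g z)) (frechet_derivative (star g) (at z) u))) (at z)"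
    by (rule has_derivative_compose[OF left_translation_has_derivative Cinf_on_has_derivative[OF f UNIV_I]])
  from frechet_derivative_eqI[OF this, of "linv_field v z"]
  show "vf_app (linv_field v) (\<lambda>w. f (star g w)) z = vf_app (linv_field v) f (star g z)"
    by (simp add: vf_app_def star_translate_deriv)
qed

end

text \<open>Right translations respect the fibres of the projection: along \<open>s \<mapsto> z \<star> (s a)\<close> the first component
  solves an ODE whose right-hand side only depends on the first component.\<close>

lemma fibre_invariant:
  fixes star :: "'x::euclidean_space \<times> 'y::euclidean_space \<Rightarrow> 'x \<times> 'y \<Rightarrow> 'x \<times> 'y"
  assumes G: "hgroup star ginv w"
    and proj: "\<And>v. projectable (hgroup.linv_field star v)" and z: "fst z1 = fst z2"
  shows "fst (star z1 a) = fst (star z2 a)"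
proof -
  interpret hgroup star ginv w by (rule G)
  \<comment> \<open>The curve \<open>s \<mapsto> s a\<close> need not be a one-parameter subgroup.
    Its velocity translated back to the unit is \<open>u s\<close>, and
    \<open>s \<mapsto> z \<star> (s a)\<close> follows at time \<open>s\<close> the left-invariant
    field with value \<open>u s\<close> at the unit.\<close>
  define u where "u = (\<lambda>s. frechet_derivative (star (ginv (s *\<^sub>R a))) (at (s *\<^sub>R a)) a)"
  \<comment> \<open>The horizontal velocity as a function of base point and direction. By
    projectability the fibre coordinate may be set to 0.\<close>
  define N where "N = (\<lambda>p :: 'x \<times> ('x \<times> 'y). fst (linv_field (snd p) (fst p, 0)))"
  have NC: "Cinf_on UNIV N"
  proof -
    have "Cinf_on UNIV (\<lambda>p :: 'x \<times> ('x \<times> 'y). fst ((\<lambda>(z, v). linv_field v z) ((fst p, 0), snd p)))"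
      by (intro Cinf_on_fst Cinf_on_compose_UNIV[OF open_UNIV Cinf_on_linv_field] Cinf_on_Pair Cinf_on_snd Cinf_on_ident Cinf_on_const open_UNIV)
    then show ?thesis by (simp add: N_def)
  qed
  have cu: "continuous_on UNIV u"
  proof -
    have S: "Cinf_on UNIV (\<lambda>p. star (fst p) (snd p))" using star_smooth by (simp add: case_prod_unfold)
    have "u = (\<lambda>s. frechet_derivative (\<lambda>p. star (fst p) (snd p)) (at (ginv (s *\<^sub>R a), s *\<^sub>R a)) (0, a))"
    proof
      fix s
      show "u s = frechet_derivative (\<lambda>p. star (fst p) (snd p)) (at (ginv (s *\<^sub>R a), s *\<^sub>R a)) (0, a)"
        using frechet_derivative_slice_snd[OF Cinf_on_differentiable[OF S UNIV_I], of "ginv (s *\<^sub>R a)" "s *\<^sub>R a" a]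
        by (simp add: u_def)
    qed
    moreover have "continuous_on UNIV (\<lambda>s. frechet_derivative (\<lambda>p. star (fst p) (snd p)) (at (ginv (s *\<^sub>R a), s *\<^sub>R a)) (0, a))"
      by (rule continuous_on_compose2[OF Cinf_on_continuous[OF Cinf_on_frechet[OF S]]])
        (auto intro!: continuous_on_Pair continuous_on_ginv continuous_on_scaleR continuous_on_id continuous_on_const)
    ultimately show ?thesis by simp
  qed
  have N_eq: "fst (linv_field v z) = N (fst z, v)" for v z
  proof -
    have "fst (linv_field v z) = fst (linv_field v (fst z, 0))"
      using proj[of v] unfolding projectable_def by (metis fst_conv)
    then show ?thesis by (simp add: N_def)
  qed
  define y where "y = (\<lambda>z s. fst (star z (s *\<^sub>R a)))"
  have dy: "(y z has_vector_derivative N (y z s, u s)) (at s)" for z s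
  proof -
    let ?b = "s *\<^sub>R a" and ?c = "star z (s *\<^sub>R a)"
    have in0: "star (ginv ?b) ?b = 0" by simp
    have s1: "(star ?c has_derivative frechet_derivative (star ?c) (at 0)) (at (star (ginv ?b) ?b))"
      unfolding in0 by (rule left_translation_has_derivative)
    have "((\<lambda>x. star ?c (star (ginv ?b) x)) has_derivative
       (\<lambda>x. frechet_derivative (star ?c) (at 0) (frechet_derivative (star (ginv ?b)) (at ?b) x))) (at ?b)"
      by (rule has_derivative_compose[OF left_translation_has_derivative s1])
    then have st: "(star z has_derivative (\<lambda>x. frechet_derivative (star ?c) (at 0) (frechet_derivative (star (ginv ?b)) (at ?b) x))) (at ?b)"
      by (simp add: assoc)
    have line: "((\<lambda>s. s *\<^sub>R a) has_derivative (\<lambda>r. r *\<^sub>R a)) (at s)" by (auto intro!: derivative_eq_intros)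
    have "((\<lambda>s. fst (star z (s *\<^sub>R a))) has_derivative
       (\<lambda>r. fst (frechet_derivative (star ?c) (at 0) (frechet_derivative (star (ginv ?b)) (at ?b) (r *\<^sub>R a))))) (at s)"
      by (rule has_derivative_fst[OF has_derivative_compose[OF line st]])
    moreover have "(\<lambda>r. fst (frechet_derivative (star ?c) (at 0) (frechet_derivative (star (ginv ?b)) (at ?b) (r *\<^sub>R a))))
        = (\<lambda>r. r *\<^sub>R N (y z s, u s))"
    proof
      fix r
      have "frechet_derivative (star ?c) (at 0) (frechet_derivative (star (ginv ?b)) (at ?b) (r *\<^sub>R a)) = r *\<^sub>R linv_field (u s) ?c"
        using linear_scale[OF has_derivative_linear[OF st], of r a] by (simp add: u_def linv_field_def)
      then show "fst (frechet_derivative (star ?c) (at 0) (frechet_derivative (star (ginv ?b)) (at ?b) (r *\<^sub>R a)))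
          = r *\<^sub>R N (y z s, u s)" by (simp only: fst_scaleR N_eq y_def)
    qed
    ultimately show ?thesis unfolding has_vector_derivative_def y_def by (simp only:)
  qed
  have cy: "continuous_on {0..1} (y z)" for z
    by (intro continuous_at_imp_continuous_on ballI has_vector_derivative_continuous[OF dy])
  have bR: "bounded (y z1 ` {0..1} \<union> y z2 ` {0..1})"
    by (intro compact_imp_bounded compact_Un compact_continuous_image cy compact_Icc)
  obtain R where R: "\<And>x. x \<in> y z1 ` {0..1} \<union> y z2 ` {0..1} \<Longrightarrow> norm x \<le> R"
    using bR[unfolded bounded_iff] by blast
  have bU: "bounded (u ` {0..1})"
    by (intro compact_imp_bounded compact_continuous_image continuous_on_subset[OF cu] compact_Icc subset_UNIV)
  obtain U where U: "\<And>x. x \<in> u ` {0..1} \<Longrightarrow> norm x \<le> U"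
    using bU[unfolded bounded_iff] by blast
  \<comment> \<open>Both curves stay in one ball and the directions in another. There
    \<open>N\<close> is Lipschitz in its first argument, so Gronwall's inequality applies to the
    difference of the curves.\<close>
  let ?K = "cball (0::'x) R \<times> cball (0::'x \<times> 'y) U"
  let ?f = "\<lambda>p. \<Sum>b\<in>Basis. norm (frechet_derivative N (at p) (b, 0))"
  have "continuous_on UNIV ?f" by (intro continuous_intros Cinf_on_continuous[OF Cinf_on_frechet[OF NC]])
  then have bf: "bounded (?f ` ?K)"
    by (intro compact_imp_bounded compact_continuous_image compact_Times compact_cball) (rule continuous_on_subset, auto)
  obtain L where L0: "\<And>x. x \<in> ?f ` ?K \<Longrightarrow> norm x \<le> L" using bf[unfolded bounded_iff] by blast
  have L: "?f p \<le> L" if "p \<in> ?K" for p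
  proof -
    have "norm (?f p) \<le> L" using that by (intro L0) (rule imageI)
    then show ?thesis by (rule order_trans[rotated]) simp
  qed
  have lip: "norm (N (y1, v) - N (y2, v)) \<le> L * norm (y1 - y2)"
    if "y1 \<in> cball 0 R" "y2 \<in> cball 0 R" "v \<in> cball 0 U" for y1 y2 v
  proof (rule differentiable_bound[where S="cball 0 R" and f'="\<lambda>x e. frechet_derivative N (at (x, v)) (e, 0)"])
    fix x :: 'x assume x: "x \<in> cball 0 R"
    have D: "(N has_derivative frechet_derivative N (at (x, v))) (at (x, v))" by (rule Cinf_on_has_derivative[OF NC UNIV_I])
    show "((\<lambda>x. N (x, v)) has_derivative (\<lambda>e. frechet_derivative N (at (x, v)) (e, 0))) (at x within cball 0 R)"
      by (rule has_derivative_at_withinI[OF has_derivative_slice_fst[OF D]])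
    have lin: "linear (\<lambda>e. frechet_derivative N (at (x, v)) (e, 0))"
      using has_derivative_slice_fst[OF D] has_derivative_linear by blast
    show "onorm (\<lambda>e. frechet_derivative N (at (x, v)) (e, 0)) \<le> L"
    proof (rule onorm_le)
      fix e :: 'x
      have "norm (frechet_derivative N (at (x, v)) (e, 0)) = norm (\<Sum>b\<in>Basis. (e \<bullet> b) *\<^sub>R frechet_derivative N (at (x, v)) (b, 0))"
        using linear_eq_sum_Basis[OF lin, of e] by simp
      also have "\<dots> \<le> (\<Sum>b\<in>Basis. norm ((e \<bullet> b) *\<^sub>R frechet_derivative N (at (x, v)) (b, 0)))" by (rule norm_sum)
      also have "\<dots> \<le> (\<Sum>b\<in>Basis. norm e * norm (frechet_derivative N (at (x, v)) (b, 0)))"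
        by (intro sum_mono) (auto intro!: mult_right_mono Basis_le_norm)
      also have "\<dots> = norm e * ?f (x, v)" by (simp add: sum_distrib_left)
      also have "\<dots> \<le> norm e * L" using x that(3) by (intro mult_left_mono L) auto
      finally show "norm (frechet_derivative N (at (x, v)) (e, 0)) \<le> L * norm e" by (simp add: mult.commute)
    qed
  qed (use that in auto)
  have "y z1 1 - y z2 1 = 0"
  proof (rule gronwall_zero[where e="\<lambda>s. y z1 s - y z2 s" and e'="\<lambda>s. N (y z1 s, u s) - N (y z2 s, u s)"])
    show "((\<lambda>s. y z1 s - y z2 s) has_vector_derivative N (y z1 s, u s) - N (y z2 s, u s)) (at s)" for s
      by (intro has_vector_derivative_diff dy)
    show "norm (N (y z1 s, u s) - N (y z2 s, u s)) \<le> L * norm (y z1 s - y z2 s)" if "s \<in> {0..1}" for s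
      using that by (intro lip) (auto intro!: R U)
    show "y z1 0 - y z2 0 = 0" using z by (simp add: y_def)
  qed
  then show ?thesis by (simp add: y_def)
qed

section \<open>Fibre integrals of homogeneous kernels\<close>

definition pair_wt :: "('a::euclidean_space \<Rightarrow> real) \<Rightarrow> ('b::euclidean_space \<Rightarrow> real) \<Rightarrow> 'a \<times> 'b \<Rightarrow> real" where
  "pair_wt u v e = (if snd e = 0 then u (fst e) else v (snd e))"

lemma wdil_pair_wt: "wdil (pair_wt u v) l (x, y) = (wdil u l x, wdil v l y)"
  unfolding wdil_Pair pair_wt_def by (auto simp: wdil_def nonzero_Basis intro!: sum.cong)

lemma pos_pair_wt: "pos_wt u \<Longrightarrow> pos_wt v \<Longrightarrow> pos_wt (pair_wt u v)"
  by (auto simp: pos_wt_def pair_wt_def Basis_prod_def)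

lemma wdil_const_wt: "l > 0 \<Longrightarrow> wdil (\<lambda>_. 2) l (\<tau>::real) = l\<^sup>2 * \<tau>"
  by (simp add: wdil_def powr_numeral)

context heat_group begin

text \<open>\<open>d\<close> is the decay exponent: the degree of homogeneity is \<open>- d\<close>,
  and derivatives increase \<open>d\<close>.\<close>

definition hom_class :: "real \<Rightarrow> (real \<times> 'g \<Rightarrow> real) \<Rightarrow> bool" where
  "hom_class d k \<longleftrightarrow> Cinf_on (UNIV - {0}) k \<and>
     (\<forall>l \<zeta>. l > 0 \<longrightarrow> \<zeta> \<noteq> 0 \<longrightarrow> k (\<Delta> l \<zeta>) = l powr (- d) * k \<zeta>)"

lemma hom_class_deriv:
  assumes k: "hom_class d k" and l: "l > 0" and \<zeta>: "\<zeta> \<noteq> 0"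
  shows "frechet_derivative (\<lambda>\<zeta>. k (\<Delta> l \<zeta>)) (at \<zeta>) = frechet_derivative (\<lambda>\<zeta>. l powr (- d) * k \<zeta>) (at \<zeta>)"
    and "k differentiable (at \<zeta>)" "k differentiable (at (\<Delta> l \<zeta>))" "(\<lambda>\<zeta>. k (\<Delta> l \<zeta>)) differentiable (at \<zeta>)"
      "(\<lambda>\<zeta>. l powr (- d) * k \<zeta>) differentiable (at \<zeta>)"
proof -
  have ks: "Cinf_on (UNIV - {0}) k" using k by (simp add: hom_class_def)
  have o: "open (UNIV - {0 :: real \<times> 'g})" by (simp add: open_delete)
  show "frechet_derivative (\<lambda>\<zeta>. k (\<Delta> l \<zeta>)) (at \<zeta>) = frechet_derivative (\<lambda>\<zeta>. l powr (- d) * k \<zeta>) (at \<zeta>)"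
    by (rule frechet_derivative_cong_open[OF o]) (use k l \<zeta> in \<open>auto simp: hom_class_def\<close>)
  show d: "k differentiable (at \<zeta>)" "k differentiable (at (\<Delta> l \<zeta>))"
    using \<zeta> l by (auto intro!: Cinf_on_differentiable[OF ks])
  show "(\<lambda>\<zeta>. k (\<Delta> l \<zeta>)) differentiable (at \<zeta>)" by (rule linear_deriv_compose(1)[OF bounded_linear_wdil d(2)])
  show "(\<lambda>\<zeta>. l powr (- d) * k \<zeta>) differentiable (at \<zeta>)"
    by (rule differentiableI[OF has_derivative_mult_right[OF d(1)[unfolded frechet_derivative_works]]])
qed

lemma hom_class_zop:
  assumes k: "hom_class d k" and j: "j \<in> {1..m}" shows "hom_class (d + 1) (zop (Z j) k)"
  unfolding hom_class_def
proof (intro conjI allI impI)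
  show "Cinf_on (UNIV - {0}) (zop (Z j) k)"
    using k by (intro Cinf_on_zop Z_smooth j) (auto simp: hom_class_def open_delete)
  fix l :: real and \<zeta> :: "real \<times> 'g" assume l: "l > 0" and \<zeta>: "\<zeta> \<noteq> 0"
  note D = hom_class_deriv[OF k l \<zeta>]
  have "l * zop (Z j) k (\<Delta> l \<zeta>) = zop (Z j) (\<lambda>\<zeta>. l powr (- d) * k \<zeta>) \<zeta>"
    by (simp only: zop_wdil[OF l D(3) j, symmetric] zop_eq[OF D(4)] zop_eq[OF D(5)] D(1))
  also have "\<dots> = l powr (- d) * zop (Z j) k \<zeta>" by (rule zop_cmult(1)[OF D(2)])
  finally have "zop (Z j) k (\<Delta> l \<zeta>) = l powr (- d) / l powr 1 * zop (Z j) k \<zeta>" using l by (simp add: field_simps)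
  also have "l powr (- d) / l powr 1 = l powr (- (d + 1))"
    using powr_diff[of l "- d" 1] by (simp only: minus_add_distrib diff_conv_add_uminus)
  finally show "zop (Z j) k (\<Delta> l \<zeta>) = l powr (- (d + 1)) * zop (Z j) k \<zeta>" .
qed

lemma hom_class_dtau:
  assumes k: "hom_class d k" shows "hom_class (d + 2) (dtau k)"
  unfolding hom_class_def
proof (intro conjI allI impI)
  show "Cinf_on (UNIV - {0}) (dtau k)"
    using k by (intro Cinf_on_dtau) (auto simp: hom_class_def open_delete)
  fix l :: real and \<zeta> :: "real \<times> 'g" assume l: "l > 0" and \<zeta>: "\<zeta> \<noteq> 0"
  note D = hom_class_deriv[OF k l \<zeta>]
  have "l powr 2 * dtau k (\<Delta> l \<zeta>) = dtau (\<lambda>\<zeta>. l powr (- d) * k \<zeta>) \<zeta>"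
    using dtau_wdil[OF l D(3)] l by (simp add: powr_numeral dtau_eq[OF D(4)] dtau_eq[OF D(5)] D(1))
  also have "\<dots> = l powr (- d) * dtau k \<zeta>" by (rule zop_cmult(2)[OF D(2)])
  finally have "dtau k (\<Delta> l \<zeta>) = l powr (- d) / l powr 2 * dtau k \<zeta>" using l by (simp add: field_simps)
  also have "l powr (- d) / l powr 2 = l powr (- (d + 2))"
    using powr_diff[of l "- d" 2] by (simp only: minus_add_distrib diff_conv_add_uminus)
  finally show "dtau k (\<Delta> l \<zeta>) = l powr (- (d + 2)) * dtau k \<zeta>" .
qed

lemma hom_class_refl:
  assumes k: "hom_class d k" shows "hom_class d (\<lambda>\<zeta>. k (refl_inv \<zeta>))"
  unfolding hom_class_def
proof (intro conjI allI impI)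
  show "Cinf_on (UNIV - {0}) (\<lambda>\<zeta>. k (refl_inv \<zeta>))"
    by (rule Cinf_on_compose[where T="UNIV - {0}"])
      (use k in \<open>auto simp: hom_class_def open_delete intro: Cinf_on_subset[OF Cinf_on_refl_inv]\<close>)
  fix l :: real and \<zeta> :: "real \<times> 'g" assume l: "l > 0" and "\<zeta> \<noteq> 0"
  then have "refl_inv \<zeta> \<noteq> 0" by simp
  then have "k (\<Delta> l (refl_inv \<zeta>)) = l powr (- d) * k (refl_inv \<zeta>)"
    using k l unfolding hom_class_def by blast
  then show "k (refl_inv (\<Delta> l \<zeta>)) = l powr (- d) * k (refl_inv \<zeta>)" by (simp only: refl_inv_wdil[OF l])
qed

end

locale lift_group = heat_group star ginv w m Z
  for star :: "'x::euclidean_space \<times> 'y::euclidean_space \<Rightarrow> 'x \<times> 'y \<Rightarrow> 'x \<times> 'y" and ginv w m Z +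
  fixes X :: "nat \<Rightarrow> 'x \<Rightarrow> 'x"
  assumes lift: "j \<in> {1..m} \<Longrightarrow> fst (Z j (x, \<xi>)) = X j x"
    and fibre: "fst z1 = fst z2 \<Longrightarrow> fst (star z1 a) = fst (star z2 a)"
begin

abbreviation "wx \<equiv> (\<lambda>e. w (e, 0))"
abbreviation "wy \<equiv> (\<lambda>e. w (0, e))"

lemma pos_wx: "pos_wt wx" and pos_wy: "pos_wt wy"
  using pos_w unfolding pos_wt_Pair[of w] by auto

lemma wdil_xy: "wdil w l (x, y) = (wdil wx l x, wdil wy l y)"
  by (rule wdil_Pair)

text \<open>The gap is the sum of the base weights. This inequality is what makes the fibre
  integrals of \<open>gam\<close> converge.\<close>

lemma hom_dim_gt: "hom_dim > (\<Sum>e\<in>Basis. wy e)"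
proof -
  have "hom_dim = (\<Sum>e\<in>Basis. wx e) + (\<Sum>e\<in>Basis. wy e)"
    unfolding hom_dim_def Basis_prod_def
    by (subst sum.union_disjoint) (auto simp: sum.reindex inj_on_def nonzero_Basis)
  moreover have "(\<Sum>e\<in>Basis. wx e) > 0" using pos_wx by (intro sum_pos) (auto simp: pos_wt_def)
  ultimately show ?thesis by simp
qed

lemma fst_star_fibre: "fst (star (x, \<xi>) a) = fst (star (x, 0) a)"
  by (rule fibre) simp

lemma Pair_fst_star: "(fst (star (x, 0) a), snd (star (x, \<xi>) a)) = star (x, \<xi>) a"
  by (simp add: fst_star_fibre[of x \<xi> a, symmetric])

text \<open>Right translation by \<open>a\<close> maps the fibre over \<open>y\<close> onto another
  fibre. In fibre coordinates this is an equivariant family with parameter \<open>(y, a)\<close>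
  that reduces to the identity at parameter 0.\<close>

lemma integral_right_fibre:
  fixes f :: "'y \<Rightarrow> real"
  shows "(\<integral>\<eta>. f (snd (star (y, \<eta>) a)) \<partial>lborel) = (\<integral>\<eta>. f \<eta> \<partial>lborel)"
proof -
  define \<phi> where "\<phi> = (\<lambda>q \<eta>. snd (star (fst q, \<eta>) (snd q)))"
  \<comment> \<open>The way back starts from the fibre that was reached and translates by the
    inverse of \<open>a\<close>.\<close>
  define \<theta> where "\<theta> = (\<lambda>q \<eta>. snd (star (fst (star (fst q, 0) (snd q)), \<eta>) (ginv (snd q))))"
  have inv: "\<theta> q (\<phi> q \<eta>) = \<eta>" "\<phi> q (\<theta> q \<eta>) = \<eta>" for q \<eta>
  proof -
    show "\<theta> q (\<phi> q \<eta>) = \<eta>" unfolding \<theta>_def \<phi>_def Pair_fst_star by simp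
    have "fst (star (fst (star (fst q, 0) (snd q)), \<eta>) (ginv (snd q)))
        = fst (star (star (fst q, 0) (snd q)) (ginv (snd q)))" by (rule fibre) simp
    then have "(fst q, \<theta> q \<eta>) = star (fst (star (fst q, 0) (snd q)), \<eta>) (ginv (snd q))"
      by (simp add: \<theta>_def prod_eq_iff)
    then show "\<phi> q (\<theta> q \<eta>) = \<eta>" by (simp add: \<phi>_def)
  qed
  have c: "continuous_on UNIV (\<theta> q)" "continuous_on UNIV (\<phi> q)" for q unfolding \<theta>_def \<phi>_def
    by (intro continuous_on_snd continuous_on_star continuous_on_Pair continuous_on_const continuous_on_id)+
  have "distr lborel borel (\<phi> (y, a)) = lborel"
  proof (rule distr_lborel_equivariant[where \<theta>=\<theta> and w=wy and v="pair_wt wx w" and A="\<lambda>x. x"])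
    show "Cinf_on UNIV (\<lambda>(q, z). \<phi> q z)" unfolding \<phi>_def case_prod_unfold
      by (intro Cinf_on_snd Cinf_on_star Cinf_on_Pair Cinf_on_fst Cinf_on_ident open_UNIV)
    show "pos_wt (pair_wt wx w)" by (intro pos_pair_wt pos_wx pos_w)
    show "\<phi> (wdil (pair_wt wx w) l q) (wdil wy l z) = wdil wy l (\<phi> q z)" if "l > 0" for l q z
    proof -
      obtain x b where q: "q = (x, b)" by (cases q)
      have "star (wdil wx l x, wdil wy l z) (wdil w l b) = wdil w l (star (x, z) b)"
        using wdil_star[OF that, of "(x, z)" b] by (simp add: wdil_xy)
      then show ?thesis
        by (simp add: \<phi>_def q wdil_pair_wt) (cases "star (x, z) b", simp add: wdil_xy)
    qed
    show "(\<phi> 0 has_derivative (\<lambda>x. x)) (at 0)" by (simp add: \<phi>_def zero_prod_def[symmetric])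
    show "\<theta> (y, a) \<in> borel_measurable borel" by (intro borel_measurable_continuous_onI c)
  qed (simp_all add: inv pos_wy)
  from lborel_distr_eqD(1)[OF this borel_measurable_continuous_onI[OF c(2)] borel_measurable_continuous_onI[OF c(1)] inv(2), of f]
  show ?thesis by (simp add: \<phi>_def)
qed

text \<open>The two fibre parametrisations \<open>\<eta> \<mapsto> (x, 0)\<^sup>-\<^sup>1 \<star> (y, \<eta>)\<close> and
  \<open>\<eta> \<mapsto> ((y, 0)\<^sup>-\<^sup>1 \<star> (x, \<eta>))\<^sup>-\<^sup>1\<close> differ by a measure preserving change of \<open>\<eta>\<close>.\<close>

lemma integral_reflect_fibre:
  fixes k :: "real \<times> 'x \<times> 'y \<Rightarrow> real"
  shows "(\<integral>\<eta>. k (\<tau>, star (ginv (x, 0)) (y, \<eta>)) \<partial>lborel)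
       = (\<integral>\<eta>. k (refl_inv (\<tau>, star (ginv (y, 0)) (x, \<eta>))) \<partial>lborel)"
proof -
  \<comment> \<open>Solving \<open>(x, 0)\<^sup>-\<^sup>1 \<star> (y, \<eta>) = (x,
    \<eta>')\<^sup>-\<^sup>1 \<star> (y, 0)\<close> gives \<open>(x, \<eta>') = (y, 0) \<star> (y,
    \<eta>)\<^sup>-\<^sup>1 \<star> (x, 0)\<close>. The right side lies over \<open>x\<close> by
    \<open>fibre\<close>, and exchanging \<open>x\<close> and \<open>y\<close> inverts the
    map.\<close>
  define \<phi> where "\<phi> = (\<lambda>q \<eta>. snd (star (snd q, 0) (star (ginv (snd q, \<eta>)) (fst q, 0))))"
  have pair: "(x, \<phi> (x, y) \<eta>) = star (y, 0) (star (ginv (y, \<eta>)) (x, 0))" for x y \<eta>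
  proof -
    have "fst (star (y, 0) (star (ginv (y, \<eta>)) (x, 0))) = fst (star (y, \<eta>) (star (ginv (y, \<eta>)) (x, 0)))"
      by (rule fibre) simp
    then show ?thesis by (simp add: \<phi>_def prod_eq_iff)
  qed
  have inv: "\<phi> (y, x) (\<phi> (x, y) \<eta>) = \<eta>" for x y \<eta>
  proof -
    have "ginv (x, \<phi> (x, y) \<eta>) = star (ginv (x, 0)) (star (y, \<eta>) (ginv (y, 0)))"
      unfolding pair by (simp add: ginv_star assoc)
    then have "star (x, 0) (star (ginv (x, \<phi> (x, y) \<eta>)) (y, 0)) = (y, \<eta>)"
      by (simp add: assoc)
    then show ?thesis by (simp add: \<phi>_def)
  qed
  have c: "continuous_on UNIV (\<phi> q)" for q unfolding \<phi>_def
    by (intro continuous_on_snd continuous_on_star continuous_on_ginv continuous_on_Pair continuous_on_const continuous_on_id)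
  have d: "distr lborel borel (\<phi> (x, y)) = lborel"
  proof (rule distr_lborel_equivariant[where \<theta>="\<lambda>q. \<phi> (snd q, fst q)" and w=wy and v="pair_wt wx wx" and A="\<lambda>x. - x"])
    show "Cinf_on UNIV (\<lambda>(q, z). \<phi> q z)" unfolding \<phi>_def case_prod_unfold
      by (intro Cinf_on_snd Cinf_on_star Cinf_on_ginv Cinf_on_Pair Cinf_on_fst Cinf_on_ident Cinf_on_const open_UNIV)
    show "pos_wt (pair_wt wx wx)" by (intro pos_pair_wt pos_wx)
    show "\<phi> (wdil (pair_wt wx wx) l q) (wdil wy l z) = wdil wy l (\<phi> q z)" if "l > 0" for l q z
    proof -
      obtain x y where q: "q = (x, y)" by (cases q)
      let ?s = "star (y, 0) (star (ginv (y, z)) (x, 0))"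
      have "star (wdil w l (y, 0)) (star (ginv (wdil w l (y, z))) (wdil w l (x, 0))) = wdil w l ?s"
        using that by (simp add: wdil_star wdil_ginv)
      then have "star (wdil wx l y, 0) (star (ginv (wdil wx l y, wdil wy l z)) (wdil wx l x, 0)) = wdil w l ?s"
        by (simp add: wdil_xy)
      then show ?thesis
        by (simp add: \<phi>_def q wdil_pair_wt) (cases ?s, simp add: wdil_xy)
    qed
    have g0: "(ginv has_derivative (\<lambda>v. - v)) (at (0, 0))" using ginv_deriv0 by (simp add: zero_prod_def)
    have "((\<lambda>\<eta>::'y. snd (ginv (0, \<eta>))) has_derivative (\<lambda>v. snd (- (0::'x, v)))) (at 0)"
      by (intro has_derivative_snd has_derivative_compose[where f="\<lambda>\<eta>. (0, \<eta>)" and g=ginv, OF _ g0] has_derivative_Pair has_derivative_const has_derivative_ident)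
    then show "(\<phi> 0 has_derivative uminus) (at 0)"
      by (simp add: \<phi>_def zero_prod_def[symmetric])
    show "\<phi> (snd (x, y), fst (x, y)) \<in> borel_measurable borel" by (intro borel_measurable_continuous_onI c)
  qed (auto simp: inv pos_wy)
  have "star (ginv (x, 0)) (y, \<eta>) = ginv (star (ginv (y, 0)) (x, \<phi> (x, y) \<eta>))" for \<eta>
    unfolding pair by (simp add: ginv_star)
  then have "(\<integral>\<eta>. k (\<tau>, star (ginv (x, 0)) (y, \<eta>)) \<partial>lborel)
      = (\<integral>\<eta>. (\<lambda>\<eta>. k (refl_inv (\<tau>, star (ginv (y, 0)) (x, \<eta>)))) (\<phi> (x, y) \<eta>) \<partial>lborel)"
    by (simp add: refl_inv_def)
  also have "\<dots> = (\<integral>\<eta>. k (refl_inv (\<tau>, star (ginv (y, 0)) (x, \<eta>))) \<partial>lborel)"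
    by (rule lborel_distr_eqD(1)[OF d borel_measurable_continuous_onI[OF c]
          borel_measurable_continuous_onI[OF c[of "(y, x)"]] inv])
  finally show ?thesis .
qed

definition fibre_int :: "(real \<times> 'x \<times> 'y \<Rightarrow> real) \<Rightarrow> real \<Rightarrow> 'x \<Rightarrow> 'x \<Rightarrow> real" where
  "fibre_int k \<tau> x y = (\<integral>\<eta>. k (\<tau>, star (ginv (x, 0)) (y, \<eta>)) \<partial>lborel)"

text \<open>The extra right factor \<open>a\<close> in the kernel below allows differentiation along \<open>Z j\<close>: by
  \<open>integral_right_fibre\<close>, moving \<open>a\<close> amounts to moving \<open>y\<close> along the projected curve.\<close>

lemma fibre_int_derivatives:
  assumes k: "hom_class d k" and d: "d \<ge> hom_dim" and ne: "(\<tau>, x) \<noteq> (0, y)"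
  shows "integrable lborel (\<lambda>\<eta>. k (\<tau>, star (ginv (x, 0)) (y, \<eta>)))"
    and "((\<lambda>\<tau>. fibre_int k \<tau> x y) has_real_derivative fibre_int (dtau k) \<tau> x y) (at \<tau>)"
    and "(\<lambda>y. fibre_int k \<tau> x y) differentiable (at y)"
    and "j \<in> {1..m} \<Longrightarrow> frechet_derivative (\<lambda>y. fibre_int k \<tau> x y) (at y) (X j y) = fibre_int (zop (Z j) k) \<tau> x y"
proof -
  \<comment> \<open>The parameter is \<open>(\<tau>, x, y, a)\<close> and the last slot is the fibre
    variable, so one application of \<open>homogeneous_param_integral\<close> yields the derivatives
    in time, in \<open>y\<close> and in \<open>a\<close>.\<close>
  define g :: "(real \<times> 'x \<times> 'x \<times> 'x \<times> 'y) \<times> 'y \<Rightarrow> real \<times> 'x \<times> 'y" where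
    "g = (\<lambda>p. (fst (fst p), star (ginv (fst (snd (fst p)), 0))
      (star (fst (snd (snd (fst p))), snd p) (snd (snd (snd (fst p)))))))"
  have g: "g ((\<tau>, x, y, a), \<eta>) = (\<tau>, star (ginv (x, 0)) (star (y, \<eta>) a))" for \<tau> x y a \<eta> by (simp add: g_def)
  have gC: "Cinf_on UNIV g" unfolding g_def
    by (intro Cinf_on_snd Cinf_on_star Cinf_on_ginv Cinf_on_Pair Cinf_on_fst Cinf_on_ident Cinf_on_const open_UNIV)
  define \<Omega> where "\<Omega> = {p. g p \<noteq> 0}"
  define F where "F = (\<lambda>p. k (g p))"
  let ?v = "pair_wt (\<lambda>_::real. 2) (pair_wt wx (pair_wt wx w))"
  have gdil: "g (wdil ?v l c, wdil wy l \<eta>) = \<Delta> l (g (c, \<eta>))" if l: "l > 0" for l c \<eta>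
  proof -
    obtain \<tau> x y a where c: "c = (\<tau>, x, y, a)" by (cases c)
    have "star (ginv (wdil w l (x, 0))) (star (wdil w l (y, \<eta>)) (wdil w l a)) = wdil w l (star (ginv (x, 0)) (star (y, \<eta>) a))"
      using l by (simp add: wdil_star wdil_ginv)
    then show ?thesis using l by (simp add: c g wdil_pair_wt wdil_const_wt wdil_prod_wt wdil_xy)
  qed
  have k': "Cinf_on (UNIV - {0}) k" "\<And>l \<zeta>. l > 0 \<Longrightarrow> \<zeta> \<noteq> 0 \<Longrightarrow> k (\<Delta> l \<zeta>) = l powr (- d) * k \<zeta>"
    using k by (auto simp: hom_class_def)
  interpret K: homogeneous_kernel ?v wy \<Omega>
  proof
    show "pos_wt ?v" by (intro pos_pair_wt pos_wx pos_w) (simp add: pos_wt_def)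
    show "open \<Omega>" unfolding \<Omega>_def by (intro open_Collect_neq Cinf_on_continuous[OF gC] continuous_on_const)
    show "(wdil ?v l c, wdil wy l \<eta>) \<in> \<Omega>" if "l > 0" "(c, \<eta>) \<in> \<Omega>" for l c \<eta>
      using that gdil by (simp add: \<Omega>_def)
    show "(0, \<eta>) \<in> \<Omega>" if "\<eta> \<noteq> 0" for \<eta>
      using that g[of 0 0 0 0 \<eta>] by (simp add: \<Omega>_def zero_prod_def[symmetric]) (simp add: zero_prod_def)
  qed (rule pos_wy)
  have FC: "Cinf_on \<Omega> F" unfolding F_def
    by (rule Cinf_on_compose[OF K.open_\<Omega> k'(1) Cinf_on_subset[OF gC]]) (auto simp: \<Omega>_def)
  have Fhom: "F (wdil ?v l c, wdil wy l \<eta>) = l powr (- d) * F (c, \<eta>)" if "l > 0" "(c, \<eta>) \<in> \<Omega>" for l c \<eta>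
    using that k'(2)[of l "g (c, \<eta>)"] by (simp add: F_def gdil \<Omega>_def)
  have d': "d > (\<Sum>e\<in>Basis. wy e)" using d hom_dim_gt by linarith
  \<comment> \<open>Parameters whose whole fibre misses the pole. The base point of
    \<open>(y, \<eta>) \<star> a\<close> does not depend on \<open>\<eta>\<close>, so the condition
    can be read off at \<open>\<eta> = 0\<close>.\<close>
  define U where "U = {c :: real \<times> 'x \<times> 'x \<times> 'x \<times> 'y.
    (fst c, fst (star (fst (snd (snd c)), 0) (snd (snd (snd c))))) \<noteq> (0, fst (snd c))}"
  have U: "open U" unfolding U_def
    by (intro open_Collect_neq continuous_on_Pair continuous_on_fst continuous_on_snd continuous_on_star continuous_on_id continuous_on_const)
  have U\<Omega>: "U \<times> UNIV \<subseteq> \<Omega>"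
  proof
    fix p assume p: "p \<in> U \<times> (UNIV :: 'y set)"
    obtain \<tau> x y a \<eta> where pe: "p = ((\<tau>, x, y, a), \<eta>)" by (metis prod.exhaust)
    show "p \<in> \<Omega>"
    proof (rule ccontr)
      assume "p \<notin> \<Omega>"
      then have "\<tau> = 0" "star (ginv (x, 0)) (star (y, \<eta>) a) = 0" by (auto simp: \<Omega>_def pe g zero_prod_def)
      then have "\<tau> = 0" "(x, 0) = star (y, \<eta>) a" by (simp_all only: star_ginv_eq_0)
      then have "\<tau> = 0" "fst (star (y, 0) a) = x" using fst_star_fibre[of y \<eta> a] by (simp, metis fst_conv)
      then show False using p by (simp add: pe U_def)
    qed
  qed
  define c0 where "c0 = (\<tau>, x, y, (0 :: 'x \<times> 'y))"
  have c0: "c0 \<in> U" using ne by (auto simp: c0_def U_def)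
  define I where "I = (\<lambda>c. \<integral>\<eta>. F (c, \<eta>) \<partial>lborel)"
  define L where "L = (\<lambda>e. \<integral>\<eta>. frechet_derivative F (at (c0, \<eta>)) (e, 0) \<partial>lborel)"
  have int: "integrable lborel (\<lambda>\<eta>. F (c0, \<eta>))"
    by (rule K.homogeneous_param_integral(1)[OF FC U U\<Omega> c0 Fhom d'])
  have I: "(I has_derivative L) (at c0)" unfolding I_def L_def
    by (rule K.homogeneous_param_integral(2)[OF FC U U\<Omega> c0 Fhom d'])
  have lin: "linear L" by (rule has_derivative_linear[OF I])
  have I_eq: "I (\<tau>, x, y, 0) = fibre_int k \<tau> x y" for \<tau> x y
    by (simp add: I_def F_def g fibre_int_def)
  show "integrable lborel (\<lambda>\<eta>. k (\<tau>, star (ginv (x, 0)) (y, \<eta>)))"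
    using int by (simp add: F_def g c0_def)
  have c0\<Omega>: "(c0, \<eta>) \<in> \<Omega>" for \<eta> using U\<Omega> c0 by blast
  have FD: "(F has_derivative frechet_derivative F (at (c0, \<eta>))) (at (c0, \<eta>))" for \<eta>
    by (rule Cinf_on_has_derivative[OF FC c0\<Omega>])
  have kd: "k differentiable (at (\<tau>, star (ginv (x, 0)) (y, \<eta>)))" for \<eta>
    using c0\<Omega>[of \<eta>] by (intro Cinf_on_differentiable[OF k'(1)]) (simp add: \<Omega>_def c0_def g)

  have L1: "L (1, 0) = fibre_int (dtau k) \<tau> x y"
    unfolding L_def fibre_int_def
  proof (rule Bochner_Integration.integral_cong[OF refl])
    fix \<eta> :: 'y
    have "((\<lambda>r. ((r, x, y, 0), \<eta>)) has_derivative (\<lambda>r. ((r, 0), 0))) (at \<tau>)"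
      by (auto intro!: derivative_eq_intros simp: zero_prod_def)
    from has_derivative_compose[OF this FD[of \<eta>, unfolded c0_def]]
    have "((\<lambda>r. F ((r, x, y, 0), \<eta>)) has_derivative (\<lambda>r. frechet_derivative F (at (c0, \<eta>)) ((r, 0), 0))) (at \<tau>)"
      by (simp add: c0_def)
    moreover have "(\<lambda>r. frechet_derivative F (at (c0, \<eta>)) ((r, 0), 0)) = (*) (frechet_derivative F (at (c0, \<eta>)) ((1, 0), 0))"
    proof
      fix r
      show "frechet_derivative F (at (c0, \<eta>)) ((r, 0), 0) = frechet_derivative F (at (c0, \<eta>)) ((1, 0), 0) * r"
        using linear_scale[OF has_derivative_linear[OF FD], of \<eta> r "((1, 0), 0)"] by simp
    qed
    ultimately have 1: "((\<lambda>r. F ((r, x, y, 0), \<eta>)) has_real_derivative frechet_derivative F (at (c0, \<eta>)) ((1, 0), 0)) (at \<tau>)"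
      by (simp only: has_field_derivative_def)
    have 2: "((\<lambda>r. F ((r, x, y, 0), \<eta>)) has_real_derivative dtau k (\<tau>, star (ginv (x, 0)) (y, \<eta>))) (at \<tau>)"
      using dtau_slice_has_derivative[OF kd[of \<eta>]] by (simp add: F_def g dtau_eq[OF kd])
    show "frechet_derivative F (at (c0, \<eta>)) ((1, 0), 0) = dtau k (\<tau>, star (ginv (x, 0)) (y, \<eta>))"
      by (rule DERIV_unique[OF 1 2])
  qed
  have "((\<lambda>r. (r, x, y, 0)) has_derivative (\<lambda>r. (r, 0))) (at \<tau>)"
    by (auto intro!: derivative_eq_intros simp: zero_prod_def)
  from has_derivative_compose[OF this I[unfolded c0_def]]
  have "((\<lambda>r. fibre_int k r x y) has_derivative (\<lambda>r. L (r, 0))) (at \<tau>)" by (simp add: I_eq)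
  moreover have "(\<lambda>r. L (r, 0)) = (*) (fibre_int (dtau k) \<tau> x y)"
  proof
    fix r show "L (r, 0) = fibre_int (dtau k) \<tau> x y * r"
      using linear_scale[OF lin, of r "(1, 0)"] by (simp add: L1)
  qed
  ultimately show "((\<lambda>\<tau>. fibre_int k \<tau> x y) has_real_derivative fibre_int (dtau k) \<tau> x y) (at \<tau>)"
    by (simp only: has_field_derivative_def)

  have emb: "((\<lambda>y'. (\<tau>, x, y', 0 :: 'x \<times> 'y)) has_derivative (\<lambda>e. (0, 0, e, 0))) (at y)"
    by (auto intro!: derivative_eq_intros)
  have Dy: "((\<lambda>y. fibre_int k \<tau> x y) has_derivative (\<lambda>e. L (0, 0, e, 0))) (at y)"
    using has_derivative_compose[OF emb I[unfolded c0_def]] by (simp add: I_eq)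
  then show "(\<lambda>y. fibre_int k \<tau> x y) differentiable (at y)" by (rule differentiableI)

  assume j: "j \<in> {1..m}"
  have I_star: "fibre_int k \<tau> x (fst (star (y, 0) a)) = I (\<tau>, x, y, a)" for a
    using integral_right_fibre[of "\<lambda>\<eta>. k (\<tau>, star (ginv (x, 0)) (fst (star (y, 0) a), \<eta>))" y a]
    by (simp add: I_def F_def g fibre_int_def Pair_fst_star)
  have Dst: "((\<lambda>a. fst (star (y, 0) a)) has_derivative (\<lambda>e. fst (frechet_derivative (star (y, 0)) (at 0) e))) (at 0)"
    by (intro has_derivative_fst left_translation_has_derivative)
  have Dy': "((\<lambda>y. fibre_int k \<tau> x y) has_derivative (\<lambda>e. L (0, 0, e, 0))) (at (fst (star (y, 0) 0)))" using Dy by simp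
  \<comment> \<open>One function of \<open>a\<close> is differentiated in two ways: by moving
    \<open>y\<close> along the projected translation, and in \<open>A2\<close> by moving
    \<open>a\<close> inside the kernel. In the direction \<open>Z j 0\<close> the first gives the
    derivative along \<open>X j y\<close>, the second the integral of
    \<open>zop (Z j) k\<close>.\<close>
  have A1: "((\<lambda>a. I (\<tau>, x, y, a)) has_derivative (\<lambda>e. L (0, 0, fst (frechet_derivative (star (y, 0)) (at 0) e), 0))) (at 0)"
    using has_derivative_compose[OF Dst Dy'] by (simp only: I_star)
  have emb2: "((\<lambda>a. (\<tau>, x, y, a)) has_derivative (\<lambda>e. (0, 0, 0, e))) (at (0 :: 'x \<times> 'y))"
    by (auto intro!: derivative_eq_intros)
  have A2: "((\<lambda>a. I (\<tau>, x, y, a)) has_derivative (\<lambda>e. L (0, 0, 0, e))) (at 0)"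
    by (rule has_derivative_compose[OF emb2 I[unfolded c0_def]])
  have "L (0, 0, X j y, 0) = L (0, 0, 0, Z j 0)"
    using fun_cong[OF has_derivative_unique[OF A1 A2], of "Z j 0"] lift[OF j, of y 0]
    by (simp add: left_inv_at_0[OF Z_left[OF j]])
  also have "\<dots> = fibre_int (zop (Z j) k) \<tau> x y"
    unfolding L_def fibre_int_def
  proof (rule Bochner_Integration.integral_cong[OF refl])
    fix \<eta> :: 'y
    let ?z = "star (ginv (x, 0)) (y, \<eta>)"
    have ks: "(\<lambda>z. k (\<tau>, z)) differentiable (at ?z)"
      by (rule differentiableI[OF has_derivative_slice_snd[OF kd[unfolded frechet_derivative_works]]])
    have "((\<lambda>a. ((\<tau>, x, y, a), \<eta>)) has_derivative (\<lambda>e. ((0, 0, 0, e), 0))) (at (0 :: 'x \<times> 'y))"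
      by (auto intro!: derivative_eq_intros)
    from has_derivative_compose[OF this FD[of \<eta>, unfolded c0_def]]
    have "((\<lambda>a. k (\<tau>, star ?z a)) has_derivative (\<lambda>e. frechet_derivative F (at (c0, \<eta>)) ((0, 0, 0, e), 0))) (at 0)"
      by (simp add: c0_def F_def g assoc)
    from frechet_derivative_eqI[OF this, of "Z j 0"]
    show "frechet_derivative F (at (c0, \<eta>)) ((0, 0, 0, Z j 0), 0) = zop (Z j) k (\<tau>, ?z)"
      using left_inv_deriv(2)[OF Z_left[OF j] ks] by (simp add: zop_def)
  qed
  finally show "frechet_derivative (\<lambda>y. fibre_int k \<tau> x y) (at y) (X j y) = fibre_int (zop (Z j) k) \<tau> x y"
    by (simp add: frechet_derivative_eqI[OF Dy])
qed

end

section \<open>Iterated derivatives\<close>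

lemma apply_ops_append: "apply_ops (xs @ ys) F = apply_ops xs (apply_ops ys F)"
  by (induction xs) auto

lemma ops_exist_append: "ops_exist W (xs @ ys) F \<longleftrightarrow> ops_exist W ys F \<and> ops_exist W xs (apply_ops ys F)"
  by (induction xs) (auto simp: apply_ops_append)

abbreviation off_diag :: "real \<times> 'a \<times> real \<times> 'a \<Rightarrow> bool" where
  "off_diag \<equiv> (\<lambda>(t, x, s, y). (t, x) \<noteq> (s, y))"

text \<open>An abstraction of fibre integrals: \<open>P\<close> is a class of kernels stable under
  the derivatives, and \<open>\<Phi> k\<close> is differentiated only in time and in its last
  argument. What remains is bookkeeping over words of operators.\<close>

locale kernel_calculus =
  fixes P :: "(real \<times> 'g::euclidean_space \<Rightarrow> real) \<Rightarrow> bool"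
    and \<Phi> :: "(real \<times> 'g \<Rightarrow> real) \<Rightarrow> real \<Rightarrow> real^'n::finite \<Rightarrow> real^'n \<Rightarrow> real"
    and m :: nat and Z :: "nat \<Rightarrow> 'g \<Rightarrow> 'g" and X :: "nat \<Rightarrow> real^'n \<Rightarrow> real^'n"
  assumes P_dtau: "P k \<Longrightarrow> P (dtau k)"
    and P_zop: "P k \<Longrightarrow> j \<in> {1..m} \<Longrightarrow> P (zop (Z j) k)"
    and \<Phi>_dtau: "P k \<Longrightarrow> (\<tau>, x) \<noteq> (0, y) \<Longrightarrow> ((\<lambda>\<tau>. \<Phi> k \<tau> x y) has_real_derivative \<Phi> (dtau k) \<tau> x y) (at \<tau>)"
    and \<Phi>_diff: "P k \<Longrightarrow> (\<tau>, x) \<noteq> (0, y) \<Longrightarrow> (\<lambda>y. \<Phi> k \<tau> x y) differentiable (at y)"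
    and \<Phi>_zop: "P k \<Longrightarrow> (\<tau>, x) \<noteq> (0, y) \<Longrightarrow> j \<in> {1..m} \<Longrightarrow>
      frechet_derivative (\<lambda>y. \<Phi> k \<tau> x y) (at y) (X j y) = \<Phi> (zop (Z j) k) \<tau> x y"
begin

text \<open>The flag selects which of the two space variables is the integrated one: \<open>DY\<close> acts on the
  unswapped and \<open>DX\<close> on the swapped form.\<close>

definition agrees :: "bool \<Rightarrow> real \<Rightarrow> (real \<times> 'g \<Rightarrow> real) \<Rightarrow> 'n F4 \<Rightarrow> bool" where
  "agrees swap c k F \<longleftrightarrow> P k \<and> (\<forall>t x s y. (t, x) \<noteq> (s, y) \<longrightarrow>
     F (t, x, s, y) = c * \<Phi> k (s - t) (if swap then y else x) (if swap then x else y))"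

lemma agreesD:
  "agrees swap c k F \<Longrightarrow> (t, x) \<noteq> (s, y) \<Longrightarrow>
    F (t, x, s, y) = c * \<Phi> k (s - t) (if swap then y else x) (if swap then x else y)"
  unfolding agrees_def by blast

text \<open>\<open>agrees\<close> gives an equality only off the diagonal, so derivatives are
  compared on an open set of the moving variable.\<close>

lemma scaled_deriv:
  fixes f g :: "'a::euclidean_space \<Rightarrow> real"
  assumes S: "open S" "a \<in> S" and eq: "\<And>z. z \<in> S \<Longrightarrow> f z = c * g z" and g: "g differentiable (at a)"
  shows "f differentiable (at a)" "frechet_derivative f (at a) v = c * frechet_derivative g (at a) v"
proof -
  have "((\<lambda>z. c * g z) has_derivative (\<lambda>v. c * frechet_derivative g (at a) v)) (at a)"
    by (intro has_derivative_mult_right g[unfolded frechet_derivative_works])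
  then have d: "(f has_derivative (\<lambda>v. c * frechet_derivative g (at a) v)) (at a)"
    by (rule has_derivative_transform_within_open[OF _ S]) (simp add: eq)
  show "f differentiable (at a)" by (rule differentiableI[OF d])
  show "frechet_derivative f (at a) v = c * frechet_derivative g (at a) v" by (rule frechet_derivative_eqI[OF d])
qed

lemma agrees_DS:
  assumes a: "agrees swap c k F"
  shows "agrees swap c (dtau k) (apply_dop DS F)" "off_diag p \<Longrightarrow> dop_exists DS F p"
proof -
  have Pk: "P k" using a by (simp add: agrees_def)
  have D: "((\<lambda>s'. F (t, x, s', y)) has_real_derivative
      c * \<Phi> (dtau k) (s - t) (if swap then y else x) (if swap then x else y)) (at s)"
    if ne: "(t, x) \<noteq> (s, y)" for t x s y
  proof -
    let ?x = "if swap then y else x" and ?y = "if swap then x else y"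
    \<comment> \<open>The values of \<open>s'\<close> that keep the point off the diagonal: all of
      them if \<open>x \<noteq> y\<close>, all but \<open>t\<close> otherwise.\<close>
    let ?S = "if x = y then - {t} else UNIV"
    have "(s - t, ?x) \<noteq> (0, ?y)" using ne by auto
    from \<Phi>_dtau[OF Pk this] have "((\<lambda>\<tau>. \<Phi> k \<tau> ?x ?y) has_real_derivative \<Phi> (dtau k) (s - t) ?x ?y) (at (s - t))" .
    moreover have "((\<lambda>s'. s' - t) has_real_derivative 1) (at s)" by (auto intro!: derivative_eq_intros)
    ultimately have "((\<lambda>s'. \<Phi> k (s' - t) ?x ?y) has_real_derivative \<Phi> (dtau k) (s - t) ?x ?y * 1) (at s)"
      by (rule DERIV_chain2)
    then have "((\<lambda>s'. c * \<Phi> k (s' - t) ?x ?y) has_real_derivative c * (\<Phi> (dtau k) (s - t) ?x ?y * 1)) (at s)"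
      by (rule DERIV_cmult)
    then have "((\<lambda>s'. c * \<Phi> k (s' - t) ?x ?y) has_real_derivative c * \<Phi> (dtau k) (s - t) ?x ?y) (at s)" by simp
    then show ?thesis
    proof (rule has_field_derivative_transform_within_open[where S="?S"])
      show "c * \<Phi> k (s' - t) ?x ?y = F (t, x, s', y)" if "s' \<in> ?S" for s'
      proof -
        have "(t, x) \<noteq> (s', y)" using that by (auto split: if_splits)
        from agreesD[OF a this] show ?thesis by (rule sym)
      qed
    qed (use ne in auto)
  qed
  show "agrees swap c (dtau k) (apply_dop DS F)"
    unfolding agrees_def using P_dtau[OF Pk] DERIV_imp_deriv[OF D] by simp
  show "off_diag p \<Longrightarrow> dop_exists DS F p"
    by (cases p) (auto intro!: differentiableI[OF D[unfolded has_field_derivative_def]])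
qed

text \<open>Time enters as \<open>s - t\<close>, so each derivative in \<open>t\<close> contributes
  a sign; these make up the factor \<open>(- 1) ^ \<beta>\<close>.\<close>

lemma agrees_DT:
  assumes a: "agrees swap c k F"
  shows "agrees swap (- c) (dtau k) (apply_dop DT F)" "off_diag p \<Longrightarrow> dop_exists DT F p"
proof -
  have Pk: "P k" using a by (simp add: agrees_def)
  have D: "((\<lambda>t'. F (t', x, s, y)) has_real_derivative
      (- c) * \<Phi> (dtau k) (s - t) (if swap then y else x) (if swap then x else y)) (at t)"
    if ne: "(t, x) \<noteq> (s, y)" for t x s y
  proof -
    let ?x = "if swap then y else x" and ?y = "if swap then x else y"
    let ?S = "if x = y then - {s} else UNIV"
    have "(s - t, ?x) \<noteq> (0, ?y)" using ne by auto
    from \<Phi>_dtau[OF Pk this] have "((\<lambda>\<tau>. \<Phi> k \<tau> ?x ?y) has_real_derivative \<Phi> (dtau k) (s - t) ?x ?y) (at (s - t))" .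
    moreover have "((\<lambda>t'. s - t') has_real_derivative - 1) (at t)" by (auto intro!: derivative_eq_intros)
    ultimately have "((\<lambda>t'. \<Phi> k (s - t') ?x ?y) has_real_derivative \<Phi> (dtau k) (s - t) ?x ?y * - 1) (at t)"
      by (rule DERIV_chain2)
    then have "((\<lambda>t'. c * \<Phi> k (s - t') ?x ?y) has_real_derivative c * (\<Phi> (dtau k) (s - t) ?x ?y * - 1)) (at t)"
      by (rule DERIV_cmult)
    then have "((\<lambda>t'. c * \<Phi> k (s - t') ?x ?y) has_real_derivative (- c) * \<Phi> (dtau k) (s - t) ?x ?y) (at t)" by simp
    then show ?thesis
    proof (rule has_field_derivative_transform_within_open[where S="?S"])
      show "c * \<Phi> k (s - t') ?x ?y = F (t', x, s, y)" if "t' \<in> ?S" for t'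
      proof -
        have "(t', x) \<noteq> (s, y)" using that by (auto split: if_splits)
        from agreesD[OF a this] show ?thesis by (rule sym)
      qed
    qed (use ne in auto)
  qed
  show "agrees swap (- c) (dtau k) (apply_dop DT F)"
    unfolding agrees_def using P_dtau[OF Pk] DERIV_imp_deriv[OF D] by simp
  show "off_diag p \<Longrightarrow> dop_exists DT F p"
    by (cases p) (auto intro!: differentiableI[OF D[unfolded has_field_derivative_def]])
qed

lemma agrees_DY:
  assumes a: "agrees False c k F" and j: "j \<in> {1..m}"
  shows "agrees False c (zop (Z j) k) (apply_dop (DY (X j)) F)" "off_diag p \<Longrightarrow> dop_exists (DY (X j)) F p"
proof -
  have Pk: "P k" using a by (simp add: agrees_def)
  have D: "(\<lambda>y'. F (t, x, s, y')) differentiable (at y)"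
    "frechet_derivative (\<lambda>y'. F (t, x, s, y')) (at y) (X j y) = c * \<Phi> (zop (Z j) k) (s - t) x y"
    if ne: "(t, x) \<noteq> (s, y)" for t x s y
  proof -
    let ?S = "if t = s then - {x} else UNIV"
    have ne': "(s - t, x) \<noteq> (0, y)" using ne by auto
    have S: "open ?S" "y \<in> ?S" using ne by auto
    have eq: "F (t, x, s, y') = c * \<Phi> k (s - t) x y'" if "y' \<in> ?S" for y'
      using a that by (auto simp: agrees_def split: if_splits)
    note * = scaled_deriv[OF S eq \<Phi>_diff[OF Pk ne']]
    show "(\<lambda>y'. F (t, x, s, y')) differentiable (at y)" by (rule *(1))
    show "frechet_derivative (\<lambda>y'. F (t, x, s, y')) (at y) (X j y) = c * \<Phi> (zop (Z j) k) (s - t) x y"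
      by (simp only: *(2) \<Phi>_zop[OF Pk ne' j])
  qed
  show "agrees False c (zop (Z j) k) (apply_dop (DY (X j)) F)"
    unfolding agrees_def using P_zop[OF Pk j] D(2) by simp
  show "off_diag p \<Longrightarrow> dop_exists (DY (X j)) F p" using D(1) by (cases p) auto
qed

lemma agrees_DX:
  assumes a: "agrees True c k F" and j: "j \<in> {1..m}"
  shows "agrees True c (zop (Z j) k) (apply_dop (DX (X j)) F)" "off_diag p \<Longrightarrow> dop_exists (DX (X j)) F p"
proof -
  have Pk: "P k" using a by (simp add: agrees_def)
  have D: "(\<lambda>x'. F (t, x', s, y)) differentiable (at x)"
    "frechet_derivative (\<lambda>x'. F (t, x', s, y)) (at x) (X j x) = c * \<Phi> (zop (Z j) k) (s - t) y x"
    if ne: "(t, x) \<noteq> (s, y)" for t x s y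
  proof -
    let ?S = "if t = s then - {y} else UNIV"
    have ne': "(s - t, y) \<noteq> (0, x)" using ne by auto
    have S: "open ?S" "x \<in> ?S" using ne by auto
    have eq: "F (t, x', s, y) = c * \<Phi> k (s - t) y x'" if "x' \<in> ?S" for x'
      using a that by (auto simp: agrees_def split: if_splits)
    note * = scaled_deriv[OF S eq \<Phi>_diff[OF Pk ne']]
    show "(\<lambda>x'. F (t, x', s, y)) differentiable (at x)" by (rule *(1))
    show "frechet_derivative (\<lambda>x'. F (t, x', s, y)) (at x) (X j x) = c * \<Phi> (zop (Z j) k) (s - t) y x"
      by (simp only: *(2) \<Phi>_zop[OF Pk ne' j])
  qed
  show "agrees True c (zop (Z j) k) (apply_dop (DX (X j)) F)"
    unfolding agrees_def using P_zop[OF Pk j] D(2) by simp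
  show "off_diag p \<Longrightarrow> dop_exists (DX (X j)) F p" using D(1) by (cases p) auto
qed

lemma agrees_map_DY:
  assumes "agrees False c k F" "set js \<subseteq> {1..m}"
  shows "agrees False c (foldr (\<lambda>j. zop (Z j)) js k) (apply_ops (map (\<lambda>j. DY (X j)) js) F) \<and>
    ops_exist off_diag (map (\<lambda>j. DY (X j)) js) F"
  using assms(2)
proof (induction js)
  case (Cons j js)
  then have a: "agrees False c (foldr (\<lambda>j. zop (Z j)) js k) (apply_ops (map (\<lambda>j. DY (X j)) js) F)" and j: "j \<in> {1..m}" by auto
  show ?case using agrees_DY(1)[OF a j] agrees_DY(2)[OF a j] Cons by simp
qed (simp add: assms(1))

lemma agrees_map_DX:
  assumes "agrees True c k F" "set js \<subseteq> {1..m}"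
  shows "agrees True c (foldr (\<lambda>j. zop (Z j)) js k) (apply_ops (map (\<lambda>j. DX (X j)) js) F) \<and>
    ops_exist off_diag (map (\<lambda>j. DX (X j)) js) F"
  using assms(2)
proof (induction js)
  case (Cons j js)
  then have a: "agrees True c (foldr (\<lambda>j. zop (Z j)) js k) (apply_ops (map (\<lambda>j. DX (X j)) js) F)" and j: "j \<in> {1..m}" by auto
  show ?case using agrees_DX(1)[OF a j] agrees_DX(2)[OF a j] Cons by simp
qed (simp add: assms(1))

lemma agrees_replicate_DT:
  assumes "agrees swap c k F"
  shows "agrees swap ((- 1) ^ n * c) ((dtau ^^ n) k) (apply_ops (replicate n DT) F) \<and> ops_exist off_diag (replicate n DT) F"
proof (induction n)
  case (Suc n)
  then have a: "agrees swap ((- 1) ^ n * c) ((dtau ^^ n) k) (apply_ops (replicate n DT) F)" by simp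
  show ?case using agrees_DT(1)[OF a] agrees_DT(2)[OF a] Suc by simp
qed (simp add: assms)

lemma agrees_replicate_DS:
  assumes "agrees swap c k F"
  shows "agrees swap c ((dtau ^^ n) k) (apply_ops (replicate n DS) F) \<and> ops_exist off_diag (replicate n DS) F"
proof (induction n)
  case (Suc n)
  then have a: "agrees swap c ((dtau ^^ n) k) (apply_ops (replicate n DS) F)" by simp
  show ?case using agrees_DS(1)[OF a] agrees_DS(2)[OF a] Suc by simp
qed (simp add: assms)

lemma agrees_time:
  assumes a: "agrees swap 1 k (apply_ops ops F)" and e: "ops_exist off_diag ops F"
  shows "agrees swap ((- 1) ^ \<beta>) ((dtau ^^ (\<alpha> + \<beta>)) k) (apply_ops (replicate \<alpha> DS @ replicate \<beta> DT @ ops) F)"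
    and "ops_exist off_diag (replicate \<alpha> DS @ replicate \<beta> DT @ ops) F"
proof -
  note 1 = agrees_replicate_DT[OF a, of \<beta>]
  note 2 = agrees_replicate_DS[OF conjunct1[OF 1], of \<alpha>]
  show "agrees swap ((- 1) ^ \<beta>) ((dtau ^^ (\<alpha> + \<beta>)) k) (apply_ops (replicate \<alpha> DS @ replicate \<beta> DT @ ops) F)"
    using 2 by (simp add: apply_ops_append funpow_add)
  show "ops_exist off_diag (replicate \<alpha> DS @ replicate \<beta> DT @ ops) F"
    using e 1 2 by (simp add: apply_ops_append ops_exist_append)
qed

end

section \<open>The derivative formulas for the fundamental solution on R^(1+n)\<close>

theorem theorem1p5:
  fixes m :: nat
    and X :: "nat \<Rightarrow> (real^('n::{finite,wellorder})) \<Rightarrow> (real^('n::{finite,wellorder}))"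
    and \<sigma> :: "'n \<Rightarrow> real"
    and star :: "(real^('n::{finite,wellorder})) \<times> (real^('p::finite)) \<Rightarrow> (real^('n::{finite,wellorder})) \<times> (real^('p::finite)) \<Rightarrow> (real^('n::{finite,wellorder})) \<times> (real^('p::finite))"
    and ginv :: "(real^('n::{finite,wellorder})) \<times> (real^('p::finite)) \<Rightarrow> (real^('n::{finite,wellorder})) \<times> (real^('p::finite))"
    and \<sigma>s :: "'p \<Rightarrow> real"
    and Z :: "nat \<Rightarrow> (real^('n::{finite,wellorder})) \<times> (real^('p::finite)) \<Rightarrow> (real^('n::{finite,wellorder})) \<times> (real^('p::finite))"
    and gam :: "real \<times> ((real^('n::{finite,wellorder})) \<times> (real^('p::finite))) \<Rightarrow> real"
    and \<alpha> \<beta> :: nat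
    and "is" js :: "nat list"
  defines "D \<equiv> (\<lambda>lam (x, \<xi>). (dil \<sigma> lam x, dil \<sigma>s lam \<xi>))"
    and "Gam \<equiv> (\<lambda>(t, x, s, y).
            \<integral>\<eta>. gam (s - t, star (ginv (x, 0)) (y, \<eta>)) \<partial>lborel)"
    and "Omega \<equiv> (\<lambda>(t, x, s, y). (t, x) \<noteq> (s, y))"
  assumes
    \<comment> \<open>the vector fields X_1..X_m: smooth and linearly independent\<close>
    X_smooth: "\<forall>j\<in>{1..m}. Cinf_on UNIV (X j)"
    and X_indep: "fun_lin_indep (map X [1..<m+1])"
    \<comment> \<open>(H.1)\<close>
    and sigma_mono: "\<forall>i j. i \<le> j \<longrightarrow> \<sigma> i \<le> \<sigma> j"
    and sigma_first: "\<forall>i. (\<forall>j. i \<le> j) \<longrightarrow> \<sigma> i = 1"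
    and X_homog: "\<forall>j\<in>{1..m}. homog1 (dil \<sigma>) (X j)"
    \<comment> \<open>(H.2)\<close>
    and H2: "dim {Y 0 | Y. Y \<in> lie_gen (X ` {1..m})} = CARD('n)"
    \<comment> \<open>N = dim Lie{X} with N = n + p (N > n is automatic since p >= 1)\<close>
    and lie_dim: "has_fun_dim (lie_gen (X ` {1..m})) (CARD('n) + CARD('p))"
    \<comment> \<open>homogeneous Carnot group G = (R^N, star) with dilations D\<close>
    and G_assoc: "\<forall>a b c. star (star a b) c = star a (star b c)"
    and G_unit: "\<forall>a. star 0 a = a \<and> star a 0 = a"
    and G_inv: "\<forall>a. star a (ginv a) = 0 \<and> star (ginv a) a = 0"
    and G_smooth: "Cinf_on UNIV (\<lambda>(a, b). star a b)"
    and G_inv_smooth: "Cinf_on UNIV ginv"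
    and sigmas_pos: "\<forall>i. \<sigma>s i > 0"
    and D_auto: "\<forall>lam a b. lam > 0 \<longrightarrow> D lam (star a b) = star (D lam a) (D lam b)"
    \<comment> \<open>the lifting vector fields Z_1..Z_m\<close>
    and Z_smooth: "\<forall>i\<in>{1..m}. Cinf_on UNIV (Z i)"
    and Z_left_inv: "\<forall>i\<in>{1..m}. left_inv star (Z i)"
    and Z_homog: "\<forall>i\<in>{1..m}. homog1 D (Z i)"
    and Z_generate: "lie_gen (Z ` {1..m}) = {V. Cinf_on UNIV V \<and> left_inv star V}"
    and Z_lift: "\<forall>i\<in>{1..m}. \<forall>f. Cinf_on UNIV f \<longrightarrow>
                   (\<forall>x \<xi>. vf_app (Z i) (\<lambda>z. f (fst z)) (x, \<xi>) = vf_app (X i) f x)"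
    \<comment> \<open>gam: the fundamental solution of H_G with pole at 0 vanishing at infinity\<close>
    and gam_fund: "fund_sol_origin m Z gam"
    and gam_smooth: "Cinf_on (UNIV - {0}) gam"
    and gam_infty: "(gam \<longlongrightarrow> 0) at_infinity"
    \<comment> \<open>indices\<close>
    and is_ne: "is \<noteq> []" and is_range: "set is \<subseteq> {1..m}"
    and js_ne: "js \<noteq> []" and js_range: "set js \<subseteq> {1..m}"
  shows
    "(let ops = replicate \<alpha> DS @ replicate \<beta> DT @ map (\<lambda>i. DY (X i)) is;
          rhs = (dtau ^^ (\<alpha> + \<beta>)) (foldr (\<lambda>i. zop (Z i)) is gam)
      in ops_exist Omega ops Gam \<and>
         (\<forall>t x s y. Omega (t, x, s, y) \<longrightarrow>
            integrable lborel (\<lambda>\<eta>. rhs (s - t, star (ginv (x, 0)) (y, \<eta>))) \<and>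
            apply_ops ops Gam (t, x, s, y) =
              (-1) ^ \<beta> * (\<integral>\<eta>. rhs (s - t, star (ginv (x, 0)) (y, \<eta>)) \<partial>lborel)))
     \<and>
     (let ops = replicate \<alpha> DS @ replicate \<beta> DT @ map (\<lambda>j. DX (X j)) js;
          rhs = (dtau ^^ (\<alpha> + \<beta>)) (foldr (\<lambda>j. zop (Z j)) js gam)
      in ops_exist Omega ops Gam \<and>
         (\<forall>t x s y. Omega (t, x, s, y) \<longrightarrow>
            integrable lborel (\<lambda>\<eta>. rhs (s - t, star (ginv (y, 0)) (x, \<eta>))) \<and>
            apply_ops ops Gam (t, x, s, y) =
              (-1) ^ \<beta> * (\<integral>\<eta>. rhs (s - t, star (ginv (y, 0)) (x, \<eta>)) \<partial>lborel)))
     \<and>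
     (let ops = replicate \<alpha> DS @ replicate \<beta> DT @ map (\<lambda>j. DX (X j)) js
                  @ map (\<lambda>i. DY (X i)) is;
          rhs = (dtau ^^ (\<alpha> + \<beta>))
                  (foldr (\<lambda>j. zop (Z j)) js
                     ((foldr (\<lambda>i. zop (Z i)) is gam) \<circ> (\<lambda>(\<tau>, z). (\<tau>, ginv z))))
      in ops_exist Omega ops Gam \<and>
         (\<forall>t x s y. Omega (t, x, s, y) \<longrightarrow>
            integrable lborel (\<lambda>\<eta>. rhs (s - t, star (ginv (y, 0)) (x, \<eta>))) \<and>
            apply_ops ops Gam (t, x, s, y) =
              (-1) ^ \<beta> * (\<integral>\<eta>. rhs (s - t, star (ginv (y, 0)) (x, \<eta>)) \<partial>lborel)))"
  proof -
  \<comment> \<open>The dilations \<open>D\<close> are given by indices, \<open>wdil\<close> by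
    basis vectors; \<open>axis_index\<close> translates between the two.\<close>
  define wt :: "((real, 'n) vec) \<times> (real^'p) \<Rightarrow> real" where
    "wt = pair_wt (\<lambda>e. \<sigma> (axis_index e)) (\<lambda>e. \<sigma>s (axis_index e))"
  have axis_dil: "dil sg l x = wdil (\<lambda>e. sg (axis_index e)) l x" for sg :: "'i::finite \<Rightarrow> real" and l and x :: "real^'i"
  proof -
    have "dil sg l x $ i = wdil (\<lambda>e. sg (axis_index e)) l x $ i" for i
      using wdil_inner[of "axis i (1::real)" "\<lambda>e. sg (axis_index e)" l x]
      by (simp add: dil_def axis_in_Basis_iff inner_axis)
    then show ?thesis by (simp add: vec_eq_iff)
  qed
  have D_eq: "D = wdil wt"
    by (rule ext) (auto simp: D_def wt_def wdil_pair_wt axis_dil fun_eq_iff)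
  have sigma_pos: "\<sigma> i > 0" for i
  proof -
    \<comment> \<open>The well-order on the index type supplies a first index, whose weight is 1;
      monotonicity makes all weights positive.\<close>
    define i0 :: 'n where "i0 = (LEAST i. True)"
    have "\<forall>j. i0 \<le> j" unfolding i0_def by (simp add: Least_le)
    then have "\<sigma> i0 = 1" "\<sigma> i0 \<le> \<sigma> i" using sigma_first sigma_mono by blast+
    then show ?thesis by simp
  qed
  interpret G: hgroup star ginv wt
  proof
    show "pos_wt wt" unfolding wt_def
      by (intro pos_pair_wt) (auto simp: pos_wt_def sigma_pos sigmas_pos)
    show "wdil wt l (star a b) = star (wdil wt l a) (wdil wt l b)" if "l > 0" for l a b
      using D_auto that unfolding D_eq by blast
  qed (use G_assoc G_unit G_inv G_smooth G_inv_smooth in blast)+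
  have lift: "fst (Z j (x, \<xi>)) = X j x" if j: "j \<in> {1..m}" for j x \<xi>
  proof (rule euclidean_eqI)
    fix b :: "(real, 'n) vec"
    have "vf_app (Z j) (\<lambda>z. fst z \<bullet> b) (x, \<xi>) = vf_app (X j) (\<lambda>x. x \<bullet> b) x"
      using Z_lift[rule_format, OF j Cinf_on_inner_const, of b x \<xi>] .
    moreover have "vf_app (Z j) (\<lambda>z. fst z \<bullet> b) (x, \<xi>) = fst (Z j (x, \<xi>)) \<bullet> b"
      unfolding vf_app_def by (rule frechet_derivative_eqI) (auto intro!: derivative_eq_intros)
    moreover have "vf_app (X j) (\<lambda>x. x \<bullet> b) x = X j x \<bullet> b"
      unfolding vf_app_def by (rule frechet_derivative_eqI) (auto intro!: derivative_eq_intros)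
    ultimately show "fst (Z j (x, \<xi>)) \<bullet> b = X j x \<bullet> b" by simp
  qed
  have gen: "Cinf_on UNIV V \<and> projectable V" if V: "V \<in> Z ` {1..m}" for V
  proof -
    obtain j where j: "j \<in> {1..m}" "V = Z j" using V by blast
    have "fst (Z j p) = X j (fst p)" for p using lift[OF j(1), of "fst p" "snd p"] by simp
    then show ?thesis using Z_smooth j by (simp add: projectable_def)
  qed
  \<comment> \<open>\<open>Z_generate\<close> places every smooth left-invariant field in the Lie
    algebra generated by the \<open>Z j\<close>, whose members all project.\<close>
  have proj: "projectable (G.linv_field v)" for v
  proof -
    have "Cinf_on UNIV (\<lambda>z. (\<lambda>(z, v). G.linv_field v z) (z, v))"
      by (rule Cinf_on_compose_UNIV[OF open_UNIV G.Cinf_on_linv_field])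
        (intro Cinf_on_Pair Cinf_on_ident Cinf_on_const open_UNIV)
    then have "G.linv_field v \<in> lie_gen (Z ` {1..m})"
      unfolding Z_generate using G.left_inv_linv_field by simp
    from lie_gen_projectable[OF gen this] show ?thesis by blast
  qed
  interpret L: lift_group star ginv wt m Z X
  proof
    show "fst (star z1 a) = fst (star z2 a)" if "fst z1 = fst z2" for z1 z2 a
      by (rule fibre_invariant[OF G.hgroup_axioms proj that])
    show "homog1 (wdil wt) (Z j)" if "j \<in> {1..m}" for j using Z_homog that unfolding D_eq by blast
  qed (use Z_smooth Z_left_inv lift in blast)+
  have green: "L.green gam"
    unfolding L.green_def
  proof (intro conjI allI impI)
    show "loc_int gam" using gam_fund by (auto simp: fund_sol_origin_def loc_int_def)
    fix \<phi> :: "real \<times> ((real, 'n) vec) \<times> (real^'p) \<Rightarrow> real" assume t: "test_fun \<phi>"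
    then have "(\<integral>\<zeta>. gam \<zeta> * heat_transpose m Z \<phi> \<zeta> \<partial>lborel) = - \<phi> 0"
      using gam_fund by (auto simp: fund_sol_origin_def test_fun_def)
    then show "(\<integral>\<zeta>. gam \<zeta> * heatT m Z \<phi> \<zeta> \<partial>lborel) = - \<phi> 0"
      using t by (simp add: L.heat_transpose_eq test_fun_def)
  qed (rule gam_infty)
  note gc = Cinf_on_continuous[OF gam_smooth]
  have gam_hom: "L.hom_class L.hom_dim gam"
    unfolding L.hom_class_def using gam_smooth L.green_homogeneous[OF green gc] by blast
  \<comment> \<open>The kernels that decay at least as fast as \<open>gam\<close>: derivatives only
    increase the exponent, and the bound \<open>hom_dim\<close> guarantees convergence on
    fibres.\<close>
  define P where "P = (\<lambda>k. \<exists>d\<ge>L.hom_dim. L.hom_class d k)"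
  have P_dtau: "P (dtau k)" if Pk: "P k" for k
  proof -
    obtain d where "d \<ge> L.hom_dim" "L.hom_class d k" using Pk unfolding P_def by blast
    then show ?thesis unfolding P_def by (intro exI[of _ "d + 2"]) (auto intro: L.hom_class_dtau)
  qed
  have P_zop: "P (zop (Z j) k)" if Pk: "P k" and j: "j \<in> {1..m}" for k j
  proof -
    obtain d where "d \<ge> L.hom_dim" "L.hom_class d k" using Pk unfolding P_def by blast
    then show ?thesis unfolding P_def using j by (intro exI[of _ "d + 1"]) (auto intro: L.hom_class_zop)
  qed
  have P_refl: "P (\<lambda>\<zeta>. k (L.refl_inv \<zeta>))" if Pk: "P k" for k
  proof -
    obtain d where d: "d \<ge> L.hom_dim" "L.hom_class d k" using Pk unfolding P_def by blast
    show ?thesis unfolding P_def using d(1) L.hom_class_refl[OF d(2)] by blast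
  qed
  have P_gam: "P gam" unfolding P_def using gam_hom by blast
  interpret K: kernel_calculus P L.fibre_int m Z X
  proof
    fix k and \<tau> :: real and x y :: "(real, 'n) vec" assume "P k" and ne: "(\<tau>, x) \<noteq> (0, y)"
    then obtain d where d: "L.hom_class d k" "d \<ge> L.hom_dim" unfolding P_def by blast
    note 1 = L.fibre_int_derivatives[OF d ne]
    show "((\<lambda>\<tau>. L.fibre_int k \<tau> x y) has_real_derivative L.fibre_int (dtau k) \<tau> x y) (at \<tau>)" by (rule 1(2))
    show "(\<lambda>y. L.fibre_int k \<tau> x y) differentiable (at y)" by (rule 1(3))
    show "frechet_derivative (\<lambda>y. L.fibre_int k \<tau> x y) (at y) (X j y) = L.fibre_int (zop (Z j) k) \<tau> x y"
      if "j \<in> {1..m}" for j using that by (rule 1(4))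
  qed (use P_dtau P_zop in auto)
  have int: "integrable lborel (\<lambda>\<eta>. k (s - t, star (ginv (x, 0)) (y, \<eta>)))"
    if "P k" "(t, x) \<noteq> (s, y)" for k s t and x y :: "(real, 'n) vec"
  proof -
    obtain d where d: "L.hom_class d k" "d \<ge> L.hom_dim" using \<open>P k\<close> unfolding P_def by blast
    have "(s - t, x) \<noteq> (0, y)" using that(2) by auto
    from L.fibre_int_derivatives(1)[OF d this] show ?thesis .
  qed
  have Gam_eq: "Gam (t, x, s, y) = L.fibre_int gam (s - t) x y" for t x s y
    by (simp add: Gam_def L.fibre_int_def)
  have reflect: "L.fibre_int k \<tau> x y = L.fibre_int (\<lambda>\<zeta>. k (L.refl_inv \<zeta>)) \<tau> y x" for k \<tau> and x y :: "(real, 'n) vec"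
    unfolding L.fibre_int_def by (rule L.integral_reflect_fibre)
  \<comment> \<open>Off the diagonal no point of the fibre is the pole, so the pointwise symmetry of
    \<open>gam\<close> can be used under the integral after reflecting.\<close>
  have sym: "L.fibre_int gam (s - t) x y = L.fibre_int gam (s - t) y x" if "(t, x) \<noteq> (s, y)" for s t x y
  proof -
    have "(s - t, star (ginv (y, 0)) (x, \<eta>)) \<noteq> 0" for \<eta>
      using that by (auto simp: zero_prod_def G.star_ginv_eq_0[unfolded zero_prod_def])
    then have "gam (L.refl_inv (s - t, star (ginv (y, 0)) (x, \<eta>))) = gam (s - t, star (ginv (y, 0)) (x, \<eta>))" for \<eta>
      by (rule L.green_symmetric[OF green gc])
    then show ?thesis unfolding reflect[of gam "s - t" x y] by (simp add: L.fibre_int_def)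
  qed
  have Om: "Omega = off_diag" by (simp add: Omega_def)
  have a1: "K.agrees False 1 gam Gam"
    unfolding K.agrees_def using P_gam Gam_eq by simp
  \<comment> \<open>By this symmetry \<open>Gam\<close> has the swapped form with the same kernel,
    which is what the formula for derivatives in \<open>x\<close> alone needs.\<close>
  have a2: "K.agrees True 1 gam Gam"
    unfolding K.agrees_def Gam_eq if_True mult_1 using P_gam sym by blast
  \<comment> \<open>For a kernel already differentiated in \<open>y\<close> there is no symmetry to
    appeal to. Swapping composes it with \<open>refl_inv\<close>, and the derivatives in
    \<open>x\<close> then act on the composite.\<close>
  have swap: "K.agrees True 1 (\<lambda>\<zeta>. k (L.refl_inv \<zeta>)) F" if "K.agrees False 1 k F" for k F
    using that P_refl unfolding K.agrees_def if_True if_False reflect[of k] by blast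
  note y = K.agrees_map_DY[OF a1 is_range]
  note x = K.agrees_map_DX[OF a2 js_range]
  note xy = K.agrees_map_DX[OF swap[OF conjunct1[OF y]] js_range]
  have refl: "(\<lambda>\<zeta>. f (L.refl_inv \<zeta>)) = f \<circ> (\<lambda>(\<tau>, z). (\<tau>, ginv z))" for f
    by (simp add: L.refl_inv_def comp_def)
  have xy': "K.agrees True 1 (foldr (\<lambda>j. zop (Z j)) js ((foldr (\<lambda>i. zop (Z i)) is gam) \<circ> (\<lambda>(\<tau>, z). (\<tau>, ginv z))))
      (apply_ops (map (\<lambda>j. DX (X j)) js @ map (\<lambda>i. DY (X i)) is) Gam)"
    "ops_exist off_diag (map (\<lambda>j. DX (X j)) js @ map (\<lambda>i. DY (X i)) is) Gam"
    using xy y unfolding refl apply_ops_append ops_exist_append by blast+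
  have concl: "\<forall>t x s y. off_diag (t, x, s, y) \<longrightarrow>
      integrable lborel (\<lambda>\<eta>. k (s - t, star (ginv (if sw then y else x, 0)) (if sw then x else y, \<eta>))) \<and>
      F (t, x, s, y) = c * (\<integral>\<eta>. k (s - t, star (ginv (if sw then y else x, 0)) (if sw then x else y, \<eta>)) \<partial>lborel)"
    if a: "K.agrees sw c k F" for sw c k F
  proof (intro allI impI conjI)
    fix t s :: real and x y :: "(real, 'n) vec" assume "off_diag (t, x, s, y)"
    then have ne: "(t, x) \<noteq> (s, y)" by simp
    then have "(t, if sw then y else x) \<noteq> (s, if sw then x else y)" by auto
    moreover have "P k" using a by (simp add: K.agrees_def)
    ultimately show "integrable lborel (\<lambda>\<eta>. k (s - t, star (ginv (if sw then y else x, 0)) (if sw then x else y, \<eta>)))"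
      by (intro int)
    show "F (t, x, s, y) = c * (\<integral>\<eta>. k (s - t, star (ginv (if sw then y else x, 0)) (if sw then x else y, \<eta>)) \<partial>lborel)"
      using K.agreesD[OF a ne] unfolding L.fibre_int_def .
  qed
  show ?thesis
    unfolding Let_def Om
  proof (intro conjI)
    note f = K.agrees_time[where \<alpha>=\<alpha> and \<beta>=\<beta>, OF conjunct1[OF y] conjunct2[OF y]]
    show "ops_exist off_diag (replicate \<alpha> DS @ replicate \<beta> DT @ map (\<lambda>i. DY (X i)) is) Gam" by (rule f(2))
    show "\<forall>t x s y. off_diag (t, x, s, y) \<longrightarrow>
        integrable lborel (\<lambda>\<eta>. (dtau ^^ (\<alpha> + \<beta>)) (foldr (\<lambda>i. zop (Z i)) is gam) (s - t, star (ginv (x, 0)) (y, \<eta>))) \<and>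
        apply_ops (replicate \<alpha> DS @ replicate \<beta> DT @ map (\<lambda>i. DY (X i)) is) Gam (t, x, s, y) =
          (-1) ^ \<beta> * (\<integral>\<eta>. (dtau ^^ (\<alpha> + \<beta>)) (foldr (\<lambda>i. zop (Z i)) is gam) (s - t, star (ginv (x, 0)) (y, \<eta>)) \<partial>lborel)"
      using concl[OF f(1)] unfolding if_False .
  next
    note f = K.agrees_time[where \<alpha>=\<alpha> and \<beta>=\<beta>, OF conjunct1[OF x] conjunct2[OF x]]
    show "ops_exist off_diag (replicate \<alpha> DS @ replicate \<beta> DT @ map (\<lambda>j. DX (X j)) js) Gam" by (rule f(2))
    show "\<forall>t x s y. off_diag (t, x, s, y) \<longrightarrow>
        integrable lborel (\<lambda>\<eta>. (dtau ^^ (\<alpha> + \<beta>)) (foldr (\<lambda>j. zop (Z j)) js gam) (s - t, star (ginv (y, 0)) (x, \<eta>))) \<and>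
        apply_ops (replicate \<alpha> DS @ replicate \<beta> DT @ map (\<lambda>j. DX (X j)) js) Gam (t, x, s, y) =
          (-1) ^ \<beta> * (\<integral>\<eta>. (dtau ^^ (\<alpha> + \<beta>)) (foldr (\<lambda>j. zop (Z j)) js gam) (s - t, star (ginv (y, 0)) (x, \<eta>)) \<partial>lborel)"
      using concl[OF f(1)] unfolding if_True .
  next
    note f = K.agrees_time[where \<alpha>=\<alpha> and \<beta>=\<beta>, OF xy']
    show "ops_exist off_diag (replicate \<alpha> DS @ replicate \<beta> DT @ map (\<lambda>j. DX (X j)) js @ map (\<lambda>i. DY (X i)) is) Gam"
      by (rule f(2))
    show "\<forall>t x s y. off_diag (t, x, s, y) \<longrightarrow>
        integrable lborel (\<lambda>\<eta>. (dtau ^^ (\<alpha> + \<beta>)) (foldr (\<lambda>j. zop (Z j)) js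
            ((foldr (\<lambda>i. zop (Z i)) is gam) \<circ> (\<lambda>(\<tau>, z). (\<tau>, ginv z)))) (s - t, star (ginv (y, 0)) (x, \<eta>))) \<and>
        apply_ops (replicate \<alpha> DS @ replicate \<beta> DT @ map (\<lambda>j. DX (X j)) js @ map (\<lambda>i. DY (X i)) is) Gam (t, x, s, y) =
          (-1) ^ \<beta> * (\<integral>\<eta>. (dtau ^^ (\<alpha> + \<beta>)) (foldr (\<lambda>j. zop (Z j)) js
            ((foldr (\<lambda>i. zop (Z i)) is gam) \<circ> (\<lambda>(\<tau>, z). (\<tau>, ginv z)))) (s - t, star (ginv (y, 0)) (x, \<eta>)) \<partial>lborel)"
      using concl[OF f(1)] unfolding if_True .
  qed
qed

end
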